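(* Let $\frac12\le H<\frac34$, let $u$ be the mild solution of the one-dimensional stochastic wave equation with zero initial conditions driven by the fractional-white noise $W^H$, fix $x\in\mathbb R$, and let $$V_N=\frac1N\sum_{i=0}^{N-1}\left\{\left(u\left(\tfrac{i+1}{N},x\right)-u\left(\tfrac iN,x\right)\right)^2-\mathbb E\left[\left(u\left(\tfrac{i+1}{N},x\right)-u\left(\tfrac iN,x\right)\right)^2\right]\right\},\qquad F_N=\frac{V_N}{\sqrt{\mathbb E[V_N^2]}}.$$ Then $F_N$ converges in law to the standard normal distribution $N(0,1)$ as $N\to\infty$. Moreover, for $d$ being any of the Kolmogorov, Wasserstein or total variation distances, there is a constant $C$ (depending on $H$) such that for all sufficiently large $N$ $$d(F_N,N(0,1))\le C\cdot\begin{cases}N^{-\frac12}&\text{if }H\in[\frac12,\frac58),\\ N^{-\frac12}(\log N)^{\frac32}&\text{if }H=\frac58,\\ N^{4H-3}&\text{if }H\in(\frac58,\frac34).\end{cases}$$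
   Context: The equation is $\partial_t^2u=\partial_x^2u+\dot W^H$ for $t\ge0$, $x\in\mathbb R$, with $u(0,x)=0$ and $\partial_tu(0,x)=0$. The noise $W^H$ is centred Gaussian, fractional in time with Hurst parameter $H$ and white in space: the Wiener integrals of deterministic functions $f,g$ on $[0,\infty)\times\mathbb R$ are jointly centred Gaussian with $$\mathbb E\Big[\int f\,dW^H\int g\,dW^H\Big]=H(2H-1)\int_0^\infty\!\int_0^\infty\!\int_{\mathbb R}f(r,y)g(v,y)|r-v|^{2H-2}\,dy\,dv\,dr\quad\text{if } H>\tfrac12,$$ and $=\int_0^\infty\int_{\mathbb R}f(r,y)g(r,y)\,dy\,dr$ if $H=\frac12$. The mild solution is the centred Gaussian field $u(t,x)=\int_0^t\int_{\mathbb R}G_1(t-r,x-y)\,W^H(dr,dy)$ with $G_1(t,x)=\frac12\mathbf 1_{\{|x|<t\}}$. Distances between a random variable and $N(0,1)$ are distances between their laws. *)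

theory Defs
  imports "HOL-Probability.Probability"
begin

definition centered_normal :: "real \<Rightarrow> real measure" where
  "centered_normal \<sigma> =
     (if \<sigma> = 0 then return borel 0 else density lborel (normal_density 0 \<sigma>))"

definition noise_inner ::
  "real \<Rightarrow> (real \<Rightarrow> real \<Rightarrow> real) \<Rightarrow> (real \<Rightarrow> real \<Rightarrow> real) \<Rightarrow> real" where
  "noise_inner H f g =
     (if H = 1/2
      then LINT r:{0..}|lborel. LINT y|lborel. f r y * g r y
      else H * (2 * H - 1) *
        (LINT r:{0..}|lborel. LINT v:{0..}|lborel. LINT y|lborel.
           f r y * g v y * \<bar>r - v\<bar> powr (2 * H - 2)))"

text \<open>The deterministic integrands (time variable first) are the measurable functions for which
  the integral defining their squared norm converges absolutely; only the values at nonnegative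
  times matter. The kernel being positive definite, the integrals \<open>noise_inner H f g\<close> of two
  such functions also converge absolutely.\<close>

definition wiener_integrand :: "real \<Rightarrow> (real \<Rightarrow> real \<Rightarrow> real) \<Rightarrow> bool" where
  "wiener_integrand H f \<longleftrightarrow>
     case_prod f \<in> borel_measurable borel \<and>
     (if H = 1/2
      then set_integrable lborel ({0..} \<times> UNIV) (\<lambda>(r, y). (f r y)\<^sup>2)
      else set_integrable lborel ({0..} \<times> {0..} \<times> UNIV)
        (\<lambda>(r, v, y). f r y * f v y * \<bar>r - v\<bar> powr (2 * H - 2)))"

text \<open>\<open>W f\<close> is the Wiener integral of \<open>f\<close> against the noise. Joint Gaussianity of the family is
  expressed by all finite linear combinations having a (possibly degenerate) normal law.\<close>

locale fractional_white_noise = prob_space M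
  for M :: "'a measure" and H :: real and W :: "(real \<Rightarrow> real \<Rightarrow> real) \<Rightarrow> 'a \<Rightarrow> real" +
  assumes measurable_W: "wiener_integrand H f \<Longrightarrow> W f \<in> borel_measurable M"
    and gaussian_W: "finite S \<Longrightarrow> (\<And>f. f \<in> S \<Longrightarrow> wiener_integrand H f) \<Longrightarrow>
      \<exists>\<sigma>\<ge>0. distr M borel (\<lambda>\<omega>. \<Sum>f\<in>S. c f * W f \<omega>) = centered_normal \<sigma>"
    and covariance_W: "wiener_integrand H f \<Longrightarrow> wiener_integrand H g \<Longrightarrow>
      expectation (\<lambda>\<omega>. W f \<omega> * W g \<omega>) = noise_inner H f g"

definition wave_kernel :: "real \<Rightarrow> real \<Rightarrow> real" where
  "wave_kernel t x = (if \<bar>x\<bar> < t then 1/2 else 0)"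

definition mild_solution ::
  "((real \<Rightarrow> real \<Rightarrow> real) \<Rightarrow> 'a \<Rightarrow> real) \<Rightarrow> real \<Rightarrow> real \<Rightarrow> 'a \<Rightarrow> real" where
  "mild_solution W t x = W (\<lambda>r y. indicator {0..t} r * wave_kernel (t - r) (x - y))"

definition increment ::
  "((real \<Rightarrow> real \<Rightarrow> real) \<Rightarrow> 'a \<Rightarrow> real) \<Rightarrow> real \<Rightarrow> nat \<Rightarrow> nat \<Rightarrow> 'a \<Rightarrow> real" where
  "increment W x N i \<omega> =
     mild_solution W (real (i + 1) / real N) x \<omega> - mild_solution W (real i / real N) x \<omega>"

definition quadratic_variation ::
  "'a measure \<Rightarrow> ((real \<Rightarrow> real \<Rightarrow> real) \<Rightarrow> 'a \<Rightarrow> real) \<Rightarrow> real \<Rightarrow> nat \<Rightarrow> 'a \<Rightarrow> real" where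
  "quadratic_variation M W x N \<omega> =
     1 / real N * (\<Sum>i<N. (increment W x N i \<omega>)\<^sup>2 - (LINT \<omega>'|M. (increment W x N i \<omega>')\<^sup>2))"

definition normalized_variation ::
  "'a measure \<Rightarrow> ((real \<Rightarrow> real \<Rightarrow> real) \<Rightarrow> 'a \<Rightarrow> real) \<Rightarrow> real \<Rightarrow> nat \<Rightarrow> 'a \<Rightarrow> real" where
  "normalized_variation M W x N \<omega> =
     quadratic_variation M W x N \<omega> / sqrt (LINT \<omega>'|M. (quadratic_variation M W x N \<omega>')\<^sup>2)"

text \<open>Distances between probability laws on the real line, valued in \<open>ennreal\<close> so that the
  suprema are always meaningful. The Wasserstein distance (in its dual form) is intended for laws
  with a finite first moment, for which all Lipschitz functions are integrable.\<close>

definition kolmogorov_dist :: "real measure \<Rightarrow> real measure \<Rightarrow> ennreal" where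
  "kolmogorov_dist \<mu> \<nu> = (SUP z. ennreal \<bar>measure \<mu> {..z} - measure \<nu> {..z}\<bar>)"

definition total_variation_dist :: "real measure \<Rightarrow> real measure \<Rightarrow> ennreal" where
  "total_variation_dist \<mu> \<nu> = (SUP A\<in>sets borel. ennreal \<bar>measure \<mu> A - measure \<nu> A\<bar>)"

definition wasserstein_dist :: "real measure \<Rightarrow> real measure \<Rightarrow> ennreal" where
  "wasserstein_dist \<mu> \<nu> =
     (SUP h\<in>{h :: real \<Rightarrow> real. 1-lipschitz_on UNIV h}. ennreal \<bar>(LINT z|\<mu>. h z) - (LINT z|\<nu>. h z)\<bar>)"

definition clt_rate :: "real \<Rightarrow> nat \<Rightarrow> real" where
  "clt_rate H N =
     (if H < 5/8 then real N powr (-1/2)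
      else if H = 5/8 then real N powr (-1/2) * ln (real N) powr (3/2)
      else real N powr (4 * H - 3))"

end

(* The squared increments are quadratic functionals of a Gaussian vector X. By the
   Hubbard-Stratonovich identity |X|^2 has the law of a quadratic form in independent standard
   normals whose matrix R is the covariance matrix of X, so that coordinatewise integration by
   parts and Stein's method apply without diagonalising R: every one of the three distances is at
   most 8 sqrt (2 tr R^4) / tr R^2.

   Integrating out the white spatial direction, the covariance of u(s,x) and u(t,x) is
   (1/2) int_0^oo R_H((s-z)^+, (t-z)^+) dz with R_H the fractional Brownian covariance. Convexity of
   |.|^(2H) therefore squeezes the covariances of the increments between 0 and multiples of
   N^(-2H) (1 + |i-j|)^(2H-2), and bounds the variances below by i/(2N) N^(-2H). Young's inequality
   for the 4-cycle in tr R^4 then yields sqrt (A_N^3 / N) with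
   A_N = sum_(m<N) (1+m)^(-(8-8H)/3), which is the stated rate. *)

theory Submission
  imports Defs "HOL-Real_Asymp.Real_Asymp"
begin

section \<open>Stein's equation\<close>

text \<open>One class of test functions serves all three distances: continuous \<open>h\<close> with
  \<open>\<bar>h y - h x\<bar> \<le> 1 + \<bar>y - x\<bar>\<close>. It contains the 1-Lipschitz
  functions and the continuous functions with values in [0,1]; regularity of Borel measures passes
  from the latter to indicators of Borel sets, so the total variation and Kolmogorov distances
  inherit the rate without any smoothing loss. The ratio in the bound is a standard deviation. For
  the centred and scaled form the Stein kernel is again a quadratic form, with matrix proportional
  to R^2, mean 1 and variance 2 tr R^4 / (tr R^2)^2; the factor 8 bounds the derivative of Stein's
  solution. The covariance matrix R may be singular, and X comes with no representation by
  independent normals. Only the law of |X|^2 enters, and its Laplace transform identifies it. The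
  thresholds in H come from A_N: its exponent (8-8H)/3 equals 1 at H = 5/8, and at H = 3/4 it equals
  2/3, where A_N^3 grows like N and the bound stops vanishing.\<close>

lemma prob_space_std_normal: "prob_space std_normal_distribution"
  by (rule prob_space_normal_density) simp

lemma integrable_std_normal_iff:
  fixes f :: "real \<Rightarrow> real"
  assumes "f \<in> borel_measurable borel"
  shows "integrable std_normal_distribution f \<longleftrightarrow> integrable lborel (\<lambda>x. f x * exp (- x\<^sup>2 / 2))"
proof -
  have "integrable std_normal_distribution f \<longleftrightarrow> integrable lborel (\<lambda>x. std_normal_density x *\<^sub>R f x)"
    using assms by (intro integrable_density) auto
  also have "(\<lambda>x. std_normal_density x *\<^sub>R f x) = (\<lambda>x. 1 / sqrt (2 * pi) * (f x * exp (- x\<^sup>2 / 2)))"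
    by (auto simp: std_normal_density_def fun_eq_iff field_simps)
  also have "integrable lborel \<dots> \<longleftrightarrow> integrable lborel (\<lambda>x. f x * exp (- x\<^sup>2 / 2))"
    by (subst integrable_mult_left_iff) auto
  finally show ?thesis .
qed

lemma integral_std_normal:
  fixes f :: "real \<Rightarrow> real"
  assumes "f \<in> borel_measurable borel"
  shows "integral\<^sup>L std_normal_distribution f = (LINT x|lborel. f x * exp (- x\<^sup>2 / 2)) / sqrt (2 * pi)"
proof -
  have "integral\<^sup>L std_normal_distribution f = integral\<^sup>L lborel (\<lambda>x. std_normal_density x *\<^sub>R f x)"
    using assms by (intro integral_density) auto
  also have "(\<lambda>x. std_normal_density x *\<^sub>R f x) = (\<lambda>x. 1 / sqrt (2 * pi) * (f x * exp (- x\<^sup>2 / 2)))"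
    by (auto simp: std_normal_density_def fun_eq_iff field_simps)
  finally show ?thesis by (simp add: field_simps)
qed

lemma integrable_gauss: "integrable lborel (\<lambda>x::real. exp (- x\<^sup>2 / 2))"
  and integral_gauss: "(LINT x|lborel. exp (- x\<^sup>2 / 2) :: real) = sqrt (2 * pi)"
proof -
  interpret prob_space std_normal_distribution by (rule prob_space_std_normal)
  show "integrable lborel (\<lambda>x::real. exp (- x\<^sup>2 / 2))"
    using integrable_std_normal_iff[of "\<lambda>_. 1"] by simp
  show "(LINT x|lborel. exp (- x\<^sup>2 / 2) :: real) = sqrt (2 * pi)"
    using integral_std_normal[of "\<lambda>_. 1"] prob_space by (simp add: field_simps)
qed

lemma std_normal_moments:
  "integral\<^sup>L std_normal_distribution (\<lambda>x. x) = 0"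
  "integral\<^sup>L std_normal_distribution (\<lambda>x. x\<^sup>2) = 1"
  using integral_std_normal_distribution_moment_odd[of 1] std_normal_distribution_even_moments[of 1]
  by simp_all

text \<open>Averaging the oscillation bound over a standard normal Y costs 1 + |x| + E|Y|, and E|Y|
  is at most 1.\<close>

lemma integrable_lip_normal:
  fixes h :: "real \<Rightarrow> real"
  assumes h: "h \<in> borel_measurable borel" and osc: "\<And>x y. \<bar>h y - h x\<bar> \<le> 1 + \<bar>y - x\<bar>"
  shows "integrable std_normal_distribution h"
    and "\<bar>h x - integral\<^sup>L std_normal_distribution h\<bar> \<le> 2 + \<bar>x\<bar>"
proof -
  interpret prob_space std_normal_distribution by (rule prob_space_std_normal)
  have iabs: "integrable std_normal_distribution (\<lambda>y. \<bar>y\<bar>)"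
    using integrable_std_normal_distribution_moment[of 1] by (intro integrable_abs) simp
  show int: "integrable std_normal_distribution h"
  proof (rule Bochner_Integration.integrable_bound)
    show "integrable std_normal_distribution (\<lambda>y. \<bar>h 0\<bar> + 1 + \<bar>y\<bar>)" using iabs by simp
    show "AE y in std_normal_distribution. norm (h y) \<le> norm (\<bar>h 0\<bar> + 1 + \<bar>y\<bar>)"
      using osc[of _ 0] by (intro AE_I2) (smt (verit, best) real_norm_def)
  qed (use h in auto)
  have "h x - integral\<^sup>L std_normal_distribution h = (LINT y|std_normal_distribution. h x - h y)"
    using int prob_space by simp
  also have "\<bar>\<dots>\<bar> \<le> (LINT y|std_normal_distribution. \<bar>h x - h y\<bar>)"
    using integral_norm_bound[of std_normal_distribution "\<lambda>y. h x - h y"] by simp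
  also have "\<dots> \<le> (LINT y|std_normal_distribution. (3/2 + \<bar>x\<bar>) + y\<^sup>2 / 2)"
  proof (rule integral_mono)
    show "integrable std_normal_distribution (\<lambda>y. (3/2 + \<bar>x\<bar>) + y\<^sup>2 / 2)"
      using integrable_std_normal_distribution_moment[of 2] by simp
    fix y :: real
    \<comment> \<open>Integrated against the normal law, this square yields E|Y| <= 1/2 + 1/2 from
      the second moment alone.\<close>
    have "0 \<le> (\<bar>y\<bar> - 1)\<^sup>2" by (rule zero_le_power2)
    hence "\<bar>y\<bar> \<le> 1/2 + y\<^sup>2/2" by (simp add: power2_diff)
    thus "\<bar>h x - h y\<bar> \<le> (3/2 + \<bar>x\<bar>) + y\<^sup>2 / 2" using osc[of x y] by linarith
  qed (use int in auto)
  also have "\<dots> = 2 + \<bar>x\<bar>"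
    using integrable_std_normal_distribution_moment[of 2] prob_space by (simp add: std_normal_moments)
  finally show "\<bar>h x - integral\<^sup>L std_normal_distribution h\<bar> \<le> 2 + \<bar>x\<bar>" .
qed

lemma mult_exp_minus_le_1:
  fixes t :: real assumes "0 \<le> t" shows "t * exp (- t) \<le> 1"
proof -
  have "t \<le> exp t" using exp_ge_add_one_self[of t] by linarith
  thus ?thesis by (simp add: exp_minus field_simps)
qed

text \<open>The expression is the derivative of Stein's solution at distance \<open>a\<close> from
  the origin. The moments I0, I1 of the weight satisfy a I0 + I1 = 1, so the coefficient 1 - a I0 of
  \<open>k0 - m\<close> collapses to I1. Since a I1 stays bounded, this compensates the linear
  growth of \<open>k0 - m\<close> in \<open>a\<close>.\<close>

lemma gauss_tail_estimate:
  fixes k :: "real \<Rightarrow> real"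
  assumes k: "k \<in> borel_measurable borel" and a: "0 \<le> a"
    and osc: "\<And>u. 0 \<le> u \<Longrightarrow> \<bar>k u - k0\<bar> \<le> 1 + u" and m: "\<bar>k0 - m\<bar> \<le> 2 + a"
  shows "\<bar>k0 - m - a * (LINT u:{0..}|lborel. (k u - m) * exp (- u\<^sup>2 / 2 - a * u))\<bar> \<le> 8"
proof -
  define w where "w u = exp (- u\<^sup>2 / 2 - a * u)" for u :: real
  have [measurable]: "w \<in> borel_measurable borel" unfolding w_def by measurable
  note k[measurable]
  have w0: "0 \<le> w u" for u by (simp add: w_def)
  have wle: "w u \<le> exp (- (u\<^sup>2 / 2))" if "0 \<le> u" for u using that a by (simp add: w_def)
  have s: "integrable lborel (\<lambda>u::real. u * exp (- u\<^sup>2 / 2))"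
    using integrable_std_normal_iff[of "\<lambda>x. x"] integrable_std_normal_distribution_moment[of 1] by simp
  have i0: "set_integrable lborel {0..} w"
    unfolding set_integrable_def
    by (rule Bochner_Integration.integrable_bound[OF integrable_gauss]) (auto simp: indicator_def w0 wle)
  have i1: "set_integrable lborel {0..} (\<lambda>u. u * w u)"
    unfolding set_integrable_def
  proof (rule Bochner_Integration.integrable_bound[OF s])
    have "norm (indicator {0..} u *\<^sub>R (u * w u)) \<le> norm (u * exp (- u\<^sup>2 / 2))" for u
      using mult_left_mono[OF wle[of u], of u] w0[of u] by (cases "0 \<le> u") (auto simp: abs_mult mult_nonpos_nonneg)
    thus "AE u in lborel. norm (indicator {0..} u *\<^sub>R (u * w u)) \<le> norm (u * exp (- u\<^sup>2 / 2))" by simp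
  qed simp
  define I0 where "I0 = (LINT u:{0..}|lborel. w u)"
  define I1 where "I1 = (LINT u:{0..}|lborel. u * w u)"
  have I0: "0 \<le> I0" unfolding I0_def set_lebesgue_integral_def
    by (intro integral_nonneg_AE AE_I2) (auto simp: w0 indicator_def)
  have I1: "0 \<le> I1" unfolding I1_def set_lebesgue_integral_def
    by (intro integral_nonneg_AE AE_I2) (auto simp: w0 indicator_def)
  have aI1: "a * I1 \<le> 3"
  proof -
    have "a * I1 = (LINT u:{0..}|lborel. a * (u * w u))" unfolding I1_def by simp
    also have "\<dots> \<le> (LINT u|lborel. exp (- u\<^sup>2 / 2))"
      unfolding set_lebesgue_integral_def
    proof (rule integral_mono)
      show "integrable lborel (\<lambda>x. indicator {0..} x *\<^sub>R (a * (x * w x)))"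
        using set_integrable_mult_right[OF i1, of a] by (simp add: set_integrable_def)
      fix u :: real
      have "a * (u * w u) \<le> exp (- u\<^sup>2 / 2)" if "0 \<le> u"
      proof -
        have "a * (u * w u) = (a * u) * exp (- (a * u)) * exp (- u\<^sup>2 / 2)"
          by (simp add: w_def algebra_simps flip: exp_add)
        also have "\<dots> \<le> 1 * exp (- u\<^sup>2 / 2)"
          using that a by (intro mult_right_mono mult_exp_minus_le_1) auto
        finally show ?thesis by simp
      qed
      thus "indicator {0..} u *\<^sub>R (a * (u * w u)) \<le> exp (- u\<^sup>2 / 2)" by (simp add: indicator_def)
    qed (rule integrable_gauss)
    also have "\<dots> = sqrt (2 * pi)" by (rule integral_gauss)
    also have "\<dots> \<le> sqrt (3\<^sup>2)" using pi_less_4 by (intro real_sqrt_le_mono) (simp add: power2_eq_square)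
    finally show ?thesis by simp
  qed
  \<comment> \<open>\<open>(a + u) * w u\<close> is the exact derivative of \<open>- w u\<close>,
    and \<open>w 0 = 1\<close>.\<close>
  have sum1: "a * I0 + I1 = 1"
  proof -
    have "(\<integral>\<^sup>+u. ennreal ((a + u) * w u) * indicator {0..} u \<partial>lborel) = ennreal (0 - (- w 0))"
    proof (rule nn_integral_FTC_atLeast)
      show "((\<lambda>u. - w u) \<longlongrightarrow> 0) at_top"
      proof -
        have "((\<lambda>u::real. exp (- u\<^sup>2 / 2)) \<longlongrightarrow> 0) at_top"
          by real_asymp
        moreover have "\<forall>\<^sub>F u in at_top. 0 \<le> w u" by (simp add: w0)
        moreover have "\<forall>\<^sub>F u in at_top. w u \<le> exp (- u\<^sup>2 / 2)"
          using eventually_ge_at_top[of 0] by eventually_elim (simp add: wle)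
        ultimately have "(w \<longlongrightarrow> 0) at_top"
          by (rule tendsto_sandwich[OF _ _ tendsto_const, rotated 2])
        thus ?thesis using tendsto_minus[of w 0 at_top] by simp
      qed
      show "DERIV (\<lambda>u. - w u) x :> (a + x) * w x" for x
        unfolding w_def by (auto intro!: derivative_eq_intros simp: field_simps)
    qed (use a w0 in auto)
    hence "(\<integral>\<^sup>+u. ennreal (indicator {0..} u *\<^sub>R ((a + u) * w u)) \<partial>lborel) = ennreal 1"
      by (subst nn_integral_cong[where v = "\<lambda>u. ennreal ((a + u) * w u) * indicator {0..} u"])
         (auto simp: indicator_def w_def)
    hence "(LINT u:{0..}|lborel. (a + u) * w u) = 1"
      unfolding set_lebesgue_integral_def using a w0
      by (subst integral_eq_nn_integral) (auto simp: indicator_def)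
    also have "(LINT u:{0..}|lborel. (a + u) * w u) = (LINT u:{0..}|lborel. a * w u + u * w u)"
      by (simp add: algebra_simps)
    also have "\<dots> = a * I0 + I1"
      unfolding I0_def I1_def using set_integrable_mult_right[OF i0, of a] i1 by (subst set_integral_add) auto
    finally show ?thesis .
  qed
  have kb: "norm (indicator {0..} u *\<^sub>R ((k u - k0) * w u)) \<le> norm (indicator {0..} u *\<^sub>R (w u + u * w u))" for u
  proof (cases "0 \<le> u")
    case True
    have "\<bar>k u - k0\<bar> * w u \<le> (1 + u) * w u" by (intro mult_right_mono osc w0 True)
    thus ?thesis using True w0[of u] by (simp add: abs_mult distrib_right)
  qed auto
  have i01: "set_integrable lborel {0..} (\<lambda>u. w u + u * w u)" using i0 i1 by (rule set_integral_add)
  have ik: "set_integrable lborel {0..} (\<lambda>u. (k u - k0) * w u)"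
    unfolding set_integrable_def
    by (rule Bochner_Integration.integrable_bound[OF i01[unfolded set_integrable_def]]) (use kb in auto)
  define J where "J = (LINT u:{0..}|lborel. (k u - k0) * w u)"
  have J: "\<bar>J\<bar> \<le> I0 + I1"
  proof -
    have "\<bar>J\<bar> \<le> (LINT u|lborel. norm (indicator {0..} u *\<^sub>R ((k u - k0) * w u)))"
      unfolding J_def set_lebesgue_integral_def real_norm_def[symmetric] by (rule integral_norm_bound)
    also have "\<dots> \<le> (LINT u:{0..}|lborel. w u + u * w u)"
      unfolding set_lebesgue_integral_def
    proof (rule integral_mono)
      show "norm (indicator {0..} u *\<^sub>R ((k u - k0) * w u)) \<le> indicator {0..} u *\<^sub>R (w u + u * w u)" for u
        using kb[of u] w0[of u] by (cases "0 \<le> u") auto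
    qed (use i01 ik in \<open>auto simp: set_integrable_def\<close>)
    also have "\<dots> = I0 + I1" unfolding I0_def I1_def using i0 i1 by (rule set_integral_add)
    finally show ?thesis .
  qed
  have "(LINT u:{0..}|lborel. (k u - m) * w u) = (LINT u:{0..}|lborel. (k u - k0) * w u + (k0 - m) * w u)"
    by (simp add: algebra_simps)
  also have "\<dots> = J + (k0 - m) * I0"
    unfolding J_def I0_def using ik set_integrable_mult_right[OF i0, of "k0 - m"] by (subst set_integral_add) auto
  finally have E: "(LINT u:{0..}|lborel. (k u - m) * w u) = J + (k0 - m) * I0" .
  have "k0 - m - a * (LINT u:{0..}|lborel. (k u - m) * w u) = (k0 - m) * (1 - a * I0) - a * J"
    unfolding E by (simp add: algebra_simps)
  also have "1 - a * I0 = I1" using sum1 by linarith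
  also have "\<bar>(k0 - m) * I1 - a * J\<bar> \<le> \<bar>k0 - m\<bar> * I1 + a * \<bar>J\<bar>"
    using a I1 abs_triangle_ineq4[of "(k0 - m) * I1" "a * J"] by (simp add: abs_mult)
  also have "\<dots> \<le> (2 + a) * I1 + a * (I0 + I1)"
    using a I1 J m by (intro add_mono mult_right_mono mult_left_mono) auto
  \<comment> \<open>Origin of the constant 8: I1 is at most 1 and a I1 at most sqrt (2 pi), hence at
    most 3, which gives 1 + 1 + 2 * 3.\<close>
  also have "\<dots> = 1 + I1 + 2 * (a * I1)" using sum1 by (simp add: algebra_simps)
  also have "\<dots> \<le> 8" using sum1 aI1 mult_nonneg_nonneg[OF a I0] by linarith
  finally show ?thesis unfolding w_def .
qed

text \<open>The solution is explicit: \<open>exp (x\<^sup>2 / 2)\<close> times the integral up to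
  \<open>x\<close> of the centred test function against the Gaussian weight. Its derivative inherits
  the continuity of \<open>h\<close>, which the later integration by parts relies on; this is why
  test functions are continuous rather than indicators.\<close>

lemma stein_equation:
  fixes h :: "real \<Rightarrow> real"
  assumes h: "continuous_on UNIV h" and osc: "\<And>x y. \<bar>h y - h x\<bar> \<le> 1 + \<bar>y - x\<bar>"
  obtains f f' where "\<And>x. (f has_real_derivative f' x) (at x)" "continuous_on UNIV f'"
    "\<And>x. f' x - x * f x = h x - integral\<^sup>L std_normal_distribution h" "\<And>x. \<bar>f' x\<bar> \<le> 8"
proof -
  define m where "m = integral\<^sup>L std_normal_distribution h"
  have hm[measurable]: "h \<in> borel_measurable borel" using h by (rule borel_measurable_continuous_onI)
  note hN = integrable_lip_normal[OF hm osc]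
  interpret prob_space std_normal_distribution by (rule prob_space_std_normal)
  define g where "g y = (h y - m) * exp (- y\<^sup>2 / 2)" for y
  have gm[measurable]: "g \<in> borel_measurable borel" unfolding g_def by measurable
  have gi: "integrable lborel g"
    using integrable_std_normal_iff[of "\<lambda>y. h y - m"] hN(1) unfolding g_def by simp
  have g0: "integral\<^sup>L lborel g = 0"
    using integral_std_normal[of "\<lambda>y. h y - m"] hN(1) prob_space unfolding g_def m_def by simp
  have gsi: "set_integrable lborel A g" if "A \<in> sets borel" for A
    by (rule set_integrable_subset[of lborel UNIV]) (use gi that in \<open>simp_all add: set_integrable_def\<close>)
  have gc: "continuous_on A g" for A
  proof (rule continuous_on_subset)
    show "continuous_on UNIV g" unfolding g_def by (intro continuous_intros h) simp
  qed simp
  define P where "P x = (LINT y:{..x}|lborel. g y)" for x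
  have split: "P b = P a + (LINT y:{a..b}|lborel. g y)" if "a \<le> b" for a b
  proof -
    have "{..a} \<union> {a<..b} = {..b}" using that by auto
    hence "P b = (LINT y:{..a} \<union> {a<..b}|lborel. g y)" unfolding P_def by (simp only:)
    moreover have "(LINT y:{..a} \<union> {a<..b}|lborel. g y) = P a + (LINT y:{a<..b}|lborel. g y)"
      unfolding P_def
    proof (rule set_integral_Un)
      show "{..a} \<inter> {a<..b} = {}" by fastforce
    qed (rule gsi, measurable)+
    moreover have "(LINT y:{a<..b}|lborel. g y) = (LINT y:{a..b}|lborel. g y)"
    proof (rule set_integral_cong_set)
      show "AE y in lborel. (y \<in> {a..b}) = (y \<in> {a<..b})"
        using AE_lborel_singleton[of a] by eventually_elim auto
    qed (auto simp: set_borel_measurable_def)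
    ultimately show ?thesis by linarith
  qed
  have Pd: "(P has_real_derivative g x) (at x)" for x
  proof -
    have "((\<lambda>u. integral {x-1..u} g) has_real_derivative g x) (at x within {x-1..x+1})"
      by (rule integral_has_real_derivative[OF gc]) auto
    hence "((\<lambda>u. integral {x-1..u} g) has_real_derivative g x) (at x)"
      by (subst (asm) at_within_Icc_at) auto
    hence "((\<lambda>u. P (x-1) + integral {x-1..u} g) has_real_derivative g x) (at x)"
      by (rule DERIV_add[OF DERIV_const, of _ _ _ _ "P (x-1)", simplified add_0])
    moreover have "P (x-1) + integral {x-1..u} g = P u" if "x - 1 < u" for u
    proof -
      have E: "(LINT y:{x-1..u}|lborel. g y) = integral {x-1..u} g"
        by (rule set_borel_integral_eq_integral(2)[OF gsi]) measurable
      show ?thesis unfolding E[symmetric] by (rule split[symmetric]) (use that in linarith)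
    qed
    hence "\<forall>\<^sub>F u in nhds x. P (x-1) + integral {x-1..u} g = P u"
      by (intro eventually_mono[OF eventually_nhds_in_open[of "{x-1<..}" x]]) auto
    ultimately show ?thesis
      by (rule iffD1[OF DERIV_cong_ev[OF refl _ refl], rotated])
  qed
  define f where "f x = exp (x\<^sup>2 / 2) * P x" for x
  define f' where "f' x = h x - m + x * f x" for x
  have fd: "(f has_real_derivative f' x) (at x)" for x
  proof -
    have "(f has_real_derivative (exp (x\<^sup>2/2) * x * P x + exp (x\<^sup>2 / 2) * g x)) (at x)"
      unfolding f_def[abs_def] by (auto intro!: derivative_eq_intros Pd)
    moreover have "exp (x\<^sup>2/2) * x * P x + exp (x\<^sup>2 / 2) * g x = f' x"
      unfolding f'_def f_def g_def by (simp add: exp_minus)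
    ultimately show ?thesis by simp
  qed
  have "continuous_on UNIV f" by (rule DERIV_continuous_on[where D = f']) (simp add: fd)
  hence fc: "continuous_on UNIV f'" unfolding f'_def[abs_def] by (intro continuous_intros h)
  have bound: "\<bar>f' x\<bar> \<le> 8" for x
  proof (cases "0 \<le> x")
    case True
    \<comment> \<open>For large positive \<open>x\<close> the prefactor
      \<open>exp (x\<^sup>2 / 2)\<close> can only be balanced by an upper tail. As \<open>g\<close>
      has total integral 0, \<open>P x\<close> is minus the integral over the upper tail.\<close>
    have "P x + (LINT y:{x<..}|lborel. g y) = (LINT y:{..x} \<union> {x<..}|lborel. g y)"
      unfolding P_def
    proof (rule set_integral_Un[symmetric])
      show "{..x} \<inter> {x<..} = {}" by fastforce
    qed (rule gsi, measurable)+
    also have "{..x} \<union> {x<..} = UNIV" by auto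
    also have "(LINT y:UNIV|lborel. g y) = 0" using g0 by (simp add: set_lebesgue_integral_def)
    finally have "P x = - (LINT y:{x<..}|lborel. g y)" by simp
    also have "(LINT y:{x<..}|lborel. g y) = (LINT y:{x..}|lborel. g y)"
    proof (rule set_integral_cong_set)
      show "AE y in lborel. (y \<in> {x..}) = (y \<in> {x<..})"
        using AE_lborel_singleton[of x] by eventually_elim auto
    qed (auto simp: set_borel_measurable_def)
    \<comment> \<open>Substituting y = x + u and expanding the square splits off
      \<open>exp (- x\<^sup>2 / 2)\<close>, which cancels the prefactor in \<open>f\<close>.\<close>
    also have "\<dots> = (LINT u|lborel. indicator {x..} (x + 1 * u) *\<^sub>R g (x + 1 * u))"
      unfolding set_lebesgue_integral_def by (subst lborel_integral_real_affine[where c = 1 and t = x]) auto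
    also have "\<dots> = (LINT u:{0..}|lborel. (h (x + u) - m) * exp (- u\<^sup>2 / 2 - x * u) * exp (- x\<^sup>2/2))"
    proof -
      have e: "exp (- (x + u)\<^sup>2 / 2) = exp (- u\<^sup>2 / 2 - x * u) * exp (- x\<^sup>2/2)" for u
        by (simp add: power2_sum field_simps flip: exp_add)
      show ?thesis unfolding set_lebesgue_integral_def g_def
        by (intro Bochner_Integration.integral_cong) (use e in \<open>auto simp: indicator_def\<close>)
    qed
    also have "\<dots> = (LINT u:{0..}|lborel. (h (x + u) - m) * exp (- u\<^sup>2 / 2 - x * u)) * exp (- x\<^sup>2/2)" by simp
    finally have "f' x = h x - m - x * (LINT u:{0..}|lborel. (h (x + u) - m) * exp (- u\<^sup>2 / 2 - x * u))"
      unfolding f'_def f_def by (simp add: exp_minus field_simps)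
    moreover have "\<bar>h x - m - x * (LINT u:{0..}|lborel. (h (x + u) - m) * exp (- u\<^sup>2 / 2 - x * u))\<bar> \<le> 8"
    proof (rule gauss_tail_estimate)
      show "\<bar>h (x + u) - h x\<bar> \<le> 1 + u" if "0 \<le> u" for u
        using osc[of x "x + u"] that by simp
    qed (use hN(2)[of x] True in \<open>auto simp: m_def\<close>)
    ultimately show ?thesis by simp
  next
    case False
    \<comment> \<open>For negative \<open>x\<close> the lower tail is already the small one; the
      reflection y = x - u brings it to the same form with \<open>a = - x\<close>.\<close>
    have "P x = (LINT u|lborel. indicator {..x} (x + (- 1) * u) *\<^sub>R g (x + (-1) * u))"
      unfolding P_def set_lebesgue_integral_def by (subst lborel_integral_real_affine[where c = "-1" and t = x]) auto
    also have "\<dots> = (LINT u:{0..}|lborel. (h (x - u) - m) * exp (- u\<^sup>2 / 2 - (-x) * u) * exp (- x\<^sup>2/2))"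
    proof -
      have e: "exp (- (x - u)\<^sup>2 / 2) = exp (- u\<^sup>2 / 2 - (-x) * u) * exp (- x\<^sup>2/2)" for u
        by (simp add: power2_diff field_simps flip: exp_add)
      show ?thesis unfolding set_lebesgue_integral_def g_def
        by (intro Bochner_Integration.integral_cong) (use e in \<open>auto simp: indicator_def\<close>)
    qed
    also have "\<dots> = (LINT u:{0..}|lborel. (h (x - u) - m) * exp (- u\<^sup>2 / 2 - (-x) * u)) * exp (- x\<^sup>2/2)" by simp
    finally have "f' x = h x - m - (- x) * (LINT u:{0..}|lborel. (h (x - u) - m) * exp (- u\<^sup>2 / 2 - (-x) * u))"
      unfolding f'_def f_def by (simp add: exp_minus field_simps)
    moreover have "\<bar>h x - m - (-x) * (LINT u:{0..}|lborel. (h (x - u) - m) * exp (- u\<^sup>2 / 2 - (-x) * u))\<bar> \<le> 8"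
    proof (rule gauss_tail_estimate)
      show "\<bar>h (x - u) - h x\<bar> \<le> 1 + u" if "0 \<le> u" for u
        using osc[of x "x - u"] that by simp
    qed (use hN(2)[of x] False in \<open>auto simp: m_def\<close>)
    ultimately show ?thesis by simp
  qed
  show thesis
    by (rule that[of f f']) (use fd fc bound in \<open>auto simp: f'_def m_def\<close>)
qed

section \<open>Quadratic forms in independent normals\<close>

lemma poly_gauss_tendsto_0:
  "((\<lambda>x::real. (1 + x\<^sup>2) ^ k * exp (- x\<^sup>2 / 2)) \<longlongrightarrow> 0) at_top"
  "((\<lambda>x::real. (1 + x\<^sup>2) ^ k * exp (- x\<^sup>2 / 2)) \<longlongrightarrow> 0) at_bot"
  by real_asymp+

lemma integrable_std_normal_poly:
  "integrable std_normal_distribution (\<lambda>x::real. (1 + x\<^sup>2) ^ k)"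
proof -
  have "integrable std_normal_distribution (\<lambda>x::real. \<Sum>i\<le>k. real (k choose i) * x ^ (2 * (k - i)))"
    by (intro Bochner_Integration.integrable_sum integrable_mult_right integrable_std_normal_distribution_moment)
  thus ?thesis by (simp add: binomial_ring power_mult)
qed

text \<open>The derivative of \<open>\<phi> x * exp (- x\<^sup>2 / 2)\<close> integrates to 0 over
  the line, because polynomial growth of \<open>\<phi>\<close> makes both boundary terms
  vanish.\<close>

lemma std_normal_ibp:
  fixes \<phi> \<phi>' :: "real \<Rightarrow> real"
  assumes d: "\<And>x. (\<phi> has_real_derivative \<phi>' x) (at x)" and c: "continuous_on UNIV \<phi>'"
    and b: "\<And>x. \<bar>\<phi> x\<bar> \<le> C * (1 + x\<^sup>2) ^ k" "\<And>x. \<bar>\<phi>' x\<bar> \<le> C * (1 + x\<^sup>2) ^ k"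
  shows "(LINT x|std_normal_distribution. x * \<phi> x) = (LINT x|std_normal_distribution. \<phi>' x)"
proof -
  have cphi: "continuous_on UNIV \<phi>" by (rule DERIV_continuous_on[where D = \<phi>']) (simp add: d)
  have [measurable]: "\<phi> \<in> borel_measurable borel" "\<phi>' \<in> borel_measurable borel"
    using c cphi by (auto intro: borel_measurable_continuous_onI)
  have C: "0 \<le> C" using b(1)[of 0] by simp
  have i1: "integrable std_normal_distribution \<phi>'"
    using integrable_mult_right[OF integrable_std_normal_poly[of k], of C]
    by (rule Bochner_Integration.integrable_bound) (use b(2) C in \<open>auto simp: abs_mult\<close>)
  have i2: "integrable std_normal_distribution (\<lambda>x. x * \<phi> x)"
    using integrable_mult_right[OF integrable_std_normal_poly[of "Suc k"], of C]
  proof (rule Bochner_Integration.integrable_bound)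
    show "AE x in std_normal_distribution. norm (x * \<phi> x) \<le> norm (C * (1 + x\<^sup>2) ^ Suc k)"
    proof (rule AE_I2)
      fix x :: real
      have "0 \<le> (\<bar>x\<bar> - 1)\<^sup>2" by (rule zero_le_power2)
      hence "\<bar>x\<bar> \<le> 1 + x\<^sup>2" using zero_le_power2[of x] by (simp add: power2_diff)
      hence "\<bar>x\<bar> * \<bar>\<phi> x\<bar> \<le> (1 + x\<^sup>2) * (C * (1 + x\<^sup>2) ^ k)" using b(1)[of x] by (intro mult_mono) auto
      thus "norm (x * \<phi> x) \<le> norm (C * (1 + x\<^sup>2) ^ Suc k)" using C by (simp add: abs_mult mult_ac)
    qed
  qed auto
  define \<psi> where "\<psi> x = \<phi> x * exp (- x\<^sup>2 / 2)" for x
  define \<psi>' where "\<psi>' x = (\<phi>' x - x * \<phi> x) * exp (- x\<^sup>2 / 2)" for x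
  have pd: "(\<psi> has_real_derivative \<psi>' x) (at x)" for x
    unfolding \<psi>_def[abs_def] \<psi>'_def
    by (auto intro!: derivative_eq_intros d simp: algebra_simps)
  have pc: "continuous_on UNIV \<psi>'"
    unfolding \<psi>'_def[abs_def] by (intro continuous_intros c cphi) simp
  have ii: "integrable std_normal_distribution (\<lambda>x. \<phi>' x - x * \<phi> x)" using i1 i2 by simp
  hence pi: "integrable lborel \<psi>'"
    using integrable_std_normal_iff[of "\<lambda>x. \<phi>' x - x * \<phi> x"] by (simp add: \<psi>'_def[abs_def])
  have lim: "(\<psi> \<longlongrightarrow> 0) F" if "((\<lambda>x::real. (1 + x\<^sup>2) ^ k * exp (- x\<^sup>2 / 2)) \<longlongrightarrow> 0) F" for F
  proof (rule Lim_null_comparison)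
    show "((\<lambda>x::real. C * ((1 + x\<^sup>2) ^ k * exp (- x\<^sup>2 / 2))) \<longlongrightarrow> 0) F"
      using tendsto_mult_left[OF that, of C] by simp
    have "norm (\<psi> x) \<le> C * ((1 + x\<^sup>2) ^ k * exp (- x\<^sup>2 / 2))" for x
      using mult_right_mono[OF b(1)[of x], of "exp (- x\<^sup>2 / 2)"] by (simp add: \<psi>_def abs_mult mult_ac)
    thus "\<forall>\<^sub>F x in F. norm (\<psi> x) \<le> C * ((1 + x\<^sup>2) ^ k * exp (- x\<^sup>2 / 2))" by simp
  qed
  have "(LBINT x=-\<infinity>..\<infinity>. \<psi>' x) = 0 - 0"
  proof (rule interval_integral_FTC_integrable)
    show "((\<psi> \<circ> real_of_ereal) \<longlongrightarrow> 0) (at_right (-\<infinity>))"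
      using lim[OF poly_gauss_tendsto_0(2)] by (simp add: ereal_tendsto_simps)
    show "((\<psi> \<circ> real_of_ereal) \<longlongrightarrow> 0) (at_left \<infinity>)"
      using lim[OF poly_gauss_tendsto_0(1)] by (simp add: ereal_tendsto_simps)
    show "isCont \<psi>' x" for x using pc by (simp add: continuous_on_eq_continuous_at)
    show "set_integrable lborel (einterval (-\<infinity>) \<infinity>) \<psi>'" using pi by (simp add: set_integrable_def)
  qed (use pd in \<open>auto simp: has_real_derivative_iff_has_vector_derivative\<close>)
  hence "integral\<^sup>L lborel \<psi>' = 0"
    by (simp add: interval_lebesgue_integral_def set_lebesgue_integral_def)
  hence "(LINT x|std_normal_distribution. \<phi>' x - x * \<phi> x) = 0"
    using integral_std_normal[of "\<lambda>x. \<phi>' x - x * \<phi> x"] by (simp add: \<psi>'_def[abs_def])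
  thus ?thesis using i1 i2 by simp
qed

section \<open>Integration by parts for independent standard normals\<close>

abbreviation iid_normal :: "nat \<Rightarrow> (nat \<Rightarrow> real) measure" where
  "iid_normal n \<equiv> PiM {..<n} (\<lambda>_. std_normal_distribution)"

interpretation normals: product_sigma_finite "\<lambda>_::nat. std_normal_distribution"
  by (intro product_sigma_finite.intro prob_space_imp_sigma_finite prob_space_std_normal)

lemma prob_space_iid_normal: "prob_space (iid_normal n)"
  by (rule prob_space_PiM) (rule prob_space_std_normal)

lemma measurable_coord_iid_normal:
  assumes "j < n" shows "(\<lambda>x. x j) \<in> borel_measurable (iid_normal n)"
proof -
  have "(\<lambda>x. x j) \<in> measurable (iid_normal n) std_normal_distribution"
    using assms by (intro measurable_component_singleton) simp
  thus ?thesis by simp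
qed

text \<open>Powers of the product of the \<open>1 + (x j)\<^sup>2\<close> factor over coordinates:
  integrability under the product law reduces to one-dimensional moments, and freezing all
  coordinates but one leaves a polynomial bound in that one. The bound ranges over all functions
  \<open>x\<close>, so \<open>x(i := y)\<close> can be inserted freely.\<close>

definition poly_bounded :: "nat \<Rightarrow> ((nat \<Rightarrow> real) \<Rightarrow> real) \<Rightarrow> bool" where
  "poly_bounded n \<phi> \<longleftrightarrow> (\<exists>C k. \<forall>x. \<bar>\<phi> x\<bar> \<le> C * (\<Prod>j<n. 1 + (x j)\<^sup>2) ^ k)"

lemma one_le_prod_1_plus: "1 \<le> (\<Prod>j<n. 1 + (x j :: real)\<^sup>2)"
  by (intro prod_ge_1) simp

lemma poly_bounded_const: "poly_bounded n (\<lambda>_. c)"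
  unfolding poly_bounded_def by (intro exI[of _ "\<bar>c\<bar>"] exI[of _ 0]) simp

lemma poly_bounded_coord:
  assumes "j < n" shows "poly_bounded n (\<lambda>x. x j)"
proof -
  have "\<bar>x j\<bar> \<le> 1 * (\<Prod>j<n. 1 + (x j)\<^sup>2) ^ 1" for x :: "nat \<Rightarrow> real"
  proof -
    have "0 \<le> (\<bar>x j\<bar> - 1)\<^sup>2" by (rule zero_le_power2)
    hence "\<bar>x j\<bar> \<le> 1 + (x j)\<^sup>2" using zero_le_power2[of "x j"] by (simp add: power2_diff)
    also have "\<dots> = (1 + (x j)\<^sup>2) * 1" by simp
    also have "\<dots> \<le> (1 + (x j)\<^sup>2) * (\<Prod>i\<in>{..<n} - {j}. 1 + (x i)\<^sup>2)"
      by (intro mult_left_mono prod_ge_1) auto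
    also have "\<dots> = (\<Prod>j<n. 1 + (x j)\<^sup>2)" using assms by (subst prod.remove[of _ j]) auto
    finally show ?thesis by simp
  qed
  thus ?thesis unfolding poly_bounded_def by blast
qed

lemma poly_bounded_add:
  assumes "poly_bounded n \<phi>" "poly_bounded n \<psi>"
  shows "poly_bounded n (\<lambda>x. \<phi> x + \<psi> x)"
proof -
  from assms obtain C k D l where b: "\<And>x. \<bar>\<phi> x\<bar> \<le> C * (\<Prod>j<n. 1 + (x j)\<^sup>2) ^ k"
    "\<And>x. \<bar>\<psi> x\<bar> \<le> D * (\<Prod>j<n. 1 + (x j)\<^sup>2) ^ l" unfolding poly_bounded_def by blast
  have CD: "0 \<le> C" "0 \<le> D" using b[of "\<lambda>_. 0"] by (auto intro: order_trans[OF abs_ge_zero])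
  have "\<bar>\<phi> x + \<psi> x\<bar> \<le> (C + D) * (\<Prod>j<n. 1 + (x j)\<^sup>2) ^ (k + l)" for x
  proof -
    let ?P = "\<Prod>j<n. 1 + (x j)\<^sup>2"
    have "C * ?P ^ k \<le> C * ?P ^ (k + l)" "D * ?P ^ l \<le> D * ?P ^ (k + l)"
      using CD one_le_prod_1_plus[of x n] by (auto intro!: mult_left_mono power_increasing)
    thus ?thesis using b[of x] abs_triangle_ineq[of "\<phi> x" "\<psi> x"] by (simp add: distrib_right)
  qed
  thus ?thesis unfolding poly_bounded_def by blast
qed

lemma poly_bounded_mult:
  assumes "poly_bounded n \<phi>" "poly_bounded n \<psi>"
  shows "poly_bounded n (\<lambda>x. \<phi> x * \<psi> x)"
proof -
  from assms obtain C k D l where b: "\<And>x. \<bar>\<phi> x\<bar> \<le> C * (\<Prod>j<n. 1 + (x j)\<^sup>2) ^ k"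
    "\<And>x. \<bar>\<psi> x\<bar> \<le> D * (\<Prod>j<n. 1 + (x j)\<^sup>2) ^ l" unfolding poly_bounded_def by blast
  have "\<bar>\<phi> x * \<psi> x\<bar> \<le> (C * D) * (\<Prod>j<n. 1 + (x j)\<^sup>2) ^ (k + l)" for x
    using mult_mono[OF b(1)[of x] b(2)[of x]] order_trans[OF abs_ge_zero b(1)[of x]]
    by (simp add: abs_mult power_add mult_ac)
  thus ?thesis unfolding poly_bounded_def by blast
qed

lemma poly_bounded_sum:
  assumes "\<And>i. i \<in> I \<Longrightarrow> poly_bounded n (\<phi> i)" shows "poly_bounded n (\<lambda>x. \<Sum>i\<in>I. \<phi> i x)"
  using assms by (induction I rule: infinite_finite_induct) (auto intro: poly_bounded_add poly_bounded_const)

lemma poly_bounded_le: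
  assumes "poly_bounded n \<psi>" "\<And>x. \<bar>\<phi> x\<bar> \<le> \<bar>\<psi> x\<bar>" shows "poly_bounded n \<phi>"
  using assms unfolding poly_bounded_def by (meson order_trans)

lemma poly_bounded_abs: "poly_bounded n \<phi> \<Longrightarrow> poly_bounded n (\<lambda>x. \<bar>\<phi> x\<bar>)"
  by (rule poly_bounded_le) auto

lemmas poly_bounded_intros =
  poly_bounded_const poly_bounded_coord poly_bounded_add poly_bounded_mult poly_bounded_sum poly_bounded_abs

lemma integrable_poly_bounded:
  assumes [measurable]: "\<phi> \<in> borel_measurable (iid_normal n)" and "poly_bounded n \<phi>"
  shows "integrable (iid_normal n) \<phi>"
proof -
  from assms(2) obtain C k where b: "\<And>x. \<bar>\<phi> x\<bar> \<le> C * (\<Prod>j<n. 1 + (x j)\<^sup>2) ^ k"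
    unfolding poly_bounded_def by blast
  show ?thesis
  proof (rule Bochner_Integration.integrable_bound)
    show "integrable (iid_normal n) (\<lambda>x. C * (\<Prod>j<n. (1 + (x j)\<^sup>2) ^ k))"
      by (intro integrable_mult_right normals.product_integrable_prod integrable_std_normal_poly) auto
    show "AE x in iid_normal n. norm (\<phi> x) \<le> norm (C * (\<Prod>j<n. (1 + (x j)\<^sup>2) ^ k))"
      using b by (auto simp: prod_power_distrib intro: order_trans[OF _ abs_ge_self])
  qed simp
qed

text \<open>Fubini isolates coordinate \<open>i\<close>; for the others frozen, this is the
  one-dimensional formula.\<close>

lemma iid_normal_ibp:
  fixes \<phi> \<phi>' :: "(nat \<Rightarrow> real) \<Rightarrow> real"
  assumes i: "i < n"
    and m: "\<phi> \<in> borel_measurable (iid_normal n)" "\<phi>' \<in> borel_measurable (iid_normal n)"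
    and d: "\<And>x y. ((\<lambda>y. \<phi> (x(i := y))) has_real_derivative \<phi>' (x(i := y))) (at y)"
    and c: "\<And>x. continuous_on UNIV (\<lambda>y. \<phi>' (x(i := y)))"
    and b: "poly_bounded n \<phi>" "poly_bounded n \<phi>'"
  shows "(LINT x|iid_normal n. x i * \<phi> x) = (LINT x|iid_normal n. \<phi>' x)"
proof -
  note m[measurable]
  have ins: "insert i ({..<n} - {i}) = {..<n}" using i by auto
  from b obtain C k D l where bd: "\<And>x. \<bar>\<phi> x\<bar> \<le> C * (\<Prod>j<n. 1 + (x j)\<^sup>2) ^ k"
    "\<And>x. \<bar>\<phi>' x\<bar> \<le> D * (\<Prod>j<n. 1 + (x j)\<^sup>2) ^ l" unfolding poly_bounded_def by blast
  have CD: "0 \<le> C" "0 \<le> D" using bd[of "\<lambda>_. 0"] by (auto intro: order_trans[OF abs_ge_zero])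
  have xm: "(\<lambda>x. x i * \<phi> x) \<in> borel_measurable (iid_normal n)" by (intro borel_measurable_times measurable_coord_iid_normal i m)
  have int: "integrable (iid_normal n) (\<lambda>x. x i * \<phi> x)" "integrable (iid_normal n) \<phi>'"
    using i b xm m by (auto intro!: integrable_poly_bounded poly_bounded_intros)
  have I: "finite ({..<n} - {i})" "i \<notin> {..<n} - {i}" by auto
  have "(LINT x|iid_normal n. x i * \<phi> x) =
      (LINT x|PiM ({..<n} - {i}) (\<lambda>_. std_normal_distribution). LINT y|std_normal_distribution. y * \<phi> (x(i := y)))"
    using normals.product_integral_insert[OF I, unfolded ins, OF int(1)] by simp
  also have "\<dots> = (LINT x|PiM ({..<n} - {i}) (\<lambda>_. std_normal_distribution).
      LINT y|std_normal_distribution. \<phi>' (x(i := y)))"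
  proof (rule Bochner_Integration.integral_cong[OF refl])
    fix x :: "nat \<Rightarrow> real"
    define R where "R = (\<Prod>j\<in>{..<n} - {i}. 1 + (x j)\<^sup>2)"
    have R: "1 \<le> R" unfolding R_def by (intro prod_ge_1) simp
    have P: "(\<Prod>j<n. 1 + ((x(i := y)) j)\<^sup>2) = (1 + y\<^sup>2) * R" for y
      using i unfolding R_def by (subst prod.remove[of _ i]) (auto intro!: arg_cong2[of _ _ _ _ "(*)"] prod.cong)
    have RR: "1 \<le> (1 + y\<^sup>2) * R" for y using mult_mono[of 1 "1 + y\<^sup>2" 1 R] R by simp
    show "(LINT y|std_normal_distribution. y * \<phi> (x(i := y))) = (LINT y|std_normal_distribution. \<phi>' (x(i := y)))"
    proof (rule std_normal_ibp[where C = "(C + D) * R ^ (k + l)" and k = "k + l"])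
      fix y :: real
      have "C * ((1 + y\<^sup>2) * R) ^ k \<le> (C + D) * ((1 + y\<^sup>2) * R) ^ (k + l)"
        using CD R RR[of y] by (intro mult_mono power_increasing) auto
      thus "\<bar>\<phi> (x(i := y))\<bar> \<le> (C + D) * R ^ (k + l) * (1 + y\<^sup>2) ^ (k + l)"
        using bd(1)[of "x(i := y)"] unfolding P by (simp add: power_mult_distrib mult_ac)
      have "D * ((1 + y\<^sup>2) * R) ^ l \<le> (C + D) * ((1 + y\<^sup>2) * R) ^ (k + l)"
        using CD R RR[of y] by (intro mult_mono power_increasing) auto
      thus "\<bar>\<phi>' (x(i := y))\<bar> \<le> (C + D) * R ^ (k + l) * (1 + y\<^sup>2) ^ (k + l)"
        using bd(2)[of "x(i := y)"] unfolding P by (simp add: power_mult_distrib mult_ac)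
    qed (use d c in auto)
  qed
  also have "\<dots> = (LINT x|iid_normal n. \<phi>' x)"
    using normals.product_integral_insert[OF I, unfolded ins, OF int(2)] by simp
  finally show ?thesis .
qed

section \<open>Stein's method for quadratic forms\<close>

definition qform :: "nat \<Rightarrow> (nat \<Rightarrow> nat \<Rightarrow> real) \<Rightarrow> (nat \<Rightarrow> real) \<Rightarrow> real" where
  "qform n A x = (\<Sum>i<n. \<Sum>j<n. A i j * x i * x j)"

definition mat_sq :: "nat \<Rightarrow> (nat \<Rightarrow> nat \<Rightarrow> real) \<Rightarrow> nat \<Rightarrow> nat \<Rightarrow> real" where
  "mat_sq n A i j = (\<Sum>k<n. A i k * A k j)"

lemma mat_sq_sym:
  assumes "\<And>i j. A i j = A j i" shows "mat_sq n A i j = mat_sq n A j i"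
  unfolding mat_sq_def using assms by (intro sum.cong) (auto simp: mult.commute)

lemma measurable_qform: "qform n A \<in> borel_measurable (iid_normal n)"
  unfolding qform_def[abs_def]
  by (intro borel_measurable_sum borel_measurable_times measurable_coord_iid_normal borel_measurable_const) auto

lemma poly_bounded_qform: "poly_bounded n (qform n A)"
  unfolding qform_def[abs_def] by (intro poly_bounded_intros) auto

lemma qform_mat_sq:
  assumes sym: "\<And>i j. A i j = A j i"
  shows "qform n (mat_sq n A) x = (\<Sum>k<n. (\<Sum>j<n. A k j * x j)\<^sup>2)"
proof -
  have "qform n (mat_sq n A) x = (\<Sum>i<n. \<Sum>j<n. \<Sum>k<n. (A k i * x i) * (A k j * x j))"
    unfolding qform_def mat_sq_def
    unfolding sum_distrib_right by (intro sum.cong refl) (simp add: sym mult_ac)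
  also have "\<dots> = (\<Sum>k<n. \<Sum>i<n. \<Sum>j<n. (A k i * x i) * (A k j * x j))"
    by (subst sum.swap[of _ "{..<n}" "{..<n}"], subst sum.swap, intro sum.cong refl sum.swap)
  also have "\<dots> = (\<Sum>k<n. (\<Sum>j<n. A k j * x j)\<^sup>2)"
    by (simp add: power2_eq_square sum_product)
  finally show ?thesis .
qed

text \<open>Write the form as the sum of \<open>x i * L i x\<close> with L = A x and integrate by
  parts in each coordinate \<open>i\<close>. The derivative of \<open>L i\<close> gives the diagonal
  entry, that of the form gives \<open>2 * L i x\<close>, and the squares of the
  \<open>L i x\<close> add up to the form of the squared matrix. A bounded \<open>f'\<close> forces
  linear growth of \<open>f\<close>, so every expectation exists.\<close>

lemma qform_stein:
  fixes f f' :: "real \<Rightarrow> real"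
  assumes sym: "\<And>i j. A i j = A j i"
    and d: "\<And>x. (f has_real_derivative f' x) (at x)" and c: "continuous_on UNIV f'"
    and B: "\<And>x. \<bar>f' x\<bar> \<le> B"
  shows "integrable (iid_normal n) (\<lambda>x. f (qform n A x))"
    and "integrable (iid_normal n) (\<lambda>x. qform n A x * f (qform n A x))"
    and "integrable (iid_normal n) (\<lambda>x. f' (qform n A x) * qform n (mat_sq n A) x)"
    and "(LINT x|iid_normal n. qform n A x * f (qform n A x)) =
      (\<Sum>i<n. A i i) * (LINT x|iid_normal n. f (qform n A x)) +
      2 * (LINT x|iid_normal n. f' (qform n A x) * qform n (mat_sq n A) x)"
proof -
  let ?P = "iid_normal n"
  let ?Q = "qform n A"
  define L where "L i x = (\<Sum>j<n. A i j * x j)" for i and x :: "nat \<Rightarrow> real"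
  have fc: "continuous_on UNIV f" by (rule DERIV_continuous_on[where D = f']) (simp add: d)
  note fm = borel_measurable_continuous_onI[OF fc] and f'm = borel_measurable_continuous_onI[OF c]
  have mf: "(\<lambda>x. f (?Q x)) \<in> borel_measurable ?P" "(\<lambda>x. f' (?Q x)) \<in> borel_measurable ?P"
    using measurable_compose[OF measurable_qform fm] measurable_compose[OF measurable_qform f'm] by auto
  have mL: "L i \<in> borel_measurable ?P" for i
    unfolding L_def[abs_def]
    by (intro borel_measurable_sum borel_measurable_times measurable_coord_iid_normal borel_measurable_const) auto
  have lin: "\<bar>f q\<bar> \<le> \<bar>f 0\<bar> + B * \<bar>q\<bar>" for q
  proof -
    have "norm (f q - f 0) \<le> B * norm (q - 0)"
      by (rule field_differentiable_bound[of UNIV]) (use d B in \<open>auto intro: has_field_derivative_at_within\<close>)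
    thus ?thesis by simp
  qed
  have B0: "0 \<le> B" using B[of 0] by simp
  have pf: "poly_bounded n (\<lambda>x. f (?Q x))"
  proof (rule poly_bounded_le)
    show "poly_bounded n (\<lambda>x. \<bar>f 0\<bar> + B * \<bar>?Q x\<bar>)" by (intro poly_bounded_intros poly_bounded_qform)
  qed (use lin B0 in \<open>auto intro: order_trans[OF _ abs_ge_self]\<close>)
  have pf': "poly_bounded n (\<lambda>x. f' (?Q x))"
    by (rule poly_bounded_le[OF poly_bounded_const[of n B]]) (use B B0 in auto)
  have pL: "poly_bounded n (L i)" for i
    unfolding L_def[abs_def] by (intro poly_bounded_intros) auto
  show i1: "integrable ?P (\<lambda>x. f (?Q x))" by (intro integrable_poly_bounded mf pf)
  show "integrable ?P (\<lambda>x. ?Q x * f (?Q x))"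
    by (intro integrable_poly_bounded borel_measurable_times measurable_qform mf poly_bounded_mult poly_bounded_qform pf)
  show "integrable ?P (\<lambda>x. f' (?Q x) * qform n (mat_sq n A) x)"
    by (intro integrable_poly_bounded borel_measurable_times measurable_qform mf poly_bounded_mult poly_bounded_qform pf')
  define \<phi> where "\<phi> i x = L i x * f (?Q x)" for i x
  define \<phi>' where "\<phi>' i x = A i i * f (?Q x) + 2 * (f' (?Q x) * (L i x)\<^sup>2)" for i x
  have ibp: "(LINT x|?P. x i * \<phi> i x) = (LINT x|?P. \<phi>' i x)" if i: "i < n" for i
  proof (rule iid_normal_ibp[OF i])
    show "\<phi> i \<in> borel_measurable ?P"
      unfolding \<phi>_def[abs_def] by (intro borel_measurable_times mf mL)
    show "\<phi>' i \<in> borel_measurable ?P"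
      unfolding \<phi>'_def[abs_def]
      by (intro borel_measurable_times borel_measurable_add borel_measurable_power borel_measurable_const mf mL)
    show "poly_bounded n (\<phi> i)" unfolding \<phi>_def[abs_def] by (intro poly_bounded_intros pL pf)
    show "poly_bounded n (\<phi>' i)"
      unfolding \<phi>'_def[abs_def] power2_eq_square by (intro poly_bounded_intros pL pf pf')
    fix x :: "nat \<Rightarrow> real"
    have dx: "((\<lambda>y. (x(i := y)) j) has_real_derivative (if j = i then 1 else 0)) (at y)" for j y
      by (cases "j = i") auto
    have dL: "((\<lambda>y. L i (x(i := y))) has_real_derivative A i i) (at y)" for y
    proof -
      have "((\<lambda>y. L i (x(i := y))) has_real_derivative (\<Sum>j<n. A i j * (if j = i then 1 else 0))) (at y)"
        unfolding L_def[abs_def] by (intro DERIV_sum DERIV_cmult dx)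
      thus ?thesis using i by (simp add: if_distrib cong: if_cong)
    qed
    \<comment> \<open>Row \<open>i\<close> and column \<open>i\<close> contribute equally by
      symmetry of \<open>A\<close>, whence the factor 2.\<close>
    have dQ: "((\<lambda>y. ?Q (x(i := y))) has_real_derivative 2 * L i (x(i := y))) (at y)" for y
    proof -
      let ?X = "x(i := y)"
      have "((\<lambda>y. ?Q (x(i := y))) has_real_derivative
          (\<Sum>a<n. \<Sum>b<n. (A a b * (if a = i then 1 else 0)) * ?X b + (if b = i then 1 else 0) * (A a b * ?X a))) (at y)"
        unfolding qform_def[abs_def] by (intro DERIV_sum DERIV_mult DERIV_cmult dx)
      also have "(\<Sum>a<n. \<Sum>b<n. (A a b * (if a = i then 1 else 0)) * ?X b + (if b = i then 1 else 0) * (A a b * ?X a))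
          = (\<Sum>a<n. if a = i then (\<Sum>b<n. A a b * ?X b) else 0) + (\<Sum>a<n. \<Sum>b<n. if b = i then A a b * ?X a else 0)"
        unfolding sum.distrib by (intro arg_cong2[of _ _ _ _ "(+)"] sum.cong refl) auto
      also have "\<dots> = L i ?X + L i ?X"
        using i sym by (simp add: L_def)
      finally show ?thesis by (simp only: mult_2)
    qed
    show "((\<lambda>y. \<phi> i (x(i := y))) has_real_derivative \<phi>' i (x(i := y))) (at y)" for y
    proof -
      have "((\<lambda>y. \<phi> i (x(i := y))) has_real_derivative
         A i i * f (?Q (x(i := y))) + (f' (?Q (x(i := y))) * (2 * L i (x(i := y)))) * L i (x(i := y))) (at y)"
        unfolding \<phi>_def[abs_def] by (intro DERIV_mult dL DERIV_chain2[OF d] dQ)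
      thus ?thesis by (simp add: \<phi>'_def power2_eq_square mult_ac)
    qed
    have cL: "continuous_on UNIV (\<lambda>y. L i (x(i := y)))" by (rule DERIV_continuous_on) (use dL in auto)
    have cQ: "continuous_on UNIV (\<lambda>y. ?Q (x(i := y)))"
      by (rule DERIV_continuous_on[where D = "\<lambda>y. 2 * L i (x(i := y))"]) (use dQ in auto)
    show "continuous_on UNIV (\<lambda>y. \<phi>' i (x(i := y)))"
      unfolding \<phi>'_def[abs_def]
      by (intro continuous_intros cL continuous_on_compose2[OF fc cQ] continuous_on_compose2[OF c cQ]) auto
  qed
  have int1: "integrable ?P (\<lambda>x. x i * \<phi> i x)" if "i < n" for i
    unfolding \<phi>_def
    by (intro integrable_poly_bounded borel_measurable_times measurable_coord_iid_normal mf mL poly_bounded_intros pL pf that)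
  have int2: "integrable ?P (\<lambda>x. f' (?Q x) * (L i x)\<^sup>2)" for i
    unfolding power2_eq_square
    by (intro integrable_poly_bounded borel_measurable_times mf mL poly_bounded_intros pL pf')
  have "(LINT x|?P. ?Q x * f (?Q x)) = (LINT x|?P. (\<Sum>i<n. x i * \<phi> i x))"
    by (simp add: qform_def[of n A] \<phi>_def L_def sum_distrib_left sum_distrib_right mult_ac)
  also have "\<dots> = (\<Sum>i<n. LINT x|?P. \<phi>' i x)"
    using int1 ibp by (subst Bochner_Integration.integral_sum) auto
  also have "\<dots> = (\<Sum>i<n. A i i * (LINT x|?P. f (?Q x)) + 2 * (LINT x|?P. f' (?Q x) * (L i x)\<^sup>2))"
    unfolding \<phi>'_def using i1 int2 by simp
  also have "\<dots> = (\<Sum>i<n. A i i) * (LINT x|?P. f (?Q x)) + 2 * (\<Sum>i<n. LINT x|?P. f' (?Q x) * (L i x)\<^sup>2)"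
    by (simp add: sum.distrib sum_distrib_right sum_distrib_left)
  also have "(\<Sum>i<n. LINT x|?P. f' (?Q x) * (L i x)\<^sup>2) = (LINT x|?P. (\<Sum>i<n. f' (?Q x) * (L i x)\<^sup>2))"
    using int2 by (subst Bochner_Integration.integral_sum) auto
  also have "\<dots> = (LINT x|?P. f' (?Q x) * qform n (mat_sq n A) x)"
    by (simp add: qform_mat_sq[of A, OF sym] L_def sum_distrib_left)
  finally show "(LINT x|?P. ?Q x * f (?Q x)) =
      (\<Sum>i<n. A i i) * (LINT x|?P. f (?Q x)) + 2 * (LINT x|?P. f' (?Q x) * qform n (mat_sq n A) x)" .
qed

text \<open>Both moments are instances of \<open>qform_stein\<close>: f = 1 gives the mean; f = id
  gives the second moment, whose last term is the mean of the form of the squared matrix, that is,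
  the trace of A^2.\<close>

lemma qform_moments:
  assumes sym: "\<And>i j. A i j = A j i"
  shows "integrable (iid_normal n) (qform n A)" "integrable (iid_normal n) (\<lambda>x. (qform n A x)\<^sup>2)"
    and "(LINT x|iid_normal n. qform n A x) = (\<Sum>i<n. A i i)"
    and "(LINT x|iid_normal n. (qform n A x)\<^sup>2) = (\<Sum>i<n. A i i)\<^sup>2 + 2 * (\<Sum>i<n. \<Sum>j<n. (A i j)\<^sup>2)"
proof -
  interpret P: prob_space "iid_normal n" by (rule prob_space_iid_normal)
  have one: "((\<lambda>_. 1) has_real_derivative 0) (at x)" for x :: real by simp
  have iden: "((\<lambda>x. x) has_real_derivative 1) (at x)" for x :: real by simp
  note s1 = qform_stein[where f = "\<lambda>_. 1" and f' = "\<lambda>_. 0" and B = 0, OF _ one]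
  note s2 = qform_stein[where f = "\<lambda>x. x" and f' = "\<lambda>_. 1" and B = 1, OF _ iden]
  have e: "(LINT x|iid_normal n. qform n A x) = (\<Sum>i<n. A i i)" if "\<And>i j. A i j = A j i" for A
    using s1(4)[OF that, of n] P.prob_space by simp
  show "integrable (iid_normal n) (qform n A)" using s1(2)[OF sym, of n] by simp
  show "(LINT x|iid_normal n. qform n A x) = (\<Sum>i<n. A i i)" by (rule e[OF sym])
  show "integrable (iid_normal n) (\<lambda>x. (qform n A x)\<^sup>2)"
    using s2(2)[OF sym, of n] by (simp add: power2_eq_square)
  have "(\<Sum>i<n. mat_sq n A i i) = (\<Sum>i<n. \<Sum>j<n. (A i j)\<^sup>2)"
    unfolding mat_sq_def by (intro sum.cong refl) (metis sym power2_eq_square)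
  thus "(LINT x|iid_normal n. (qform n A x)\<^sup>2) = (\<Sum>i<n. A i i)\<^sup>2 + 2 * (\<Sum>i<n. \<Sum>j<n. (A i j)\<^sup>2)"
    using s2(4)[OF sym, of n] e[OF sym] e[OF mat_sq_sym[of A n, OF sym]] by (simp add: power2_eq_square)
qed

text \<open>\<open>G\<close> below is a Stein kernel for \<open>F\<close>: E[F f(F)] = E[f'(F) G]
  with E G = 1. Stein's equation turns the left-hand side into |E[f'(F) (1 - G)]|, which is at most
  8 times the standard deviation of \<open>G\<close>. As \<open>G\<close> is a multiple of the form
  of A^2, its variance involves the trace of A^4.\<close>

lemma qform_clt_bound:
  fixes h :: "real \<Rightarrow> real"
  assumes sym: "\<And>i j. A i j = A j i" and pos: "0 < (\<Sum>i<n. \<Sum>j<n. (A i j)\<^sup>2)"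
    and h: "continuous_on UNIV h" and osc: "\<And>x y. \<bar>h y - h x\<bar> \<le> 1 + \<bar>y - x\<bar>"
  defines "T \<equiv> (\<Sum>i<n. \<Sum>j<n. (A i j)\<^sup>2)"
  shows "\<bar>(LINT x|iid_normal n. h ((qform n A x - (\<Sum>i<n. A i i)) / sqrt (2 * T))) - integral\<^sup>L std_normal_distribution h\<bar>
     \<le> 8 * sqrt (2 * (\<Sum>i<n. \<Sum>j<n. (mat_sq n A i j)\<^sup>2)) / T"
proof -
  interpret P: prob_space "iid_normal n" by (rule prob_space_iid_normal)
  let ?P = "iid_normal n"
  let ?Q = "qform n A"
  let ?A2 = "mat_sq n A"
  define m where "m = integral\<^sup>L std_normal_distribution h"
  define t where "t = (\<Sum>i<n. A i i)"
  define U where "U = (\<Sum>i<n. \<Sum>j<n. (?A2 i j)\<^sup>2)"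
  define c where "c = 1 / sqrt (2 * T)"
  have T: "0 < T" using pos by (simp add: T_def)
  have c0: "0 < c" and c2: "2 * c\<^sup>2 * T = 1" using T by (auto simp: c_def power_divide)
  obtain f f' where f: "\<And>x. (f has_real_derivative f' x) (at x)" and f'c: "continuous_on UNIV f'"
    and eq: "\<And>x. f' x - x * f x = h x - m" and f'b: "\<And>x. \<bar>f' x\<bar> \<le> 8"
    by (rule stein_equation[OF h osc, folded m_def], rule that)
  define F where "F x = c * (?Q x - t)" for x
  define G where "G x = 2 * c\<^sup>2 * qform n ?A2 x" for x
  \<comment> \<open>Centring and scaling are put into the function instead of the matrix; the chain
    rule then supplies one of the two factors \<open>c\<close> in \<open>G\<close>.\<close>
  have fd: "((\<lambda>q. f (c * (q - t))) has_real_derivative f' (c * (q - t)) * c) (at q)" for q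
    by (intro DERIV_chain2[OF f]) (auto intro!: derivative_eq_intros)
  have fcc: "continuous_on UNIV (\<lambda>q. f' (c * (q - t)) * c)"
    by (intro continuous_intros continuous_on_compose2[OF f'c]) auto
  have fb: "\<bar>f' (c * (q - t)) * c\<bar> \<le> 8 * c" for q
    using f'b[of "c * (q - t)"] c0 by (simp add: abs_mult)
  note S = qform_stein[of A, OF sym fd fcc fb, of n, folded F_def t_def]
  have iFf: "integrable ?P (\<lambda>x. F x * f (F x))"
  proof -
    have "integrable ?P (\<lambda>x. c * (?Q x * f (F x)) - c * t * f (F x))"
      using S(1,2) by (intro Bochner_Integration.integrable_diff integrable_mult_right) auto
    thus ?thesis by (simp add: F_def algebra_simps)
  qed
  have if'G: "integrable ?P (\<lambda>x. f' (F x) * G x)"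
    using integrable_mult_right[OF S(3), of "2 * c"] by (simp add: G_def power2_eq_square mult_ac)
  have E1: "(LINT x|?P. F x * f (F x)) = (LINT x|?P. f' (F x) * G x)"
  proof -
    have "(LINT x|?P. F x * f (F x)) = (LINT x|?P. c * (?Q x * f (F x)) - c * t * f (F x))"
      by (simp add: F_def algebra_simps)
    also have "\<dots> = c * (LINT x|?P. ?Q x * f (F x)) - c * t * (LINT x|?P. f (F x))"
      using S(1,2) by simp
    also have "\<dots> = 2 * c * (LINT x|?P. f' (F x) * c * qform n ?A2 x)"
      unfolding S(4) by (simp add: algebra_simps)
    also have "\<dots> = (LINT x|?P. 2 * c * (f' (F x) * c * qform n ?A2 x))" by simp
    finally show ?thesis by (simp add: G_def power2_eq_square mult_ac)
  qed
  have mF: "F \<in> borel_measurable ?P"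
    unfolding F_def[abs_def] using measurable_qform[of n A] by measurable
  have if': "integrable ?P (\<lambda>x. f' (F x))"
  proof (rule P.integrable_const_bound[where B = 8])
    show "(\<lambda>x. f' (F x)) \<in> borel_measurable ?P"
      by (rule measurable_compose[OF mF borel_measurable_continuous_onI[OF f'c]])
  qed (use f'b in auto)
  note mom = qform_moments[of ?A2 n, OF mat_sq_sym[of A n, OF sym]]
  \<comment> \<open>The trace of A^2 is the squared Frobenius norm, so the normalisation by
    \<open>sqrt (2 * T)\<close> is exactly what makes the mean of \<open>G\<close> equal to
    1.\<close>
  have tr: "(\<Sum>i<n. ?A2 i i) = T"
    unfolding mat_sq_def T_def by (intro sum.cong refl) (metis sym power2_eq_square)
  have iG: "integrable ?P G" "integrable ?P (\<lambda>x. (G x)\<^sup>2)"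
    using mom(1,2) by (auto simp: G_def[abs_def] power_mult_distrib)
  have EG: "(LINT x|?P. G x) = 1"
    using mom(3) c2 by (simp add: G_def tr)
  have EG2: "(LINT x|?P. (G x)\<^sup>2) = 1 + 8 * c ^ 4 * U"
  proof -
    have "(LINT x|?P. (G x)\<^sup>2) = (2 * c\<^sup>2)\<^sup>2 * (T\<^sup>2 + 2 * U)"
      using mom(4) by (simp add: G_def power_mult_distrib tr U_def)
    also have "\<dots> = (2 * c\<^sup>2 * T)\<^sup>2 + 8 * c ^ 4 * U" by (simp add: power2_eq_square power4_eq_xxxx algebra_simps)
    finally show ?thesis by (simp add: c2)
  qed
  \<comment> \<open>Cauchy-Schwarz in the form that the variance of |1 - G| is nonnegative.\<close>
  have var: "(LINT x|?P. \<bar>1 - G x\<bar>) \<le> sqrt (8 * c ^ 4 * U)"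
  proof (rule real_le_rsqrt)
    have i2: "integrable ?P (\<lambda>x. \<bar>1 - G x\<bar>\<^sup>2)"
      using iG by (simp add: power2_diff)
    have "0 \<le> P.variance (\<lambda>x. \<bar>1 - G x\<bar>)" by (rule P.variance_positive)
    also have "\<dots> = (LINT x|?P. \<bar>1 - G x\<bar>\<^sup>2) - (LINT x|?P. \<bar>1 - G x\<bar>)\<^sup>2"
      using iG i2 by (intro P.variance_eq) auto
    also have "(LINT x|?P. \<bar>1 - G x\<bar>\<^sup>2) = (LINT x|?P. 1 + (G x)\<^sup>2 - 2 * G x)"
      by (simp add: power2_diff)
    also have "\<dots> = 8 * c ^ 4 * U" using iG EG EG2 P.prob_space by simp
    finally show "(LINT x|?P. \<bar>1 - G x\<bar>)\<^sup>2 \<le> 8 * c ^ 4 * U" by simp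
  qed
  have hF: "integrable ?P (\<lambda>x. h (F x))"
  proof -
    have "h (F x) = f' (F x) - F x * f (F x) + m" for x using eq[of "F x"] by simp
    thus ?thesis using if' iFf by simp
  qed
  have "(LINT x|?P. h (F x)) - m = (LINT x|?P. h (F x) - m)" using hF P.prob_space by simp
  also have "\<dots> = (LINT x|?P. f' (F x) - F x * f (F x))" using eq by simp
  also have "\<dots> = (LINT x|?P. f' (F x)) - (LINT x|?P. f' (F x) * G x)"
    using if' iFf E1 by simp
  also have "\<dots> = (LINT x|?P. f' (F x) * (1 - G x))"
    using if' if'G by (simp add: right_diff_distrib)
  finally have "\<bar>(LINT x|?P. h (F x)) - m\<bar> = \<bar>LINT x|?P. f' (F x) * (1 - G x)\<bar>" by simp
  also have "\<dots> \<le> (LINT x|?P. \<bar>f' (F x) * (1 - G x)\<bar>)"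
    using integral_norm_bound[of ?P "\<lambda>x. f' (F x) * (1 - G x)"] by simp
  also have "\<dots> \<le> (LINT x|?P. 8 * \<bar>1 - G x\<bar>)"
  proof (rule integral_mono)
    show "integrable ?P (\<lambda>x. \<bar>f' (F x) * (1 - G x)\<bar>)"
      using if' if'G by (intro integrable_abs) (simp add: right_diff_distrib)
  qed (use iG f'b in \<open>auto simp: abs_mult intro!: mult_right_mono\<close>)
  also have "\<dots> \<le> 8 * sqrt (8 * c ^ 4 * U)" using var by simp
  also have "8 * c ^ 4 * U = 2 * U / T\<^sup>2"
  proof -
    have "c ^ 4 = (1 / (2 * T))\<^sup>2" using T by (simp add: c_def power4_eq_xxxx power2_eq_square)
    thus ?thesis using T by (simp add: power2_eq_square field_simps)
  qed
  also have "sqrt (2 * U / T\<^sup>2) = sqrt (2 * U) / T" using T by (simp add: real_sqrt_divide)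
  finally show ?thesis by (simp add: F_def c_def t_def U_def m_def)
qed

section \<open>The squared norm of a Gaussian vector\<close>

text \<open>Polynomials are uniformly dense in the continuous functions on [0,1], so equal moments
  give equal expectations of cosines and sines, hence equal characteristic functions.\<close>

lemma moments_unit_interval_unique:
  assumes \<mu>: "real_distribution \<mu>" and \<nu>: "real_distribution \<nu>"
    and supp: "AE x in \<mu>. x \<in> {0..1}" "AE x in \<nu>. x \<in> {0..1}"
    and mom: "\<And>k::nat. (LINT x|\<mu>. x ^ k) = (LINT x|\<nu>. x ^ k)"
  shows "\<mu> = \<nu>"
proof (rule Levy_uniqueness[OF \<mu> \<nu>], rule ext)
  fix t :: real
  interpret \<mu>: real_distribution \<mu> by fact
  interpret \<nu>: real_distribution \<nu> by fact
  have bnd: "integrable \<kappa> \<phi>" if k: "real_distribution \<kappa>" "AE x in \<kappa>. x \<in> {0..1}" and p: "continuous_on UNIV \<phi>"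
    for \<kappa> and \<phi> :: "real \<Rightarrow> real"
  proof -
    interpret \<kappa>: real_distribution \<kappa> by fact
    have "compact (\<phi> ` {0..1})" by (intro compact_continuous_image continuous_on_subset[OF p]) auto
    then obtain B where "\<forall>y\<in>\<phi> ` {0..1}. norm y \<le> B" using compact_imp_bounded bounded_iff by blast
    thus ?thesis using k(2) borel_measurable_continuous_onI[OF p]
      by (intro \<kappa>.integrable_const_bound[where B = B]) (auto elim: AE_mp)
  qed
  have eq: "(LINT x|\<mu>. \<phi> x) = (LINT x|\<nu>. \<phi> x)" if p: "continuous_on UNIV \<phi>" for \<phi> :: "real \<Rightarrow> real"
  proof -
    have "\<bar>(LINT x|\<mu>. \<phi> x) - (LINT x|\<nu>. \<phi> x)\<bar> \<le> e" if "0 < e" for e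
    proof -
      have pre: "compact {0..1::real}" "continuous_on {0..1} \<phi>" "0 < e / 2"
        using that continuous_on_subset[OF p] by auto
      obtain g where "real_polynomial_function g" and g: "\<And>x. x \<in> {0..1} \<Longrightarrow> \<bar>\<phi> x - g x\<bar> < e / 2"
        by (rule Stone_Weierstrass_real_polynomial_function[OF pre], rule that)
      then obtain a n where ga: "g = (\<lambda>x. \<Sum>i\<le>n. a i * x ^ i)"
        using real_polynomial_function_iff_sum by blast
      have gc: "continuous_on UNIV g" unfolding ga by (intro continuous_intros)
      have ck: "continuous_on UNIV (\<lambda>x::real. x ^ k)" for k by (intro continuous_intros)
      have gg: "(LINT x|\<mu>. g x) = (LINT x|\<nu>. g x)"
        unfolding ga using bnd[OF \<mu> supp(1) ck] bnd[OF \<nu> supp(2) ck] mom by simp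
      have cl: "\<bar>(LINT x|\<kappa>. \<phi> x) - (LINT x|\<kappa>. g x)\<bar> \<le> e / 2"
        if k: "real_distribution \<kappa>" "AE x in \<kappa>. x \<in> {0..1}" for \<kappa>
      proof -
        interpret \<kappa>: real_distribution \<kappa> by fact
        have "\<bar>(LINT x|\<kappa>. \<phi> x) - (LINT x|\<kappa>. g x)\<bar> = \<bar>LINT x|\<kappa>. \<phi> x - g x\<bar>"
          using bnd[OF k p] bnd[OF k gc] by simp
        also have "\<dots> \<le> (LINT x|\<kappa>. \<bar>\<phi> x - g x\<bar>)"
          using integral_norm_bound[of \<kappa> "\<lambda>x. \<phi> x - g x"] by simp
        also have "\<dots> \<le> (LINT x|\<kappa>. e / 2)"
        proof (rule integral_mono_AE)
          show "AE x in \<kappa>. \<bar>\<phi> x - g x\<bar> \<le> e / 2"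
            using k(2) by eventually_elim (use g in \<open>auto intro: less_imp_le\<close>)
        qed (use bnd[OF k p] bnd[OF k gc] in auto)
        also have "\<dots> = e / 2" using \<kappa>.prob_space by simp
        finally show ?thesis .
      qed
      show ?thesis using cl[OF \<mu> supp(1)] cl[OF \<nu> supp(2)] gg by linarith
    qed
    hence "\<bar>(LINT x|\<mu>. \<phi> x) - (LINT x|\<nu>. \<phi> x)\<bar> \<le> 0" by (rule field_le_epsilon) simp
    thus ?thesis by simp
  qed
  have "char \<kappa> t = complex_of_real (LINT x|\<kappa>. cos (t * x)) + \<i> * complex_of_real (LINT x|\<kappa>. sin (t * x))"
    if k: "real_distribution \<kappa>" "AE x in \<kappa>. x \<in> {0..1}" for \<kappa>
  proof -
    have c: "integrable \<kappa> (\<lambda>x. cos (t * x))" "integrable \<kappa> (\<lambda>x. sin (t * x))"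
      by (intro bnd[OF k] continuous_intros)+
    have "char \<kappa> t = (LINT x|\<kappa>. complex_of_real (cos (t * x)) + \<i> * complex_of_real (sin (t * x)))"
      unfolding char_def by (intro Bochner_Integration.integral_cong refl) (simp only: exp_Euler cos_of_real sin_of_real)
    also have "\<dots> = (LINT x|\<kappa>. complex_of_real (cos (t * x))) + \<i> * (LINT x|\<kappa>. complex_of_real (sin (t * x)))"
      using c by simp
    finally show ?thesis by simp
  qed
  thus "char \<mu> t = char \<nu> t"
    using eq[of "\<lambda>x. cos (t * x)"] eq[of "\<lambda>x. sin (t * x)"] \<mu> \<nu> supp by (simp add: continuous_intros)
qed

text \<open>Approximate \<open>A\<close> from inside by a compact set for \<open>\<mu>\<close> and
  from outside by an open set for \<open>\<nu>\<close>. A Urysohn function between the two sets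
  transfers the estimate from continuous functions to \<open>A\<close> with the same
  constant.\<close>

lemma measure_diff_le_continuous:
  assumes \<mu>: "real_distribution \<mu>" and \<nu>: "real_distribution \<nu>"
    and le: "\<And>h :: real \<Rightarrow> real. continuous_on UNIV h \<Longrightarrow> (\<And>x. 0 \<le> h x \<and> h x \<le> 1) \<Longrightarrow>
      (LINT x|\<mu>. h x) - (LINT x|\<nu>. h x) \<le> e"
    and A: "A \<in> sets borel"
  shows "measure \<mu> A - measure \<nu> A \<le> e"
proof (rule field_le_epsilon)
  fix d :: real assume d: "0 < d"
  interpret \<mu>: real_distribution \<mu> by fact
  interpret \<nu>: real_distribution \<nu> by fact
  have "emeasure \<mu> A = (SUP K \<in> {K. K \<subseteq> A \<and> compact K}. emeasure \<mu> K)"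
    using A by (intro inner_regular) auto
  \<comment> \<open>\<open>ennreal\<close> truncates negative numbers to 0, so the strict inequality
    can fail when \<open>A\<close> is a null set of \<open>\<mu>\<close>; the second alternative
    covers this, with the empty set as the compact one.\<close>
  moreover have "ennreal (measure \<mu> A - d / 2) < emeasure \<mu> A \<or> measure \<mu> A - d / 2 < 0"
    using d by (auto simp: \<mu>.emeasure_eq_measure ennreal_less_iff)
  ultimately obtain K where K: "K \<subseteq> A" "compact K" "measure \<mu> A - d / 2 \<le> measure \<mu> K"
  proof (elim disjE)
    assume *: "emeasure \<mu> A = (SUP K \<in> {K. K \<subseteq> A \<and> compact K}. emeasure \<mu> K)"
      "ennreal (measure \<mu> A - d / 2) < emeasure \<mu> A"
    hence "\<exists>K \<in> {K. K \<subseteq> A \<and> compact K}. ennreal (measure \<mu> A - d / 2) < emeasure \<mu> K"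
      by (simp add: less_SUP_iff)
    thus thesis using that by (auto simp: \<mu>.emeasure_eq_measure ennreal_less_iff less_imp_le intro: ccontr)
         (metis ennreal_less_iff ennreal_neg less_imp_le linorder_not_le measure_nonneg)
  next
    assume "measure \<mu> A - d / 2 < 0"
    thus thesis using that[of "{}"] by simp
  qed
  have "emeasure \<nu> A = (INF U \<in> {U. A \<subseteq> U \<and> open U}. emeasure \<nu> U)"
    using A by (intro outer_regular) auto
  moreover have "emeasure \<nu> A < ennreal (measure \<nu> A + d / 2)"
    using d by (auto simp: \<nu>.emeasure_eq_measure ennreal_less_iff)
  ultimately have "\<exists>U \<in> {U. A \<subseteq> U \<and> open U}. emeasure \<nu> U < ennreal (measure \<nu> A + d / 2)"
    by (simp add: INF_less_iff)
  then obtain U where U: "A \<subseteq> U" "open U" "measure \<nu> U < measure \<nu> A + d / 2"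
    by (auto simp: \<nu>.emeasure_eq_measure ennreal_less_iff)
  obtain h :: "real \<Rightarrow> real" where h: "continuous_on UNIV h" "\<And>x. h x \<in> closed_segment 1 0"
    "\<And>x. x \<in> K \<Longrightarrow> h x = 1" "\<And>x. x \<in> - U \<Longrightarrow> h x = 0"
    using Urysohn[of K "- U" 1 0] K(1,2) U(1,2) by (auto intro: compact_imp_closed)
  have h01: "0 \<le> h x \<and> h x \<le> 1" for x using h(2)[of x] by (simp add: closed_segment_eq_real_ivl)
  have hm: "h \<in> borel_measurable borel" by (rule borel_measurable_continuous_onI[OF h(1)])
  have [measurable]: "K \<in> sets borel" "U \<in> sets borel" using K(2) U(2) by (auto simp: compact_imp_closed)
  note hm[measurable]
  have "measure \<mu> K = (LINT x|\<mu>. indicator K x)" using K(2) by (simp add: compact_imp_closed borel_closed)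
  also have "\<dots> \<le> (LINT x|\<mu>. h x)"
    using h01 h(3) by (intro integral_mono \<mu>.integrable_const_bound[where B = 1])
      (auto simp: indicator_def)
  finally have 1: "measure \<mu> K \<le> (LINT x|\<mu>. h x)" .
  have "(LINT x|\<nu>. h x) \<le> (LINT x|\<nu>. indicator U x)"
    using h01 h(4) by (intro integral_mono \<nu>.integrable_const_bound[where B = 1])
      (auto simp: indicator_def)
  also have "\<dots> = measure \<nu> U" using U(2) by simp
  finally have 2: "(LINT x|\<nu>. h x) \<le> measure \<nu> U" .
  show "measure \<mu> A - measure \<nu> A \<le> e + d"
    using 1 2 K(3) U(3) le[OF h(1) h01] by simp
qed

section \<open>Gaussian vectors and the law of their squared norm\<close>

text \<open>Scaling a standard normal covers the point mass at 0 and the nondegenerate laws by one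
  formula, so moments and characteristic functions are computed without a case split.\<close>

lemma centered_normal_conv_distr:
  assumes "0 \<le> \<sigma>" shows "centered_normal \<sigma> = distr std_normal_distribution borel (\<lambda>x. \<sigma> * x)"
proof (cases "\<sigma> = 0")
  case True
  interpret prob_space std_normal_distribution by (rule prob_space_std_normal)
  show ?thesis using True by (simp add: centered_normal_def distr_const)
next
  case False
  interpret prob_space std_normal_distribution by (rule prob_space_std_normal)
  have "distributed std_normal_distribution lborel (\<lambda>x. x) std_normal_density"
    by (simp add: distributed_def distr_id2)
  from normal_density_affine[OF this _ False, of 0]
  have "distributed std_normal_distribution lborel (\<lambda>x. \<sigma> * x) (normal_density 0 \<sigma>)"
    using assms by simp
  hence "distr std_normal_distribution lborel (\<lambda>x. \<sigma> * x) = density lborel (normal_density 0 \<sigma>)"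
    by (simp add: distributed_def)
  moreover have "distr std_normal_distribution borel (\<lambda>x. \<sigma> * x) = distr std_normal_distribution lborel (\<lambda>x. \<sigma> * x)"
    by (intro distr_cong) auto
  ultimately show ?thesis using False by (simp add: centered_normal_def)
qed

lemma (in prob_space) centered_normal_props:
  assumes Y[measurable]: "Y \<in> borel_measurable M" and \<sigma>: "0 \<le> \<sigma>" "distr M borel Y = centered_normal \<sigma>"
  shows "integrable M (\<lambda>\<omega>. (Y \<omega>)\<^sup>2)" "expectation (\<lambda>\<omega>. (Y \<omega>)\<^sup>2) = \<sigma>\<^sup>2"
    and "(CLINT \<omega>|M. iexp (Y \<omega>)) = exp (- complex_of_real (\<sigma>\<^sup>2) / 2)"
proof -
  have eq: "distr M borel Y = distr std_normal_distribution borel (\<lambda>x. \<sigma> * x)"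
    using \<sigma> centered_normal_conv_distr by simp
  have "integrable std_normal_distribution (\<lambda>x. (\<sigma> * x)\<^sup>2)"
    using integrable_std_normal_distribution_moment[of 2] by (simp add: power_mult_distrib)
  hence "integrable (distr std_normal_distribution borel (\<lambda>x. \<sigma> * x)) (\<lambda>y. y\<^sup>2)"
    by (subst integrable_distr_eq) auto
  thus "integrable M (\<lambda>\<omega>. (Y \<omega>)\<^sup>2)"
    unfolding eq[symmetric] by (subst (asm) integrable_distr_eq) auto
  have "expectation (\<lambda>\<omega>. (Y \<omega>)\<^sup>2) = (LINT y|distr M borel Y. y\<^sup>2)"
    by (subst integral_distr) auto
  also have "\<dots> = (LINT x|std_normal_distribution. (\<sigma> * x)\<^sup>2)"
    unfolding eq by (subst integral_distr) auto
  also have "\<dots> = \<sigma>\<^sup>2" by (simp add: power_mult_distrib std_normal_moments)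
  finally show "expectation (\<lambda>\<omega>. (Y \<omega>)\<^sup>2) = \<sigma>\<^sup>2" .
  have "(CLINT \<omega>|M. iexp (Y \<omega>)) = (CLINT y|distr M borel Y. iexp y)"
    by (subst integral_distr) auto
  also have "\<dots> = (CLINT x|std_normal_distribution. iexp (\<sigma> * x))"
    unfolding eq by (subst integral_distr) auto
  also have "\<dots> = char std_normal_distribution \<sigma>" by (simp add: char_def)
  also have "\<dots> = exp (complex_of_real (- (\<sigma>\<^sup>2) / 2))"
    unfolding char_std_normal_distribution exp_of_real ..
  also have "complex_of_real (- (\<sigma>\<^sup>2) / 2) = - complex_of_real (\<sigma>\<^sup>2) / 2" by simp
  finally show "(CLINT \<omega>|M. iexp (Y \<omega>)) = exp (- complex_of_real (\<sigma>\<^sup>2) / 2)" .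
qed

locale gaussian_vector = prob_space M for M :: "'a measure" +
  fixes n :: nat and X :: "nat \<Rightarrow> 'a \<Rightarrow> real"
  assumes measurable_X: "i < n \<Longrightarrow> X i \<in> borel_measurable M"
    and normal_X: "\<exists>\<sigma>\<ge>0. distr M borel (\<lambda>\<omega>. \<Sum>i<n. \<theta> i * X i \<omega>) = centered_normal \<sigma>"
begin

definition covar :: "nat \<Rightarrow> nat \<Rightarrow> real" where
  "covar i j = expectation (\<lambda>\<omega>. X i \<omega> * X j \<omega>)"

lemma covar_sym: "covar i j = covar j i"
  by (simp add: covar_def mult.commute)

lemma measurable_lin: "(\<lambda>\<omega>. \<Sum>i<n. \<theta> i * X i \<omega>) \<in> borel_measurable M"
  using measurable_X by (intro borel_measurable_sum borel_measurable_times) auto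

lemma integrable_X_X:
  assumes "i < n" "j < n" shows "integrable M (\<lambda>\<omega>. X i \<omega> * X j \<omega>)"
proof -
  \<comment> \<open>The unit coefficient vector at \<open>k\<close> turns normality of linear
    combinations into a second moment for the single coordinate.\<close>
  have sq: "integrable M (\<lambda>\<omega>. (X k \<omega>)\<^sup>2)" if "k < n" for k
  proof -
    obtain \<sigma> where "0 \<le> \<sigma>" "distr M borel (\<lambda>\<omega>. \<Sum>i<n. (if i = k then 1 else 0) * X i \<omega>) = centered_normal \<sigma>"
      using normal_X[of "\<lambda>i. if i = k then 1 else 0"] by blast
    from centered_normal_props(1)[OF measurable_lin this]
    have "integrable M (\<lambda>\<omega>. (\<Sum>i<n. (if i = k then 1 else 0) * X i \<omega>)\<^sup>2)" .
    moreover have "(\<Sum>i<n. (if i = k then 1 else 0) * X i \<omega>) = X k \<omega>" for \<omega>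
    proof -
      have "(\<Sum>i<n. (if i = k then 1 else 0) * X i \<omega>) = (\<Sum>i<n. if i = k then X i \<omega> else 0)"
        by (intro sum.cong refl) simp
      thus ?thesis using that by simp
    qed
    ultimately show ?thesis by simp
  qed
  show ?thesis
  proof (rule Bochner_Integration.integrable_bound)
    show "integrable M (\<lambda>\<omega>. (X i \<omega>)\<^sup>2 + (X j \<omega>)\<^sup>2)" using sq assms by simp
    show "AE \<omega> in M. norm (X i \<omega> * X j \<omega>) \<le> norm ((X i \<omega>)\<^sup>2 + (X j \<omega>)\<^sup>2)"
    proof (rule AE_I2)
      fix \<omega>
      have "2 * \<bar>X i \<omega>\<bar> * \<bar>X j \<omega>\<bar> \<le> \<bar>X i \<omega>\<bar>\<^sup>2 + \<bar>X j \<omega>\<bar>\<^sup>2" by (rule sum_squares_bound)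
      moreover have "0 \<le> \<bar>X i \<omega>\<bar> * \<bar>X j \<omega>\<bar>" by simp
      ultimately have "\<bar>X i \<omega>\<bar> * \<bar>X j \<omega>\<bar> \<le> (X i \<omega>)\<^sup>2 + (X j \<omega>)\<^sup>2"
        unfolding mult.assoc power2_abs by linarith
      thus "norm (X i \<omega> * X j \<omega>) \<le> norm ((X i \<omega>)\<^sup>2 + (X j \<omega>)\<^sup>2)"
        by (simp add: abs_mult)
    qed
    show "(\<lambda>\<omega>. X i \<omega> * X j \<omega>) \<in> borel_measurable M"
      by (intro borel_measurable_times measurable_X assms)
  qed
qed

lemma second_moment_lin:
  "integrable M (\<lambda>\<omega>. (\<Sum>i<n. \<theta> i * X i \<omega>)\<^sup>2)"
  "expectation (\<lambda>\<omega>. (\<Sum>i<n. \<theta> i * X i \<omega>)\<^sup>2) = qform n covar \<theta>"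
proof -
  have e: "(\<lambda>\<omega>. (\<Sum>i<n. \<theta> i * X i \<omega>)\<^sup>2) = (\<lambda>\<omega>. \<Sum>i<n. \<Sum>j<n. \<theta> i * \<theta> j * (X i \<omega> * X j \<omega>))"
    by (simp add: power2_eq_square sum_product mult_ac)
  show "integrable M (\<lambda>\<omega>. (\<Sum>i<n. \<theta> i * X i \<omega>)\<^sup>2)"
    unfolding e by (intro Bochner_Integration.integrable_sum integrable_mult_right integrable_X_X) auto
  have "expectation (\<lambda>\<omega>. (\<Sum>i<n. \<theta> i * X i \<omega>)\<^sup>2) =
      (\<Sum>i<n. \<Sum>j<n. expectation (\<lambda>\<omega>. \<theta> i * \<theta> j * (X i \<omega> * X j \<omega>)))"
    unfolding e
    by (subst Bochner_Integration.integral_sum,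
        intro Bochner_Integration.integrable_sum integrable_mult_right integrable_X_X, simp, simp,
        intro sum.cong refl Bochner_Integration.integral_sum integrable_mult_right integrable_X_X, auto)
  also have "\<dots> = qform n covar \<theta>"
    unfolding qform_def covar_def by (intro sum.cong refl) (simp add: mult_ac)
  finally show "expectation (\<lambda>\<omega>. (\<Sum>i<n. \<theta> i * X i \<omega>)\<^sup>2) = qform n covar \<theta>" .
qed

lemma qform_covar_nonneg: "0 \<le> qform n covar \<theta>"
  unfolding second_moment_lin(2)[symmetric] by (intro integral_nonneg_AE AE_I2) simp

text \<open>The variance is only asserted to exist in \<open>normal_X\<close>; comparing second
  moments identifies it with the covariance form.\<close>

lemma char_lin:
  "(CLINT \<omega>|M. iexp (\<Sum>i<n. \<theta> i * X i \<omega>)) = complex_of_real (exp (- qform n covar \<theta> / 2))"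
proof -
  obtain \<sigma> where \<sigma>: "0 \<le> \<sigma>" "distr M borel (\<lambda>\<omega>. \<Sum>i<n. \<theta> i * X i \<omega>) = centered_normal \<sigma>"
    using normal_X[of \<theta>] by blast
  note p = centered_normal_props[OF measurable_lin \<sigma>]
  have "\<sigma>\<^sup>2 = qform n covar \<theta>" using p(2) second_moment_lin(2) by simp
  thus ?thesis using p(3) by (simp add: exp_of_real[symmetric])
qed

text \<open>The Hubbard--Stratonovich identity
  \<open>exp (- s \<bar>X\<bar>\<^sup>2) = E\<^sub>g [exp (\<i> sqrt (2 s) g \<bullet> X)]\<close> turns the Laplace transform of the squared norm into
  that of a quadratic form in independent Gaussians.\<close>

lemma laplace_sum_squares:
  assumes s: "0 \<le> s"
  shows "expectation (\<lambda>\<omega>. exp (- s * (\<Sum>i<n. (X i \<omega>)\<^sup>2))) = (LINT g|iid_normal n. exp (- s * qform n covar g))"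
proof -
  let ?P = "iid_normal n"
  interpret P: prob_space ?P by (rule prob_space_iid_normal)
  interpret PP: pair_prob_space M ?P ..
  define r where "r = sqrt (2 * s)"
  have r2: "r\<^sup>2 = 2 * s" using s by (simp add: r_def)
  define k where "k \<omega> g = iexp (\<Sum>i<n. (r * g i) * X i \<omega>)" for \<omega> and g :: "nat \<Rightarrow> real"
  have m: "case_prod k \<in> borel_measurable (M \<Otimes>\<^sub>M ?P)"
  proof -
    have a: "(\<lambda>z. X i (fst z)) \<in> borel_measurable (M \<Otimes>\<^sub>M ?P)" if "i < n" for i
      by (rule measurable_compose[OF measurable_fst measurable_X[OF that]])
    have b: "(\<lambda>z. snd z i) \<in> borel_measurable (M \<Otimes>\<^sub>M ?P)" if "i < n" for i
      by (rule measurable_compose[OF measurable_snd measurable_coord_iid_normal[OF that]])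
    have "(\<lambda>z. \<Sum>i<n. (r * snd z i) * X i (fst z)) \<in> borel_measurable (M \<Otimes>\<^sub>M ?P)"
      using a b by (intro borel_measurable_sum borel_measurable_times borel_measurable_const) auto
    hence "(\<lambda>z. iexp (\<Sum>i<n. (r * snd z i) * X i (fst z))) \<in> borel_measurable (M \<Otimes>\<^sub>M ?P)" by measurable
    thus ?thesis by (simp add: k_def case_prod_unfold)
  qed
  have "integrable (M \<Otimes>\<^sub>M ?P) (case_prod k)"
    using m by (intro PP.integrable_const_bound[where B = 1]) (auto simp: k_def)
  from PP.Fubini_integral[OF this]
  \<comment> \<open>Integrating \<open>\<omega>\<close> out first gives the characteristic function
    of X at r g, an exponential of the covariance form; integrating g out first gives a product of
    one-dimensional normal characteristic functions, an exponential of the sum of squares.\<close>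
  have F: "(CLINT g|?P. CLINT \<omega>|M. k \<omega> g) = (CLINT \<omega>|M. CLINT g|?P. k \<omega> g)" .
  have "(CLINT \<omega>|M. k \<omega> g) = complex_of_real (exp (- s * qform n covar g))" for g
  proof -
    have "qform n covar (\<lambda>i. r * g i) = r\<^sup>2 * qform n covar g"
      by (simp add: qform_def sum_distrib_left power2_eq_square mult_ac)
    thus ?thesis unfolding k_def char_lin by (simp add: r2)
  qed
  moreover have "(CLINT g|?P. k \<omega> g) = complex_of_real (exp (- s * (\<Sum>i<n. (X i \<omega>)\<^sup>2)))" for \<omega>
  proof -
    have "k \<omega> g = (\<Prod>i<n. iexp ((r * X i \<omega>) * g i))" for g
      by (simp add: k_def exp_sum[symmetric] sum_distrib_left mult_ac)
    hence "(CLINT g|?P. k \<omega> g) = (CLINT g|?P. \<Prod>i<n. iexp ((r * X i \<omega>) * g i))" by simp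
    also have "\<dots> = (\<Prod>i<n. CLINT y|std_normal_distribution. iexp ((r * X i \<omega>) * y))"
    proof (rule normals.product_integral_prod)
      interpret N: prob_space std_normal_distribution by (rule prob_space_std_normal)
      show "integrable std_normal_distribution (\<lambda>y. iexp ((r * X i \<omega>) * y))" for i
        by (intro N.integrable_const_bound[where B = 1]) auto
    qed simp
    also have "\<dots> = (\<Prod>i<n. complex_of_real (exp (- s * (X i \<omega>)\<^sup>2)))"
    proof (intro prod.cong refl)
      fix i
      have "(CLINT y|std_normal_distribution. iexp ((r * X i \<omega>) * y)) = complex_of_real (exp (- ((r * X i \<omega>)\<^sup>2) / 2))"
        using fun_cong[OF char_std_normal_distribution, of "r * X i \<omega>"] unfolding char_def .
      also have "- ((r * X i \<omega>)\<^sup>2) / 2 = - s * (X i \<omega>)\<^sup>2" by (simp add: power_mult_distrib r2)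
      finally show "(CLINT y|std_normal_distribution. iexp ((r * X i \<omega>) * y)) = complex_of_real (exp (- s * (X i \<omega>)\<^sup>2))" .
    qed
    also have "\<dots> = complex_of_real (exp (- s * (\<Sum>i<n. (X i \<omega>)\<^sup>2)))"
      by (simp add: exp_sum[symmetric] sum_distrib_left sum_negf flip: of_real_prod)
    finally show ?thesis .
  qed
  ultimately have "(CLINT g|?P. complex_of_real (exp (- s * qform n covar g))) =
      (CLINT \<omega>|M. complex_of_real (exp (- s * (\<Sum>i<n. (X i \<omega>)\<^sup>2))))"
    using F by simp
  thus ?thesis unfolding integral_complex_of_real of_real_eq_iff by simp
qed

text \<open>Both quantities are nonnegative, so their negative exponentials lie in [0,1]. The k-th
  moment of such an exponential is the Laplace transform at k, and on [0,1] the moments determine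
  the law. Applying \<open>- ln\<close> recovers the original variables.\<close>

theorem distr_sum_squares:
  "distr M borel (\<lambda>\<omega>. \<Sum>i<n. (X i \<omega>)\<^sup>2) = distr (iid_normal n) borel (qform n covar)"
proof -
  let ?P = "iid_normal n"
  let ?S = "\<lambda>\<omega>. \<Sum>i<n. (X i \<omega>)\<^sup>2"
  interpret P: prob_space ?P by (rule prob_space_iid_normal)
  have S[measurable]: "?S \<in> borel_measurable M"
    using measurable_X by (intro borel_measurable_sum borel_measurable_power) auto
  have Q[measurable]: "qform n covar \<in> borel_measurable ?P" by (rule measurable_qform)
  have S0: "0 \<le> ?S \<omega>" for \<omega> by (intro sum_nonneg) simp
  have eq: "distr M borel (\<lambda>\<omega>. exp (- ?S \<omega>)) = distr ?P borel (\<lambda>g. exp (- qform n covar g))" (is "?\<mu> = ?\<nu>")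
  proof (rule moments_unit_interval_unique)
    show "real_distribution ?\<mu>" "real_distribution ?\<nu>"
      by (auto simp: real_distribution_def real_distribution_axioms_def intro!: prob_space_distr P.prob_space_distr)
    show "AE x in ?\<mu>. x \<in> {0..1}" by (subst AE_distr_iff) (use S0 in auto)
    show "AE x in ?\<nu>. x \<in> {0..1}" by (subst AE_distr_iff) (use qform_covar_nonneg in auto)
    fix k :: nat
    have "(LINT x|?\<mu>. x ^ k) = expectation (\<lambda>\<omega>. exp (- ?S \<omega>) ^ k)" by (subst integral_distr) auto
    also have "\<dots> = expectation (\<lambda>\<omega>. exp (- real k * ?S \<omega>))" by (simp add: exp_of_nat_mult[symmetric])
    also have "\<dots> = (LINT g|?P. exp (- real k * qform n covar g))" by (rule laplace_sum_squares) simp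
    also have "\<dots> = (LINT g|?P. exp (- qform n covar g) ^ k)" by (simp add: exp_of_nat_mult[symmetric])
    also have "\<dots> = (LINT x|?\<nu>. x ^ k)" by (subst integral_distr) auto
    finally show "(LINT x|?\<mu>. x ^ k) = (LINT x|?\<nu>. x ^ k)" .
  qed
  have "distr M borel ?S = distr ?\<mu> borel (\<lambda>z. - ln z)"
    by (subst distr_distr) (auto simp: comp_def)
  also have "\<dots> = distr ?P borel (qform n covar)"
    unfolding eq by (subst distr_distr) (auto simp: comp_def)
  finally show ?thesis .
qed

end

context gaussian_vector
begin

lemma clt_distance_bounds:
  fixes F :: "'a \<Rightarrow> real"
  defines "T \<equiv> (\<Sum>i<n. \<Sum>j<n. (covar i j)\<^sup>2)"
  defines "\<epsilon> \<equiv> 8 * sqrt (2 * (\<Sum>i<n. \<Sum>j<n. (mat_sq n covar i j)\<^sup>2)) / T"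
  assumes pos: "0 < T"
    and F: "F = (\<lambda>\<omega>. ((\<Sum>i<n. (X i \<omega>)\<^sup>2) - (\<Sum>i<n. covar i i)) / sqrt (2 * T))"
  shows "expectation (\<lambda>\<omega>. ((\<Sum>i<n. (X i \<omega>)\<^sup>2) - (\<Sum>i<n. covar i i))\<^sup>2) = 2 * T"
    and "kolmogorov_dist (distr M borel F) std_normal_distribution \<le> ennreal \<epsilon>"
    and "wasserstein_dist (distr M borel F) std_normal_distribution \<le> ennreal \<epsilon>"
    and "total_variation_dist (distr M borel F) std_normal_distribution \<le> ennreal \<epsilon>"
proof -
  let ?P = "iid_normal n"
  let ?t = "\<Sum>i<n. covar i i"
  let ?S = "\<lambda>\<omega>. \<Sum>i<n. (X i \<omega>)\<^sup>2"
  define F' where "F' g = (qform n covar g - ?t) / sqrt (2 * T)" for g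
  interpret P: prob_space ?P by (rule prob_space_iid_normal)
  have S[measurable]: "?S \<in> borel_measurable M"
    using measurable_X by (intro borel_measurable_sum borel_measurable_power) auto
  have Q[measurable]: "qform n covar \<in> borel_measurable ?P" by (rule measurable_qform)
  have Fm[measurable]: "F \<in> borel_measurable M" unfolding F by measurable
  have F'm[measurable]: "F' \<in> borel_measurable ?P" unfolding F'_def[abs_def] by measurable
  note mom = qform_moments[of covar n, OF covar_sym]
  have "expectation (\<lambda>\<omega>. (?S \<omega> - ?t)\<^sup>2) = (LINT y|distr M borel ?S. (y - ?t)\<^sup>2)"
    by (subst integral_distr) auto
  also have "\<dots> = (LINT g|?P. (qform n covar g - ?t)\<^sup>2)"
    unfolding distr_sum_squares by (subst integral_distr) auto
  also have "\<dots> = (LINT g|?P. (qform n covar g)\<^sup>2 + ?t\<^sup>2 - 2 * ?t * qform n covar g)"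
    by (simp add: power2_diff mult_ac)
  also have "\<dots> = (?t\<^sup>2 + 2 * T) + ?t\<^sup>2 - 2 * ?t * ?t"
    using mom P.prob_space by (simp add: T_def)
  finally show "expectation (\<lambda>\<omega>. (?S \<omega> - ?t)\<^sup>2) = 2 * T" by (simp add: power2_eq_square)
  have dF: "distr M borel F = distr ?P borel F'"
  proof -
    have "distr M borel F = distr (distr M borel ?S) borel (\<lambda>y. (y - ?t) / sqrt (2 * T))"
      by (subst distr_distr) (auto simp: comp_def F)
    also have "\<dots> = distr ?P borel F'"
      unfolding distr_sum_squares by (subst distr_distr) (auto simp: comp_def F'_def[abs_def])
    finally show ?thesis .
  qed
  \<comment> \<open>The oscillation condition is the common weakening of "1-Lipschitz" and "values
    in [0,1]", so this one estimate feeds the Wasserstein and the total variation bounds.\<close>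
  have main: "\<bar>(LINT z|distr M borel F. h z) - (LINT z|std_normal_distribution. h z)\<bar> \<le> \<epsilon>"
    if h: "continuous_on UNIV h" and osc: "\<And>x y. \<bar>h y - h x\<bar> \<le> 1 + \<bar>y - x\<bar>" for h :: "real \<Rightarrow> real"
  proof -
    have [measurable]: "h \<in> borel_measurable borel" by (rule borel_measurable_continuous_onI[OF h])
    have "(LINT z|distr M borel F. h z) = (LINT g|?P. h (F' g))"
      unfolding dF by (subst integral_distr) auto
    thus ?thesis
      using qform_clt_bound[of covar n, OF covar_sym pos[unfolded T_def] h osc]
      by (simp add: F'_def T_def \<epsilon>_def)
  qed
  have rd: "real_distribution (distr M borel F)" "real_distribution std_normal_distribution"
    using real_dist_normal_dist by (auto simp: real_distribution_def real_distribution_axioms_def intro!: prob_space_distr)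
  have tv: "\<bar>measure (distr M borel F) A - measure std_normal_distribution A\<bar> \<le> \<epsilon>" if "A \<in> sets borel" for A
  proof -
    have m: "\<bar>(LINT z|distr M borel F. h z) - (LINT z|std_normal_distribution. h z)\<bar> \<le> \<epsilon>"
      if "continuous_on UNIV h" "\<And>x. 0 \<le> h x \<and> h x \<le> 1" for h :: "real \<Rightarrow> real"
    proof (rule main[OF that(1)])
      show "\<bar>h y - h x\<bar> \<le> 1 + \<bar>y - x\<bar>" for x y using that(2)[of x] that(2)[of y] by linarith
    qed
    have "measure (distr M borel F) A - measure std_normal_distribution A \<le> \<epsilon>"
      by (rule measure_diff_le_continuous[OF rd _ that]) (use m in \<open>blast intro: order_trans[OF abs_ge_self]\<close>)
    moreover have "measure std_normal_distribution A - measure (distr M borel F) A \<le> \<epsilon>"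
    proof (rule measure_diff_le_continuous[OF rd(2,1) _ that])
      fix h :: "real \<Rightarrow> real" assume "continuous_on UNIV h" "\<And>x. 0 \<le> h x \<and> h x \<le> 1"
      from m[OF this] show "(LINT z|std_normal_distribution. h z) - (LINT z|distr M borel F. h z) \<le> \<epsilon>" by linarith
    qed
    ultimately show ?thesis by linarith
  qed
  show "kolmogorov_dist (distr M borel F) std_normal_distribution \<le> ennreal \<epsilon>"
    unfolding kolmogorov_dist_def by (intro SUP_least ennreal_leI tv) simp
  show "total_variation_dist (distr M borel F) std_normal_distribution \<le> ennreal \<epsilon>"
    unfolding total_variation_dist_def by (intro SUP_least ennreal_leI tv)
  show "wasserstein_dist (distr M borel F) std_normal_distribution \<le> ennreal \<epsilon>"
    unfolding wasserstein_dist_def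
  proof (intro SUP_least ennreal_leI main)
    fix h :: "real \<Rightarrow> real" assume h: "h \<in> {h. 1-lipschitz_on UNIV h}"
    thus "continuous_on UNIV h" by (auto intro: lipschitz_on_continuous_on)
    fix x y :: real
    have "dist (h y) (h x) \<le> 1 * dist y x" using h by (intro lipschitz_onD[of 1 UNIV h]) auto
    thus "\<bar>h y - h x\<bar> \<le> 1 + \<bar>y - x\<bar>" by (simp add: dist_real_def)
  qed
qed

end

section \<open>Covariance of the mild solution\<close>

text \<open>The exceptional set \<open>S\<close> takes up the singularity of the kernel
  \<open>\<bar>r - v\<bar> powr (q - 1)\<close> on the diagonal: the antiderivative is continuous
  there but need not be differentiable.\<close>

lemma nn_integral_FTC_Icc_strong:
  fixes f F :: "real \<Rightarrow> real"
  assumes S: "finite S" and ab: "a \<le> b" and f[measurable]: "f \<in> borel_measurable borel"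
    and nonneg: "\<And>x. x \<in> {a..b} \<Longrightarrow> 0 \<le> f x"
    and d: "\<And>x. x \<in> {a..b} - S \<Longrightarrow> (F has_real_derivative f x) (at x)"
    and c: "continuous_on {a..b} F"
  shows "(\<integral>\<^sup>+x. ennreal (indicator {a..b} x * f x) \<partial>lborel) = ennreal (F b - F a)"
proof -
  have "(f has_integral (F b - F a)) {a..b}"
    by (rule fundamental_theorem_of_calculus_strong[OF S ab _ c])
       (use d in \<open>simp add: has_real_derivative_iff_has_vector_derivative\<close>)
  hence "((\<lambda>x. if x \<in> {a..b} then f x else 0) has_integral (F b - F a)) UNIV"
    by (simp only: has_integral_restrict_UNIV)
  also have "(\<lambda>x. if x \<in> {a..b} then f x else 0) = (\<lambda>x. indicator {a..b} x * f x)"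
    by (auto simp: indicator_def)
  finally show ?thesis
    by (intro nn_integral_has_integral_lborel) (use nonneg in \<open>auto simp: indicator_def\<close>)
qed

text \<open>The odd extension \<open>sgn u * \<bar>u\<bar> powr q\<close>, written so that its continuity at 0 is immediate.\<close>

definition odd_powr :: "real \<Rightarrow> real \<Rightarrow> real" where
  "odd_powr q u = max 0 u powr q - max 0 (- u) powr q"

lemma continuous_odd_powr:
  assumes "0 < q" "continuous_on A g" shows "continuous_on A (\<lambda>x. odd_powr q (g x))"
  unfolding odd_powr_def using assms by (intro continuous_intros continuous_on_powr') auto

lemma odd_powr_minus: "odd_powr q (- u) = - odd_powr q u"
  by (simp add: odd_powr_def)

lemma odd_powr_nonneg: "0 \<le> u \<Longrightarrow> odd_powr q u = u powr q"
  by (simp add: odd_powr_def)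

lemma odd_powr_mono:
  assumes "0 < q" "u \<le> v" shows "odd_powr q u \<le> odd_powr q v"
  using assms unfolding odd_powr_def by (intro diff_mono powr_mono2) auto

text \<open>One formula on both sides of 0: the odd extension provides a single antiderivative of
  the even kernel across its singularity. Integrating once more leads to
  \<open>\<bar>u\<bar> powr (q + 1)\<close>.\<close>

lemma DERIV_odd_powr:
  assumes "u \<noteq> 0" shows "(odd_powr q has_real_derivative q * \<bar>u\<bar> powr (q - 1)) (at u)"
proof -
  have pos: "(odd_powr q has_real_derivative q * u powr (q - 1)) (at u)" if "0 < u" for u
    by (rule has_field_derivative_transform_within_open[OF has_real_derivative_powr[OF that], of "{0<..}"])
       (use that in \<open>auto simp: odd_powr_nonneg\<close>)
  show ?thesis
  proof (cases "0 < u")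
    case True thus ?thesis using pos by simp
  next
    case False
    hence u: "0 < - u" using assms by simp
    have "((\<lambda>x. - odd_powr q (- x)) has_real_derivative - (q * (- u) powr (q - 1) * (-1))) (at u)"
      by (intro DERIV_minus DERIV_chain2[where g = uminus and x = u, OF pos[OF u]]) (auto intro!: derivative_eq_intros)
    thus ?thesis using u by (simp add: odd_powr_minus)
  qed
qed

lemma DERIV_abs_powr:
  assumes "u \<noteq> 0" shows "((\<lambda>u. \<bar>u\<bar> powr (q + 1)) has_real_derivative (q + 1) * odd_powr q u) (at u)"
proof -
  have pos: "((\<lambda>u. \<bar>u\<bar> powr (q + 1)) has_real_derivative (q + 1) * odd_powr q u) (at u)" if "0 < u" for u
    by (rule has_field_derivative_transform_within_open[of "\<lambda>u. u powr (q + 1)" _ _ "{0<..}"])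
       (use that has_real_derivative_powr[OF that, of "q + 1"] in \<open>auto simp: odd_powr_nonneg\<close>)
  show ?thesis
  proof (cases "0 < u")
    case True thus ?thesis using pos by simp
  next
    case False
    hence u: "0 < - u" using assms by simp
    have "((\<lambda>x. \<bar>- x\<bar> powr (q + 1)) has_real_derivative (q + 1) * odd_powr q (- u) * (-1)) (at u)"
      by (intro DERIV_chain2[where g = uminus and x = u, OF pos[OF u]]) (auto intro!: derivative_eq_intros)
    thus ?thesis by (simp add: odd_powr_minus)
  qed
qed

lemma continuous_abs_powr:
  assumes "0 < q" "continuous_on A g" shows "continuous_on A (\<lambda>x. \<bar>g x\<bar> powr (q::real))"
  using assms by (intro continuous_intros continuous_on_powr') auto

lemma nn_integral_riesz_inner:
  assumes q: "0 < q" and b: "0 \<le> b"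
  shows "(\<integral>\<^sup>+v. ennreal (indicator {0..b} v * \<bar>r - v\<bar> powr (q - 1)) \<partial>lborel)
      = ennreal ((odd_powr q r + odd_powr q (b - r)) / q)"
proof -
  have "(\<integral>\<^sup>+v. ennreal (indicator {0..b} v * \<bar>r - v\<bar> powr (q - 1)) \<partial>lborel)
      = ennreal (odd_powr q (b - r) / q - odd_powr q (0 - r) / q)"
  proof (rule nn_integral_FTC_Icc_strong[where S = "{r}"])
    show "continuous_on {0..b} (\<lambda>v. odd_powr q (v - r) / q)"
      using q by (intro continuous_intros continuous_odd_powr) auto
    fix x assume "x \<in> {0..b} - {r}"
    hence "x - r \<noteq> 0" by auto
    have "((\<lambda>v. v - r) has_real_derivative 1) (at x)" by (auto intro!: derivative_eq_intros)
    from DERIV_chain2[where g = "\<lambda>v. v - r" and x = x and s = UNIV, OF DERIV_odd_powr[OF \<open>x - r \<noteq> 0\<close>, of q] this]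
    have "((\<lambda>v. odd_powr q (v - r)) has_real_derivative q * \<bar>x - r\<bar> powr (q - 1)) (at x)" by simp
    from DERIV_cdivide[OF this, of q]
    show "((\<lambda>v. odd_powr q (v - r) / q) has_real_derivative \<bar>r - x\<bar> powr (q - 1)) (at x)"
      using q by (simp add: abs_minus_commute)
  qed (use b in auto)
  also have "odd_powr q (b - r) / q - odd_powr q (0 - r) / q = (odd_powr q r + odd_powr q (b - r)) / q"
    using odd_powr_minus[of q r] by (simp add: add_divide_distrib)
  finally show ?thesis .
qed

text \<open>For q + 1 = 2H the numerator is twice the covariance of fractional Brownian motion at
  times \<open>a\<close> and \<open>b\<close>: the kernel is, up to the constant q (q + 1), the
  mixed second derivative behind that covariance.\<close>

lemma nn_integral_riesz:
  assumes q: "0 < q" and ab: "0 \<le> a" "0 \<le> b"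
  shows "(\<integral>\<^sup>+r. \<integral>\<^sup>+v. ennreal (indicator {0..a} r * (indicator {0..b} v * \<bar>r - v\<bar> powr (q - 1))) \<partial>lborel \<partial>lborel)
      = ennreal ((a powr (q + 1) + b powr (q + 1) - \<bar>a - b\<bar> powr (q + 1)) / (q * (q + 1)))"
proof -
  have "(\<integral>\<^sup>+r. \<integral>\<^sup>+v. ennreal (indicator {0..a} r * (indicator {0..b} v * \<bar>r - v\<bar> powr (q - 1))) \<partial>lborel \<partial>lborel)
     = (\<integral>\<^sup>+r. ennreal (indicator {0..a} r * ((odd_powr q r + odd_powr q (b - r)) / q)) \<partial>lborel)"
  proof (rule nn_integral_cong)
    fix r :: real
    have "(\<integral>\<^sup>+v. ennreal (indicator {0..a} r * (indicator {0..b} v * \<bar>r - v\<bar> powr (q - 1))) \<partial>lborel)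
        = (\<integral>\<^sup>+v. ennreal (indicator {0..a} r) * ennreal (indicator {0..b} v * \<bar>r - v\<bar> powr (q - 1)) \<partial>lborel)"
      by (intro nn_integral_cong ennreal_mult) auto
    also have "\<dots> = ennreal (indicator {0..a} r) * ennreal ((odd_powr q r + odd_powr q (b - r)) / q)"
      unfolding nn_integral_riesz_inner[OF q ab(2), symmetric] by (rule nn_integral_cmult) measurable
    also have "\<dots> = ennreal (indicator {0..a} r * ((odd_powr q r + odd_powr q (b - r)) / q))"
      by (rule ennreal_mult'[symmetric]) simp
    finally show "(\<integral>\<^sup>+v. ennreal (indicator {0..a} r * (indicator {0..b} v * \<bar>r - v\<bar> powr (q - 1))) \<partial>lborel)
       = ennreal (indicator {0..a} r * ((odd_powr q r + odd_powr q (b - r)) / q))" .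
  qed
  also have "\<dots> = ennreal ((\<bar>a\<bar> powr (q + 1) - \<bar>b - a\<bar> powr (q + 1)) / (q * (q + 1))
      - (\<bar>0\<bar> powr (q + 1) - \<bar>b - 0\<bar> powr (q + 1)) / (q * (q + 1)))"
  proof (rule nn_integral_FTC_Icc_strong[where S = "{0, b}"])
    show "continuous_on {0..a} (\<lambda>r. (\<bar>r\<bar> powr (q + 1) - \<bar>b - r\<bar> powr (q + 1)) / (q * (q + 1)))"
      using q by (intro continuous_intros continuous_abs_powr) auto
    show "(\<lambda>r. (odd_powr q r + odd_powr q (b - r)) / q) \<in> borel_measurable borel"
      unfolding odd_powr_def by measurable
    show "0 \<le> (odd_powr q r + odd_powr q (b - r)) / q" for r
    proof -
      have "odd_powr q (- r) \<le> odd_powr q (b - r)" using ab q by (intro odd_powr_mono) auto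
      thus ?thesis using q by (simp add: odd_powr_minus)
    qed
    fix x assume "x \<in> {0..a} - {0, b}"
    hence x: "x \<noteq> 0" "b - x \<noteq> 0" by auto
    have "((\<lambda>r. \<bar>b - r\<bar> powr (q + 1)) has_real_derivative (q + 1) * odd_powr q (b - x) * (-1)) (at x)"
      by (intro DERIV_chain2[where g = "\<lambda>r. b - r" and x = x, OF DERIV_abs_powr[OF x(2)]]) (auto intro!: derivative_eq_intros)
    from DERIV_cdivide[OF DERIV_diff[OF DERIV_abs_powr[OF x(1), of q] this], of "q * (q + 1)"]
    show "((\<lambda>r. (\<bar>r\<bar> powr (q + 1) - \<bar>b - r\<bar> powr (q + 1)) / (q * (q + 1))) has_real_derivative
        (odd_powr q x + odd_powr q (b - x)) / q) (at x)"
    proof (rule DERIV_cong)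
      have "(q + 1) * odd_powr q x - (q + 1) * odd_powr q (b - x) * - 1 = (q + 1) * (odd_powr q x + odd_powr q (b - x))"
        by (simp add: distrib_left)
      thus "((q + 1) * odd_powr q x - (q + 1) * odd_powr q (b - x) * - 1) / (q * (q + 1)) = (odd_powr q x + odd_powr q (b - x)) / q"
        using q by simp
    qed
  qed (use ab in auto)
  also have "(\<bar>a\<bar> powr (q + 1) - \<bar>b - a\<bar> powr (q + 1)) / (q * (q + 1))
      - (\<bar>0\<bar> powr (q + 1) - \<bar>b - 0\<bar> powr (q + 1)) / (q * (q + 1))
      = (a powr (q + 1) + b powr (q + 1) - \<bar>a - b\<bar> powr (q + 1)) / (q * (q + 1))"
    using ab by (simp add: abs_minus_commute diff_divide_distrib add_divide_distrib)
  finally show ?thesis .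
qed

text \<open>Tonelli values are computed in \<open>ennreal\<close>, whereas
  \<open>noise_inner\<close> iterates Bochner integrals; for a nonnegative integrand with finite
  total mass the two agree.\<close>

lemma iterated_integral_eq_nn_integral:
  fixes g :: "real \<Rightarrow> real \<Rightarrow> real"
  assumes m: "case_prod g \<in> borel_measurable (lborel \<Otimes>\<^sub>M lborel)" and g0: "\<And>x y. 0 \<le> g x y"
    and c: "0 \<le> c" "(\<integral>\<^sup>+x. \<integral>\<^sup>+y. ennreal (g x y) \<partial>lborel \<partial>lborel) = ennreal c"
  shows "(LINT x|lborel. LINT y|lborel. g x y) = c"
proof -
  have m': "(\<lambda>z. ennreal (case_prod g z)) \<in> borel_measurable (lborel \<Otimes>\<^sub>M lborel)" using m by measurable
  have "(\<integral>\<^sup>+z. ennreal (case_prod g z) \<partial>(lborel \<Otimes>\<^sub>M lborel)) = (\<integral>\<^sup>+x. \<integral>\<^sup>+y. ennreal (g x y) \<partial>lborel \<partial>lborel)"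
    by (subst lborel.nn_integral_fst[OF m', symmetric]) simp
  hence e: "(\<integral>\<^sup>+z. ennreal (case_prod g z) \<partial>(lborel \<Otimes>\<^sub>M lborel)) = ennreal c" using c by simp
  have int: "integrable (lborel \<Otimes>\<^sub>M lborel) (case_prod g)"
    by (rule integrableI_nonneg[OF m]) (use g0 e in auto)
  have "(LINT x|lborel. LINT y|lborel. g x y) = integral\<^sup>L (lborel \<Otimes>\<^sub>M lborel) (case_prod g)"
    by (rule lborel_pair.integral_fst[OF int])
  also have "\<dots> = c"
    using c(1) g0 by (subst integral_eq_nn_integral[OF m]) (auto simp: e)
  finally show ?thesis .
qed

section \<open>Inner products of the wave kernels\<close>

definition wave_integrand :: "real \<Rightarrow> real \<Rightarrow> real \<Rightarrow> real \<Rightarrow> real" where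
  "wave_integrand x t = (\<lambda>r y. indicator {0..t} r * wave_kernel (t - r) (x - y))"

lemma mild_solution_eq: "mild_solution W t x = W (wave_integrand x t)"
  by (simp add: mild_solution_def wave_integrand_def)

lemma measurable_wave_integrand [measurable]: "case_prod (wave_integrand x t) \<in> borel_measurable borel"
proof -
  have "(\<lambda>z. indicator {0..t} (fst z) * (if \<bar>x - snd z\<bar> < t - fst z then 1/2 else 0 :: real)) \<in> borel_measurable (borel \<Otimes>\<^sub>M borel)"
    by measurable
  thus ?thesis by (simp add: wave_integrand_def[abs_def] wave_kernel_def[abs_def] case_prod_unfold borel_prod)
qed

lemma wave_integrand_nonneg: "0 \<le> wave_integrand x t r y"
  by (simp add: wave_integrand_def wave_kernel_def)

text \<open>Both light cones have their apex above the same point \<open>x\<close>, so their spatial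
  sections are concentric intervals and intersect in the smaller one. A nonpositive radius gives the
  empty ball, matching a time beyond the apex.\<close>

lemma wave_integrand_prod:
  assumes "0 \<le> r" "0 \<le> v"
  shows "wave_integrand x s r y * wave_integrand x t v y = 1/4 * indicator (ball x (min (s - r) (t - v))) y"
  using assms by (auto simp: wave_integrand_def wave_kernel_def indicator_def dist_real_def)

lemma nn_integral_wave_prod:
  assumes "0 \<le> r" "0 \<le> v"
  shows "(\<integral>\<^sup>+y. ennreal (wave_integrand x s r y * wave_integrand x t v y) \<partial>lborel) = ennreal (1/2 * max 0 (min (s - r) (t - v)))"
proof -
  have "(\<integral>\<^sup>+y. ennreal (wave_integrand x s r y * wave_integrand x t v y) \<partial>lborel)
     = (\<integral>\<^sup>+y. ennreal (1/4) * indicator (ball x (min (s - r) (t - v))) y \<partial>lborel)"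
    unfolding wave_integrand_prod[OF assms]
    by (intro nn_integral_cong) (simp add: indicator_def)
  also have "\<dots> = ennreal (1/4) * emeasure lborel (ball x (min (s - r) (t - v)))"
    by (subst nn_integral_cmult_indicator) auto
  also have "\<dots> = ennreal (1/2 * max 0 (min (s - r) (t - v)))"
  proof (cases "0 \<le> min (s - r) (t - v)")
    case True
    thus ?thesis unfolding ball_eq_greaterThanLessThan
      by (subst emeasure_lborel_Ioo) (auto simp flip: ennreal_mult)
  next
    case False
    hence e: "ball x (min (s - r) (t - v)) = {}" "max 0 (min (s - r) (t - v)) = 0" by (auto simp: ball_empty)
    show ?thesis unfolding e by simp
  qed
  finally show ?thesis .
qed

text \<open>The covariance of fractional Brownian motion with Hurst parameter \<open>H\<close>, at
  nonnegative times.\<close>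

definition fbm_cov :: "real \<Rightarrow> real \<Rightarrow> real \<Rightarrow> real" where
  "fbm_cov H a b = (a powr (2 * H) + b powr (2 * H) - \<bar>a - b\<bar> powr (2 * H)) / 2"

lemma fbm_cov_nonneg_le:
  assumes "1/2 \<le> H" "0 \<le> a" "0 \<le> b"
  shows "0 \<le> fbm_cov H a b" "fbm_cov H a b \<le> (a powr (2 * H) + b powr (2 * H)) / 2"
proof -
  have "\<bar>a - b\<bar> powr (2 * H) \<le> max a b powr (2 * H)" using assms by (intro powr_mono2) auto
  also have "\<dots> \<le> a powr (2 * H) + b powr (2 * H)" by (simp add: max_def)
  finally show "0 \<le> fbm_cov H a b" by (simp add: fbm_cov_def)
  show "fbm_cov H a b \<le> (a powr (2 * H) + b powr (2 * H)) / 2" by (simp add: fbm_cov_def)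
qed

lemma fbm_cov_0: "0 < H \<Longrightarrow> 0 \<le> a \<Longrightarrow> fbm_cov H 0 a = 0" "0 < H \<Longrightarrow> 0 \<le> a \<Longrightarrow> fbm_cov H a 0 = 0"
  by (auto simp: fbm_cov_def)

definition wave_cov :: "real \<Rightarrow> real \<Rightarrow> real \<Rightarrow> real" where
  "wave_cov H s t = 1/2 * (LINT z:{0..}|lborel. fbm_cov H (max 0 (s - z)) (max 0 (t - z)))"

lemma measurable_fbm_cov_wave [measurable]:
  "(\<lambda>z. fbm_cov H (max 0 (s - z)) (max 0 (t - z))) \<in> borel_measurable borel"
  unfolding fbm_cov_def by measurable

lemma set_integrable_fbm_cov_wave:
  assumes H: "1/2 \<le> H"
  shows "set_integrable lborel {0..} (\<lambda>z. fbm_cov H (max 0 (s - z)) (max 0 (t - z)))"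
  unfolding set_integrable_def
proof (rule Bochner_Integration.integrable_bound)
  define B where "B = (max 0 s powr (2 * H) + max 0 t powr (2 * H)) / 2"
  show "integrable lborel (\<lambda>z. B * indicator {0..max 0 s} z)"
    by (intro integrable_mult_right integrable_real_indicator) auto
  have 1: "\<bar>fbm_cov H (max 0 (s - z)) (max 0 (t - z))\<bar> \<le> \<bar>B\<bar>" if "0 \<le> z" for z
  proof -
    have "max 0 (s - z) powr (2 * H) \<le> max 0 s powr (2 * H)" "max 0 (t - z) powr (2 * H) \<le> max 0 t powr (2 * H)"
      using that H by (auto intro!: powr_mono2)
    thus ?thesis using fbm_cov_nonneg_le[OF H, of "max 0 (s - z)" "max 0 (t - z)"] by (simp add: B_def)
  qed
  have 2: "fbm_cov H (max 0 (s - z)) (max 0 (t - z)) = 0" if "z > max 0 s" for z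
  proof -
    have "max 0 (s - z) = 0" using that by simp
    thus ?thesis using fbm_cov_0(1)[of H "max 0 (t - z)"] H by simp
  qed
  have "norm (indicator {0..} z *\<^sub>R fbm_cov H (max 0 (s - z)) (max 0 (t - z)))
      \<le> norm (B * indicator {0..max 0 s} z)" for z
    using 1[of z] 2[of z] by (cases "z \<le> max 0 s"; cases "0 \<le> z") (simp_all add: not_le del: max_less_iff_conj)
  thus "AE z in lborel. norm (indicator {0..} z *\<^sub>R fbm_cov H (max 0 (s - z)) (max 0 (t - z)))
      \<le> norm (B * indicator {0..max 0 s} z)" by simp
qed measurable

lemma wave_cov_nonneg:
  assumes H: "1/2 \<le> H" shows "0 \<le> wave_cov H s t"
  unfolding wave_cov_def set_lebesgue_integral_def
  using fbm_cov_nonneg_le(1)[OF H] by (auto intro!: mult_nonneg_nonneg integral_nonneg_AE)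

text \<open>A layer-cake encoding. Integrated over \<open>z\<close>, it gives the singular kernel
  times the positive part of \<open>min (s - r) (t - v)\<close>; integrated over \<open>r\<close>
  and \<open>v\<close> at fixed \<open>z\<close>, it gives the Riesz integral over the rectangle
  with sides \<open>s - z\<close> and \<open>t - z\<close>.\<close>

definition cone_kernel :: "real \<Rightarrow> real \<Rightarrow> real \<Rightarrow> real \<Rightarrow> real \<Rightarrow> real \<Rightarrow> real" where
  "cone_kernel q s t r v z =
     (if 0 \<le> z \<and> 0 \<le> r \<and> r \<le> s - z \<and> 0 \<le> v \<and> v \<le> t - z then \<bar>r - v\<bar> powr (q - 1) else 0)"

lemma measurable_cone_kernel [measurable (raw)]:
  assumes [measurable]: "f \<in> borel_measurable N" "g \<in> borel_measurable N" "h \<in> borel_measurable N"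
  shows "(\<lambda>x. cone_kernel q s t (f x) (g x) (h x)) \<in> borel_measurable N"
  unfolding cone_kernel_def by measurable

text \<open>Tonelli moves \<open>z\<close> outermost, and each slice then is a fractional Brownian
  covariance. This is where the integral over z in \<open>wave_cov\<close> comes from.\<close>

lemma nn_integral_wave_triple:
  assumes H: "1/2 < H"
  shows "(\<integral>\<^sup>+r. \<integral>\<^sup>+v. ennreal (indicator {0..} r * (indicator {0..} v * (\<bar>r - v\<bar> powr (2 * H - 2) *
      (1/2 * max 0 (min (s - r) (t - v)))))) \<partial>lborel \<partial>lborel) = ennreal (wave_cov H s t / (H * (2 * H - 1)))"
proof -
  define q where "q = 2 * H - 1"
  have q: "0 < q" "q + 1 = 2 * H" "q - 1 = 2 * H - 2" using H by (auto simp: q_def)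
  define k where "k = cone_kernel q s t"
  have k0: "0 \<le> k r v z" for r v z by (simp add: k_def cone_kernel_def)
  have [measurable]: "(\<lambda>z. fbm_cov H (max 0 (s - z)) (max 0 (t - z))) \<in> borel_measurable lborel"
    using measurable_fbm_cov_wave by simp
  have "(\<integral>\<^sup>+r. \<integral>\<^sup>+v. ennreal (indicator {0..} r * (indicator {0..} v * (\<bar>r - v\<bar> powr (2 * H - 2) *
      (1/2 * max 0 (min (s - r) (t - v)))))) \<partial>lborel \<partial>lborel)
    = (\<integral>\<^sup>+r. \<integral>\<^sup>+v. ennreal (1/2) * (\<integral>\<^sup>+z. ennreal (k r v z) \<partial>lborel) \<partial>lborel \<partial>lborel)"
  proof (intro nn_integral_cong)
    fix r v :: real
    let ?w = "indicator {0..} r * (indicator {0..} v * \<bar>r - v\<bar> powr (q - 1)) :: real"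
    let ?m = "min (s - r) (t - v)"
    have "(\<integral>\<^sup>+z. ennreal (k r v z) \<partial>lborel) = (\<integral>\<^sup>+z. ennreal ?w * indicator {0..?m} z \<partial>lborel)"
      by (intro nn_integral_cong) (auto simp: k_def cone_kernel_def indicator_def)
    also have "\<dots> = ennreal ?w * emeasure lborel {0..?m}" by (rule nn_integral_cmult_indicator) simp
    also have "emeasure lborel {0..?m} = ennreal (max 0 ?m)" by (cases "0 \<le> ?m") (auto simp: max_def)
    also have "ennreal ?w * ennreal (max 0 ?m) = ennreal (?w * max 0 ?m)"
      by (rule ennreal_mult[symmetric]) simp_all
    finally have E: "(\<integral>\<^sup>+z. ennreal (k r v z) \<partial>lborel) = ennreal (?w * max 0 ?m)" .
    have "ennreal (1/2) * (\<integral>\<^sup>+z. ennreal (k r v z) \<partial>lborel) = ennreal (1/2 * (?w * max 0 ?m))"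
      unfolding E by (rule ennreal_mult[symmetric]) simp_all
    thus "ennreal (indicator {0..} r * (indicator {0..} v * (\<bar>r - v\<bar> powr (2 * H - 2) * (1/2 * max 0 ?m))))
        = ennreal (1/2) * (\<integral>\<^sup>+z. ennreal (k r v z) \<partial>lborel)"
      by (simp add: q(3) mult_ac)
  qed
  also have "\<dots> = (\<integral>\<^sup>+r. ennreal (1/2) * (\<integral>\<^sup>+v. \<integral>\<^sup>+z. ennreal (k r v z) \<partial>lborel \<partial>lborel) \<partial>lborel)"
    unfolding k_def by (intro nn_integral_cong nn_integral_cmult) measurable
  also have "\<dots> = ennreal (1/2) * (\<integral>\<^sup>+r. \<integral>\<^sup>+v. \<integral>\<^sup>+z. ennreal (k r v z) \<partial>lborel \<partial>lborel \<partial>lborel)"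
    unfolding k_def by (rule nn_integral_cmult) measurable
  also have "(\<integral>\<^sup>+r. \<integral>\<^sup>+v. \<integral>\<^sup>+z. ennreal (k r v z) \<partial>lborel \<partial>lborel \<partial>lborel)
      = (\<integral>\<^sup>+r. \<integral>\<^sup>+z. \<integral>\<^sup>+v. ennreal (k r v z) \<partial>lborel \<partial>lborel \<partial>lborel)"
    unfolding k_def by (intro nn_integral_cong lborel_pair.Fubini') measurable
  also have "\<dots> = (\<integral>\<^sup>+z. \<integral>\<^sup>+r. \<integral>\<^sup>+v. ennreal (k r v z) \<partial>lborel \<partial>lborel \<partial>lborel)"
    unfolding k_def by (rule lborel_pair.Fubini') measurable
  also have "\<dots> = (\<integral>\<^sup>+z. ennreal (indicator {0..} z *\<^sub>R fbm_cov H (max 0 (s - z)) (max 0 (t - z)) * (2 / (q * (q + 1)))) \<partial>lborel)"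
  proof (rule nn_integral_cong)
    fix z :: real
    show "(\<integral>\<^sup>+r. \<integral>\<^sup>+v. ennreal (k r v z) \<partial>lborel \<partial>lborel)
        = ennreal (indicator {0..} z *\<^sub>R fbm_cov H (max 0 (s - z)) (max 0 (t - z)) * (2 / (q * (q + 1))))"
    proof (cases "0 \<le> z \<and> z \<le> s \<and> z \<le> t")
      case True
      show ?thesis
      proof -
        have "k r v z = indicator {0..s - z} r * (indicator {0..t - z} v * \<bar>r - v\<bar> powr (q - 1))" for r v
          using True by (auto simp: k_def cone_kernel_def indicator_def)
        thus ?thesis using True
          using nn_integral_riesz[OF q(1), of "s - z" "t - z"] by (simp add: fbm_cov_def q(2) mult_ac)
      qed
    next
      case False
      hence "k r v z = 0" for r v by (auto simp: k_def cone_kernel_def indicator_def)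
      moreover have "indicator {0..} z *\<^sub>R fbm_cov H (max 0 (s - z)) (max 0 (t - z)) = 0"
      proof (cases "0 \<le> z")
        case z: True
        with False have "max 0 (s - z) = 0 \<or> max 0 (t - z) = 0" by (auto simp: max_def)
        thus ?thesis using fbm_cov_0[of H] H by auto
      qed simp
      ultimately show ?thesis by (auto simp: mult_eq_0_iff)
    qed
  qed
  also have "\<dots> = ennreal (LINT z|lborel. indicator {0..} z *\<^sub>R fbm_cov H (max 0 (s - z)) (max 0 (t - z)) * (2 / (q * (q + 1))))"
  proof (rule nn_integral_eq_integral)
    show "integrable lborel (\<lambda>z. indicator {0..} z *\<^sub>R fbm_cov H (max 0 (s - z)) (max 0 (t - z)) * (2 / (q * (q + 1))))"
      using set_integrable_fbm_cov_wave[of H s t] H unfolding set_integrable_def by (intro integrable_mult_left) auto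
    show "AE z in lborel. 0 \<le> indicator {0..} z *\<^sub>R fbm_cov H (max 0 (s - z)) (max 0 (t - z)) * (2 / (q * (q + 1)))"
      using fbm_cov_nonneg_le(1)[of H] H q by (intro AE_I2 mult_nonneg_nonneg) auto
  qed
  also have "(LINT z|lborel. indicator {0..} z *\<^sub>R fbm_cov H (max 0 (s - z)) (max 0 (t - z)) * (2 / (q * (q + 1))))
      = 2 * wave_cov H s t * (2 / (q * (q + 1)))"
    by (simp add: wave_cov_def set_lebesgue_integral_def)
  \<comment> \<open>With q = 2H - 1 the constants 1/2, 2 and 2 / (q (q + 1)) multiply to 1 / (H (2H
    - 1)), the reciprocal of the prefactor in \<open>noise_inner\<close>.\<close>
  also have "ennreal (1/2) * ennreal (2 * wave_cov H s t * (2 / (q * (q + 1)))) = ennreal (wave_cov H s t / (H * (2 * H - 1)))"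
    using wave_cov_nonneg[of H s t] H q
    by (subst ennreal_mult[symmetric]) (auto simp: q_def field_simps)
  finally show ?thesis .
qed

lemma measurable_wave_prod:
  assumes "0 \<le> r" "0 \<le> v"
  shows "(\<lambda>y. wave_integrand x s r y * wave_integrand x t v y) \<in> borel_measurable lborel"
  unfolding wave_integrand_prod[OF assms]
  by (intro borel_measurable_times borel_measurable_indicator borel_measurable_const) auto

lemma integral_wave_prod:
  assumes "0 \<le> r" "0 \<le> v"
  shows "(LINT y|lborel. wave_integrand x s r y * wave_integrand x t v y) = 1/2 * max 0 (min (s - r) (t - v))"
  by (subst integral_eq_nn_integral[OF measurable_wave_prod[OF assms]])
     (simp_all add: wave_integrand_nonneg nn_integral_wave_prod[OF assms])

lemma noise_inner_wave:
  assumes H: "1/2 \<le> H"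
  shows "noise_inner H (wave_integrand x s) (wave_integrand x t) = wave_cov H s t"
proof (cases "H = 1/2")
  case True
  have "noise_inner H (wave_integrand x s) (wave_integrand x t)
      = (LINT r:{0..}|lborel. 1/2 * fbm_cov H (max 0 (s - r)) (max 0 (t - r)))"
    unfolding noise_inner_def set_lebesgue_integral_def if_P[OF True]
  proof (intro Bochner_Integration.integral_cong refl)
    fix r :: real
    show "indicator {0..} r *\<^sub>R (LINT y|lborel. wave_integrand x s r y * wave_integrand x t r y)
        = indicator {0..} r *\<^sub>R (1/2 * fbm_cov H (max 0 (s - r)) (max 0 (t - r)))"
    proof (cases "0 \<le> r")
      case r: True
      \<comment> \<open>At H = 1/2 the fractional covariance is the Brownian one, the minimum of the
        two times, so both branches of \<open>noise_inner\<close> lead to the same formula.\<close>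
      have "max 0 (min (s - r) (t - r)) = fbm_cov H (max 0 (s - r)) (max 0 (t - r))"
        unfolding fbm_cov_def True by (auto simp: max_def min_def abs_if)
      thus ?thesis using r by (simp add: integral_wave_prod)
    qed simp
  qed
  thus ?thesis by (simp add: wave_cov_def set_lebesgue_integral_def)
next
  case False
  hence H': "1/2 < H" using H by simp
  define g where "g r v = indicator {0..} r * (indicator {0..} v * (\<bar>r - v\<bar> powr (2 * H - 2) * (1/2 * max 0 (min (s - r) (t - v)))))" for r v :: real
  have "(LINT r:{0..}|lborel. LINT v:{0..}|lborel. LINT y|lborel. wave_integrand x s r y * wave_integrand x t v y * \<bar>r - v\<bar> powr (2 * H - 2))
     = (LINT r|lborel. LINT v|lborel. g r v)"
    unfolding set_lebesgue_integral_def
  proof (intro Bochner_Integration.integral_cong refl)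
    fix r :: real
    have "(LINT v|lborel. indicator {0..} v *\<^sub>R (LINT y|lborel. wave_integrand x s r y * wave_integrand x t v y * \<bar>r - v\<bar> powr (2 * H - 2)))
        = (LINT v|lborel. indicator {0..} v * (\<bar>r - v\<bar> powr (2 * H - 2) * (1/2 * max 0 (min (s - r) (t - v)))))" if "0 \<le> r"
    proof (intro Bochner_Integration.integral_cong refl)
      fix v :: real
      show "indicator {0..} v *\<^sub>R (LINT y|lborel. wave_integrand x s r y * wave_integrand x t v y * \<bar>r - v\<bar> powr (2 * H - 2))
        = indicator {0..} v * (\<bar>r - v\<bar> powr (2 * H - 2) * (1/2 * max 0 (min (s - r) (t - v))))"
        using integral_wave_prod[OF that, of v x s t] by (cases "0 \<le> v") simp_all
    qed
    thus "indicator {0..} r *\<^sub>R (LINT v|lborel. indicator {0..} v *\<^sub>R (LINT y|lborel. wave_integrand x s r y * wave_integrand x t v y * \<bar>r - v\<bar> powr (2 * H - 2)))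
       = (LINT v|lborel. g r v)"
      by (cases "0 \<le> r") (simp_all add: g_def)
  qed
  also have "\<dots> = wave_cov H s t / (H * (2 * H - 1))"
  proof (rule iterated_integral_eq_nn_integral)
    show "case_prod g \<in> borel_measurable (lborel \<Otimes>\<^sub>M lborel)" unfolding g_def by measurable
    show "0 \<le> wave_cov H s t / (H * (2 * H - 1))" using wave_cov_nonneg[OF H] H by simp
    show "(\<integral>\<^sup>+r. \<integral>\<^sup>+v. ennreal (g r v) \<partial>lborel \<partial>lborel) = ennreal (wave_cov H s t / (H * (2 * H - 1)))"
      unfolding g_def by (rule nn_integral_wave_triple[OF H'])
  qed (simp add: g_def)
  finally show ?thesis using False H' by (simp add: noise_inner_def)
qed

text \<open>At H = 1/2 the integrand is bounded with compact support. For larger H it is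
  nonnegative, and the Tonelli value already computed, taken at equal times, is finite.\<close>

lemma wiener_integrand_wave:
  assumes H: "1/2 \<le> H"
  shows "wiener_integrand H (wave_integrand x t)"
proof (cases "H = 1/2")
  case True
  have [measurable]: "(\<lambda>(r, y). (wave_integrand x t r y)\<^sup>2) \<in> borel_measurable borel"
    using borel_measurable_power[OF measurable_wave_integrand[of x t], of 2] by (simp add: case_prod_unfold)
  have "set_integrable lborel ({0..} \<times> UNIV) (\<lambda>(r, y). (wave_integrand x t r y)\<^sup>2)"
    unfolding set_integrable_def
  proof (rule Bochner_Integration.integrable_bound)
    show "integrable lborel (indicator (cbox (0, x - t) (t, x + t)) :: real \<times> real \<Rightarrow> real)"
      by (intro integrable_real_indicator emeasure_lborel_cbox_finite) simp
    have "norm (indicator ({0..} \<times> UNIV) z *\<^sub>R (case z of (r, y) \<Rightarrow> (wave_integrand x t r y)\<^sup>2))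
        \<le> norm (indicator (cbox (0, x - t) (t, x + t)) z :: real)" for z :: "real \<times> real"
      by (cases z) (auto simp: indicator_def wave_integrand_def wave_kernel_def power2_eq_square cbox_Pair_eq)
    thus "AE z in lborel. norm (indicator ({0..} \<times> UNIV) z *\<^sub>R (case z of (r, y) \<Rightarrow> (wave_integrand x t r y)\<^sup>2))
        \<le> norm (indicator (cbox (0, x - t) (t, x + t)) z :: real)" by simp
    have "({0..} \<times> UNIV :: (real \<times> real) set) \<in> sets borel" by (intro borel_closed closed_Times) auto
    thus "(\<lambda>z. indicator ({0..} \<times> UNIV) z *\<^sub>R (case z of (r, y) \<Rightarrow> (wave_integrand x t r y)\<^sup>2)) \<in> borel_measurable lborel"
      by (intro borel_measurable_scaleR borel_measurable_indicator) auto
  qed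
  thus ?thesis using True by (simp add: wiener_integrand_def)
next
  case False
  hence H': "1/2 < H" using H by simp
  have mw: "(\<lambda>w. wave_integrand x t (f w) (g w)) \<in> borel_measurable lborel"
    if "f \<in> borel_measurable borel" "g \<in> borel_measurable borel" for f g :: "real \<times> real \<times> real \<Rightarrow> real"
    using measurable_compose[OF borel_measurable_Pair[OF that] measurable_wave_integrand] by simp
  define G :: "real \<times> real \<times> real \<Rightarrow> real" where
    "G = (\<lambda>(r, v, y). wave_integrand x t r y * wave_integrand x t v y * \<bar>r - v\<bar> powr (2 * H - 2))"
  have GB: "(\<lambda>z. indicator ({0..} \<times> {0..} \<times> UNIV) z *\<^sub>R G z) \<in> borel_measurable lborel"
  proof -
    have c: "f \<in> borel_measurable borel" if "continuous_on UNIV f" for f :: "real \<times> real \<times> real \<Rightarrow> real"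
      using that by (rule borel_measurable_continuous_onI)
    have "({0..} \<times> {0..} \<times> UNIV :: (real \<times> real \<times> real) set) \<in> sets borel"
      by (intro borel_closed closed_Times) auto
    moreover have "(\<lambda>z::real \<times> real \<times> real. \<bar>fst z - fst (snd z)\<bar> powr (2 * H - 2)) \<in> borel_measurable borel"
      by (rule measurable_compose[OF c, of "\<lambda>z. fst z - fst (snd z)" "\<lambda>u. \<bar>u\<bar> powr (2 * H - 2)" borel])
         (intro continuous_intros, measurable)
    ultimately show ?thesis
      unfolding G_def case_prod_unfold
      by (intro borel_measurable_scaleR borel_measurable_indicator borel_measurable_times mw c continuous_intros) auto
  qed
  have "set_integrable lborel ({0..} \<times> {0..} \<times> UNIV) G"
    unfolding set_integrable_def
  proof (rule integrableI_nonneg[OF GB])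
    show "AE z in lborel. 0 \<le> indicator ({0..} \<times> {0..} \<times> UNIV) z *\<^sub>R G z"
      by (intro AE_I2) (auto simp: G_def wave_integrand_nonneg indicator_def)
    let ?h = "\<lambda>z. ennreal (indicator ({0..} \<times> {0..} \<times> UNIV) z *\<^sub>R G z)"
    have hm: "?h \<in> borel_measurable (lborel \<Otimes>\<^sub>M (lborel \<Otimes>\<^sub>M lborel))"
      using measurable_compose[OF GB measurable_ennreal] by (simp add: lborel_prod)
    have "(\<integral>\<^sup>+z. ?h z \<partial>lborel) = (\<integral>\<^sup>+z. ?h z \<partial>(lborel \<Otimes>\<^sub>M (lborel \<Otimes>\<^sub>M lborel)))" by (simp add: lborel_prod)
    also have "\<dots> = (\<integral>\<^sup>+r. \<integral>\<^sup>+w. ?h (r, w) \<partial>(lborel \<Otimes>\<^sub>M lborel) \<partial>lborel)"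
      by (rule sigma_finite_measure.nn_integral_fst[symmetric, OF _ hm]) (unfold lborel_prod, rule sigma_finite_lborel)
    also have "\<dots> = (\<integral>\<^sup>+r. \<integral>\<^sup>+v. \<integral>\<^sup>+y. ?h (r, v, y) \<partial>lborel \<partial>lborel \<partial>lborel)"
      by (intro nn_integral_cong lborel.nn_integral_fst[symmetric] measurable_compose[OF _ hm]) measurable
    also have "\<dots> = (\<integral>\<^sup>+r. \<integral>\<^sup>+v. ennreal (indicator {0..} r * (indicator {0..} v * (\<bar>r - v\<bar> powr (2 * H - 2) *
      (1/2 * max 0 (min (t - r) (t - v)))))) \<partial>lborel \<partial>lborel)"
    proof (intro nn_integral_cong)
      fix r v :: real
      show "(\<integral>\<^sup>+y. ?h (r, v, y) \<partial>lborel) = ennreal (indicator {0..} r * (indicator {0..} v * (\<bar>r - v\<bar> powr (2 * H - 2) *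
        (1/2 * max 0 (min (t - r) (t - v))))))"
      proof (cases "0 \<le> r \<and> 0 \<le> v")
        case True
        have "(\<integral>\<^sup>+y. ?h (r, v, y) \<partial>lborel) = (\<integral>\<^sup>+y. ennreal (\<bar>r - v\<bar> powr (2 * H - 2)) *
            ennreal (wave_integrand x t r y * wave_integrand x t v y) \<partial>lborel)"
          using True by (intro nn_integral_cong) (simp add: G_def ennreal_mult[symmetric] wave_integrand_nonneg mult_ac)
        also have "\<dots> = ennreal (\<bar>r - v\<bar> powr (2 * H - 2)) * (\<integral>\<^sup>+y. ennreal (wave_integrand x t r y * wave_integrand x t v y) \<partial>lborel)"
          using True by (intro nn_integral_cmult measurable_compose[OF measurable_wave_prod measurable_ennreal]) auto
        also have "\<dots> = ennreal (\<bar>r - v\<bar> powr (2 * H - 2) * (1/2 * max 0 (min (t - r) (t - v))))"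
          unfolding nn_integral_wave_prod[OF conjunct1[OF True] conjunct2[OF True]]
          by (rule ennreal_mult[symmetric]) simp_all
        finally show ?thesis using True by simp
      qed (auto simp: indicator_def)
    qed
    also have "\<dots> = ennreal (wave_cov H t t / (H * (2 * H - 1)))" by (rule nn_integral_wave_triple[OF H'])
    finally show "(\<integral>\<^sup>+z. ?h z \<partial>lborel) < \<infinity>" by simp
  qed
  thus ?thesis using False by (simp add: wiener_integrand_def G_def)
qed

section \<open>Decay of the correlations\<close>

lemma convex_on_abs_powr:
  fixes p :: real assumes p: "1 \<le> p"
  shows "convex_on UNIV (\<lambda>u::real. \<bar>u\<bar> powr p)"
proof (rule convex_onI)
  fix t x y :: real assume t: "0 < t" "t < 1"
  have "\<bar>(1 - t) *\<^sub>R x + t *\<^sub>R y\<bar> \<le> (1 - t) * \<bar>x\<bar> + t * \<bar>y\<bar>"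
    using abs_triangle_ineq[of "(1 - t) * x" "t * y"] t by (simp add: abs_mult)
  hence "\<bar>(1 - t) *\<^sub>R x + t *\<^sub>R y\<bar> powr p \<le> ((1 - t) * \<bar>x\<bar> + t * \<bar>y\<bar>) powr p"
    using p by (intro powr_mono2) auto
  also have "\<dots> \<le> (1 - t) * \<bar>x\<bar> powr p + t * \<bar>y\<bar> powr p"
  \<comment> \<open>Convexity of the power is invoked at positive arguments; if one argument
    vanishes, the claim is that \<open>s powr p\<close> is at most \<open>s\<close> for
    \<open>s\<close> between 0 and 1.\<close>
  proof (cases "x = 0 \<or> y = 0")
    case True
    have "(s * \<bar>u\<bar>) powr p \<le> s * \<bar>u\<bar> powr p" if "0 < s" "s < 1" for s u
    proof -
      have "s powr p \<le> s powr 1" using that p by (intro powr_mono') auto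
      thus ?thesis using that by (simp add: powr_mult mult_right_mono)
    qed
    thus ?thesis using True t p by auto
  next
    case False
    thus ?thesis using convex_onD[OF powr_convex[OF p], of t "\<bar>x\<bar>" "\<bar>y\<bar>"] t by simp
  qed
  finally show "\<bar>(1 - t) *\<^sub>R x + t *\<^sub>R y\<bar> powr p \<le> (1 - t) * \<bar>x\<bar> powr p + t * \<bar>y\<bar> powr p" .
qed simp

text \<open>The two inner points are convex combinations of the two outer ones with complementary
  weights d / (d + e) and e / (d + e), so the weights add up to 1 at each end.\<close>

lemma convex_on_exchange:
  fixes \<phi> :: "real \<Rightarrow> real"
  assumes c: "convex_on UNIV \<phi>" and "0 \<le> d" "0 \<le> e"
  shows "\<phi> (u + d) + \<phi> (u + e) \<le> \<phi> u + \<phi> (u + d + e)"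
proof (cases "d + e = 0")
  case True
  hence "d = 0" "e = 0" using assms by auto
  thus ?thesis by simp
next
  case False
  hence L: "0 < d + e" using assms by auto
  have w: "\<phi> (u + a) \<le> (1 - a / (d + e)) * \<phi> u + a / (d + e) * \<phi> (u + d + e)" if "0 \<le> a" "a \<le> d + e" for a
  proof -
    have "(1 - a / (d + e)) *\<^sub>R u + (a / (d + e)) *\<^sub>R (u + d + e) = u + a"
    proof -
      have "(1 - c) *\<^sub>R u + c *\<^sub>R (u + d + e) = u + c * (d + e)" for c
        by (simp add: algebra_simps)
      from this[of "a / (d + e)"] show ?thesis using L by simp
    qed
    thus ?thesis using convex_onD[OF c, of "a / (d + e)" u "u + d + e"] that L by simp
  qed
  define p where "p = d / (d + e)"
  have q: "e / (d + e) = 1 - p" using L by (simp add: p_def field_simps)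
  show ?thesis using w[of d, folded p_def] w[of e, unfolded q] assms by (simp add: algebra_simps)
qed

text \<open>The covariance of the fractional Brownian increments over [a, a'] and [b, b'], for
  nonnegative times. The one-variable terms cancel, so the expression depends on time differences
  only and stays meaningful for negative arguments, which occur once truncations are
  removed.\<close>

definition fbm_rect :: "real \<Rightarrow> real \<Rightarrow> real \<Rightarrow> real \<Rightarrow> real \<Rightarrow> real" where
  "fbm_rect H a a' b b' = fbm_cov H a' b' - fbm_cov H a' b - fbm_cov H a b' + fbm_cov H a b"

lemma fbm_rect_eq:
  "fbm_rect H a a' b b' = (\<bar>a' - b\<bar> powr (2 * H) + \<bar>a - b'\<bar> powr (2 * H) - \<bar>a' - b'\<bar> powr (2 * H) - \<bar>a - b\<bar> powr (2 * H)) / 2"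
  by (simp add: fbm_rect_def fbm_cov_def diff_divide_distrib add_divide_distrib)

text \<open>The exchange inequality for the convex function |.|^(2H), started at a - b' with steps
  b' - b and a' - a. This is where H >= 1/2 makes increments positively correlated.\<close>

lemma fbm_rect_nonneg:
  assumes "1/2 \<le> H" "a \<le> a'" "b \<le> b'"
  shows "0 \<le> fbm_rect H a a' b b'"
  using convex_on_exchange[OF convex_on_abs_powr[of "2 * H"], of "b' - b" "a' - a" "a - b'"] assms
  by (simp add: fbm_rect_eq)

text \<open>The expression is additive under splitting either interval, and the two pieces that are
  cut off are nonnegative.\<close>

lemma fbm_rect_mono:
  assumes "1/2 \<le> H" "a \<le> a1" "a1 \<le> a'" "b \<le> b1" "b1 \<le> b'"
  shows "fbm_rect H a1 a' b1 b' \<le> fbm_rect H a a' b b'"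
  using fbm_rect_nonneg[of H a a1 b b'] fbm_rect_nonneg[of H a1 a' b b1] assms
  by (simp add: fbm_rect_eq)

text \<open>The autocovariance of fractional Gaussian noise at lag \<open>k\<close>.\<close>

definition fgn_cov :: "real \<Rightarrow> real \<Rightarrow> real" where
  "fgn_cov H k = (\<bar>k + 1\<bar> powr (2 * H) + \<bar>k - 1\<bar> powr (2 * H) - 2 * \<bar>k\<bar> powr (2 * H)) / 2"

lemma fbm_rect_shift:
  assumes h: "0 \<le> h"
  shows "fbm_rect H (i * h - z) ((i + 1) * h - z) (j * h - z) ((j + 1) * h - z) = h powr (2 * H) * fgn_cov H (i - j)"
proof -
  have e: "\<bar>c * h\<bar> powr (2 * H) = h powr (2 * H) * \<bar>c\<bar> powr (2 * H)" for c
    using h by (simp add: abs_mult powr_mult mult.commute)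
  have d: "(i + 1) * h - z - (j * h - z) = (i - j + 1) * h" "i * h - z - ((j + 1) * h - z) = (i - j - 1) * h"
    "(i + 1) * h - z - ((j + 1) * h - z) = (i - j) * h" "i * h - z - (j * h - z) = (i - j) * h"
    by (simp_all add: algebra_simps)
  show ?thesis unfolding fbm_rect_eq d e fgn_cov_def by (simp add: field_simps)
qed

lemma fgn_cov_nonneg: "1/2 \<le> H \<Longrightarrow> 0 \<le> fgn_cov H k"
  using fbm_rect_shift[of 1 H k 0 0] fbm_rect_nonneg[of H k "k + 1" 0 1] by simp

lemma fgn_cov_0: "0 < H \<Longrightarrow> fgn_cov H 0 = 1"
  by (simp add: fgn_cov_def)

lemma fgn_cov_minus: "fgn_cov H (- k) = fgn_cov H k"
proof -
  have "\<bar>- k + 1\<bar> = \<bar>k - 1\<bar>" "\<bar>- k - 1\<bar> = \<bar>k + 1\<bar>" by auto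
  thus ?thesis by (simp add: fgn_cov_def)
qed

text \<open>A second difference of u^(2H) behaves like its second derivative. Two mean values reduce
  it to a difference of q-th powers with q = 2H - 1, and a third yields the power q - 1. Lags 0 and
  1 are checked by hand, since there k - 1 is not positive.\<close>

lemma fgn_cov_le:
  assumes H: "1/2 \<le> H" "H < 1"
  shows "fgn_cov H (real n) \<le> 6 * (1 + real n) powr (2 * H - 2)"
proof (cases "n \<le> 1")
  case True
  have "2 powr (- 1) \<le> (2::real) powr (2 * H - 2)" using H by (intro powr_mono) auto
  hence 1: "1/2 \<le> (2::real) powr (2 * H - 2)" by (simp add: powr_minus)
  have "(2::real) powr (2 * H) \<le> 2 powr 2" using H by (intro powr_mono) auto
  hence 2: "(2::real) powr (2 * H) \<le> 4" by simp
  from True have "n = 0 \<or> n = 1" by auto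
  thus ?thesis
  proof
    assume "n = 0" thus ?thesis using fgn_cov_0[of H] H by simp
  next
    assume "n = 1" thus ?thesis using 1 2 by (simp add: fgn_cov_def)
  qed
next
  case False
  define k where "k = real n"
  have k: "2 \<le> k" using False by (simp add: k_def)
  define q where "q = 2 * H - 1"
  have q: "0 \<le> q" "q < 1" "2 * H = q + 1" "2 * H - 2 = q - 1" using H by (auto simp: q_def)
  have mvt: "\<exists>\<xi>. x < \<xi> \<and> \<xi> < y \<and> y powr p - x powr p = (y - x) * (p * \<xi> powr (p - 1))" if "0 < x" "x < y" for x y p :: real
    using MVT2[OF that(2), of "\<lambda>u. u powr p" "\<lambda>u. p * u powr (p - 1)"] that has_real_derivative_powr
    by (meson less_le_trans)
  obtain \<xi>1 where \<xi>1: "k < \<xi>1" "\<xi>1 < k + 1" "(k + 1) powr (q + 1) - k powr (q + 1) = (q + 1) * \<xi>1 powr q"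
    using mvt[of k "k + 1" "q + 1"] k by auto
  obtain \<xi>2 where \<xi>2: "k - 1 < \<xi>2" "\<xi>2 < k" "k powr (q + 1) - (k - 1) powr (q + 1) = (q + 1) * \<xi>2 powr q"
    using mvt[of "k - 1" k "q + 1"] k by auto
  obtain \<xi> where \<xi>: "k - 1 < \<xi>" "(k + 1) powr q - (k - 1) powr q = 2 * (q * \<xi> powr (q - 1))"
    using mvt[of "k - 1" "k + 1" q] k by auto
  have "fgn_cov H k = ((q + 1) * \<xi>1 powr q - (q + 1) * \<xi>2 powr q) / 2"
    using k \<xi>1(3) \<xi>2(3) by (simp add: fgn_cov_def q)
  also have "\<dots> = (q + 1) / 2 * (\<xi>1 powr q - \<xi>2 powr q)" by (simp add: algebra_simps)
  also have "\<dots> \<le> (q + 1) / 2 * ((k + 1) powr q - (k - 1) powr q)"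
    using \<xi>1 \<xi>2 k q by (intro mult_left_mono diff_mono powr_mono2) auto
  also have "\<dots> = (q + 1) * q * \<xi> powr (q - 1)" using \<xi>(2) by simp
  \<comment> \<open>For k >= 2 the mean value point exceeds k - 1 >= (1 + k) / 3. The constant 6 is
    2 times 3, where 3 bounds 3^(1 - q).\<close>
  also have "\<dots> \<le> 2 * ((1 + k) / 3) powr (q - 1)"
  proof (intro mult_mono)
    show "(q + 1) * q \<le> 2" using mult_mono[of "q + 1" 2 q 1] q by simp
    show "\<xi> powr (q - 1) \<le> ((1 + k) / 3) powr (q - 1)"
      using q \<xi>(1) k by (intro powr_mono2') auto
  qed (use q in auto)
  also have "((1 + k) / 3) powr (q - 1) = (1 + k) powr (q - 1) * 3 powr (1 - q)"
  proof -
    have "(3::real) powr (1 - q) * 3 powr (q - 1) = 1" by (simp flip: powr_add)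
    thus ?thesis using k by (simp add: powr_divide field_simps)
  qed
  also have "2 * ((1 + k) powr (q - 1) * 3 powr (1 - q)) \<le> 2 * ((1 + k) powr (q - 1) * 3 powr 1)"
    using q by (intro mult_left_mono powr_mono) auto
  finally show ?thesis by (simp add: k_def q)
qed

definition wave_incr_cov :: "real \<Rightarrow> nat \<Rightarrow> nat \<Rightarrow> nat \<Rightarrow> real" where
  "wave_incr_cov H N i j = wave_cov H (real (i + 1) / real N) (real (j + 1) / real N) - wave_cov H (real (i + 1) / real N) (real j / real N)
     - wave_cov H (real i / real N) (real (j + 1) / real N) + wave_cov H (real i / real N) (real j / real N)"

lemma wave_incr_cov_eq:
  assumes H: "1/2 \<le> H"
  shows "wave_incr_cov H N i j = 1/2 * (LINT z:{0..}|lborel. fbm_rect H (max 0 (real i / real N - z)) (max 0 (real (i + 1) / real N - z))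
      (max 0 (real j / real N - z)) (max 0 (real (j + 1) / real N - z)))"
    and "set_integrable lborel {0..} (\<lambda>z. fbm_rect H (max 0 (real i / real N - z)) (max 0 (real (i + 1) / real N - z))
      (max 0 (real j / real N - z)) (max 0 (real (j + 1) / real N - z)))"
proof -
  note i = set_integrable_fbm_cov_wave[OF H, unfolded set_integrable_def]
  show "set_integrable lborel {0..} (\<lambda>z. fbm_rect H (max 0 (real i / real N - z)) (max 0 (real (i + 1) / real N - z))
      (max 0 (real j / real N - z)) (max 0 (real (j + 1) / real N - z)))"
    unfolding fbm_rect_def by (intro set_integral_diff set_integral_add set_integrable_fbm_cov_wave H)
  show "wave_incr_cov H N i j = 1/2 * (LINT z:{0..}|lborel. fbm_rect H (max 0 (real i / real N - z)) (max 0 (real (i + 1) / real N - z))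
      (max 0 (real j / real N - z)) (max 0 (real (j + 1) / real N - z)))"
    unfolding wave_incr_cov_def wave_cov_def fbm_rect_def set_lebesgue_integral_def scaleR_add_right scaleR_diff_right
    by (simp add: i del: scaleR_conv_of_real real_scaleR_def of_nat_add of_nat_Suc)
qed

text \<open>At each \<open>z\<close> the integrand is a fractional increment covariance with times
  truncated at 0. Truncation only shrinks the two intervals, which gives the upper bound; on the
  diagonal it has no effect while \<open>z\<close> is at most i/N, and this length is the factor in
  the lower bound.\<close>

lemma wave_incr_cov_bounds:
  assumes H: "1/2 \<le> H" "H < 1" and ij: "i < N" "j < N"
  shows "0 \<le> wave_incr_cov H N i j"
    and "wave_incr_cov H N i j \<le> 1/2 * (1 / real N) powr (2 * H) * fgn_cov H (real i - real j)"
    and "1/2 * (real i / real N) * (1 / real N) powr (2 * H) \<le> wave_incr_cov H N i i"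
proof -
  define h where "h = 1 / real N"
  have h: "0 < h" "real N * h = 1" using ij by (auto simp: h_def)
  have t: "real k / real N = real k * h" "real (k + 1) = real k + 1" "(real k + 1) / real N = (real k + 1) * h" for k
    by (auto simp: h_def)
  define D where "D i j z = fbm_rect H (max 0 (real i * h - z)) (max 0 ((real i + 1) * h - z))
      (max 0 (real j * h - z)) (max 0 ((real j + 1) * h - z))" for i j z
  have eq: "wave_incr_cov H N i j = 1/2 * (LINT z:{0..}|lborel. D i j z)" for i j
    using wave_incr_cov_eq(1)[OF H(1), where N = N and i = i and j = j] unfolding t D_def .
  have int: "set_integrable lborel {0..} (D i j)" for i j
    using wave_incr_cov_eq(2)[OF H(1), where N = N and i = i and j = j] unfolding t D_def .
  have mh: "max 0 (real k * h - z) \<le> max 0 ((real k + 1) * h - z)" for k z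
    using h by (intro max.mono diff_mono mult_right_mono) auto
  have D0: "0 \<le> D i j z" for i j z unfolding D_def by (intro fbm_rect_nonneg H mh)
  show "0 \<le> wave_incr_cov H N i j"
    unfolding eq set_lebesgue_integral_def by (auto intro!: mult_nonneg_nonneg integral_nonneg_AE D0)
  define B where "B = h powr (2 * H) * fgn_cov H (real i - real j)"
  have B0: "0 \<le> B" using fgn_cov_nonneg[OF H(1)] by (simp add: B_def)
  have DB: "D i j z \<le> B * indicator {0..1} z" if z: "0 \<le> z" for z
  proof (cases "z \<le> (real i + 1) * h \<and> z \<le> (real j + 1) * h")
    case True
    have "(real i + 1) * h \<le> real N * h" using ij h by (intro mult_right_mono) auto
    hence z1: "z \<le> 1" using True h by simp
    have "D i j z = fbm_rect H (max 0 (real i * h - z)) ((real i + 1) * h - z) (max 0 (real j * h - z)) ((real j + 1) * h - z)"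
      using True by (simp add: D_def)
    \<comment> \<open>The intervals are extended to their untruncated left ends, possibly negative;
      the larger rectangle has a value depending on i - j only.\<close>
    also have "\<dots> \<le> fbm_rect H (real i * h - z) ((real i + 1) * h - z) (real j * h - z) ((real j + 1) * h - z)"
      using True h by (intro fbm_rect_mono H) (auto intro!: mult_right_mono)
    also have "\<dots> = B" unfolding B_def using h by (intro fbm_rect_shift) simp
    finally show ?thesis using z z1 by simp
  next
    case False
    \<comment> \<open>Once \<open>z\<close> passes the right end of one interval, both of its ends
      are truncated to 0 and the increment vanishes.\<close>
    hence "max 0 ((real i + 1) * h - z) = 0 \<and> max 0 (real i * h - z) = 0 \<or> max 0 ((real j + 1) * h - z) = 0 \<and> max 0 (real j * h - z) = 0"
      using mh[of i z] mh[of j z] by linarith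
    hence "D i j z = 0" by (auto simp: D_def fbm_rect_def)
    thus ?thesis using B0 by (simp add: indicator_def)
  qed
  have "(LINT z:{0..}|lborel. D i j z) \<le> (LINT z|lborel. B * indicator {0..1::real} z)"
    unfolding set_lebesgue_integral_def
  proof (rule integral_mono)
    show "integrable lborel (\<lambda>z. B * indicator {0..1::real} z)"
      by (intro integrable_mult_right integrable_real_indicator) auto
    show "indicator {0..} z *\<^sub>R D i j z \<le> B * indicator {0..1} z" for z
      using DB[of z] by (cases "0 \<le> z") auto
  qed (use int in \<open>simp add: set_integrable_def\<close>)
  also have "\<dots> = B" by simp
  finally show "wave_incr_cov H N i j \<le> 1/2 * (1 / real N) powr (2 * H) * fgn_cov H (real i - real j)"
    unfolding eq B_def h_def by simp
  have Dd: "h powr (2 * H) * indicator {0..real i * h} z \<le> D i i z" for z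
  proof (cases "0 \<le> z \<and> z \<le> real i * h")
    case True
    moreover have "real i * h \<le> (real i + 1) * h" using h by (intro mult_right_mono) auto
    ultimately have "D i i z = fbm_rect H (real i * h - z) ((real i + 1) * h - z) (real i * h - z) ((real i + 1) * h - z)"
      by (simp add: D_def)
    also have "\<dots> = h powr (2 * H) * fgn_cov H (real i - real i)" using h by (intro fbm_rect_shift) simp
    finally show ?thesis using True H fgn_cov_0[of H] by simp
  next
    case False thus ?thesis using D0[of i i z] by (auto simp: indicator_def)
  qed
  have "real i * h * h powr (2 * H) = (LINT z|lborel. h powr (2 * H) * indicator {0..real i * h} z)"
    using h by simp
  also have "\<dots> \<le> (LINT z:{0..}|lborel. D i i z)"
    unfolding set_lebesgue_integral_def
  proof (rule integral_mono)
    show "integrable lborel (\<lambda>z. h powr (2 * H) * indicator {0..real i * h} z)"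
      by (intro integrable_mult_right integrable_real_indicator) (auto simp: emeasure_lborel_Icc_eq)
    show "h powr (2 * H) * indicator {0..real i * h} z \<le> indicator {0..} z *\<^sub>R D i i z" for z
      using Dd[of z] by (cases "0 \<le> z") auto
  qed (use int in \<open>simp add: set_integrable_def\<close>)
  finally show "1/2 * (real i / real N) * (1 / real N) powr (2 * H) \<le> wave_incr_cov H N i i"
    unfolding eq h_def by simp
qed

section \<open>The four-cycle sum\<close>

text \<open>The four-fold product is bounded by the triple products via AM-GM; taking cubes \<open>u ^ 3\<close> for the
  entries keeps the exponent \<open>4/3\<close> of Young's inequality polynomial.\<close>

lemma cycle_prod_le:
  fixes a b c d :: real
  shows "4 * (a ^ 3 * b ^ 3 * c ^ 3 * d ^ 3) \<le> b ^ 4 * c ^ 4 * d ^ 4 + a ^ 4 * c ^ 4 * d ^ 4 + a ^ 4 * b ^ 4 * d ^ 4 + a ^ 4 * b ^ 4 * c ^ 4"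
proof -
  \<comment> \<open>AM-GM in two rounds: the first two squares pair up the four terms, and the third
    applies AM-GM to the two resulting geometric means.\<close>
  have "0 \<le> (b\<^sup>2 * c\<^sup>2 * d\<^sup>2 - a\<^sup>2 * c\<^sup>2 * d\<^sup>2)\<^sup>2 + (a\<^sup>2 * b\<^sup>2 * d\<^sup>2 - a\<^sup>2 * b\<^sup>2 * c\<^sup>2)\<^sup>2
      + 2 * (a * b * (c\<^sup>2 * d\<^sup>2) - a\<^sup>2 * b\<^sup>2 * (c * d))\<^sup>2" by simp
  also have "\<dots> = b ^ 4 * c ^ 4 * d ^ 4 + a ^ 4 * c ^ 4 * d ^ 4 + a ^ 4 * b ^ 4 * d ^ 4 + a ^ 4 * b ^ 4 * c ^ 4
      - 4 * (a ^ 3 * b ^ 3 * c ^ 3 * d ^ 3)"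
    by algebra
  finally show ?thesis by simp
qed

lemma sum_rotate3:
  "(\<Sum>i\<in>A. \<Sum>j\<in>B. \<Sum>k\<in>C. f i j k) = (\<Sum>j\<in>B. \<Sum>k\<in>C. \<Sum>i\<in>A. f i j k)"
  by (subst sum.swap) (intro sum.cong refl sum.swap)

lemma sum_rotate4:
  "(\<Sum>i\<in>A. \<Sum>j\<in>B. \<Sum>k\<in>C. \<Sum>l\<in>D. f i j k l) = (\<Sum>j\<in>B. \<Sum>k\<in>C. \<Sum>l\<in>D. \<Sum>i\<in>A. f i j k l)"
  by (subst sum.swap) (intro sum.cong refl sum_rotate3)

text \<open>Expanded, the left side is a sum over closed 4-cycles. AM-GM replaces a cycle by the
  average of four paths, each with one edge removed; a path is summed from its free end, each edge
  costing one row sum \<open>S\<close> and the last vertex the factor \<open>n\<close>.\<close>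

lemma sum_cycle_le:
  fixes u :: "nat \<Rightarrow> nat \<Rightarrow> real"
  assumes sym: "\<And>i j. u i j = u j i" and S: "\<And>i. i < n \<Longrightarrow> (\<Sum>j<n. u i j ^ 4) \<le> S"
  shows "(\<Sum>i<n. \<Sum>j<n. (\<Sum>k<n. u i k ^ 3 * u k j ^ 3)\<^sup>2) \<le> real n * S ^ 3"
proof (cases "n = 0")
  case False
  have "0 \<le> (\<Sum>j<n. u 0 j ^ 4)" by (intro sum_nonneg) simp
  hence S0: "0 \<le> S" using S[of 0] False by simp
  have path: "(\<Sum>i<n. \<Sum>j<n. \<Sum>k<n. \<Sum>l<n. u i j ^ 4 * u j k ^ 4 * u k l ^ 4) \<le> real n * S ^ 3"
  proof -
    have "(\<Sum>i<n. \<Sum>j<n. \<Sum>k<n. \<Sum>l<n. u i j ^ 4 * u j k ^ 4 * u k l ^ 4)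
       = (\<Sum>i<n. \<Sum>j<n. u i j ^ 4 * (\<Sum>k<n. u j k ^ 4 * (\<Sum>l<n. u k l ^ 4)))"
      by (simp add: sum_distrib_left mult.assoc)
    also have "\<dots> \<le> (\<Sum>i<n. \<Sum>j<n. u i j ^ 4 * (\<Sum>k<n. u j k ^ 4 * S))"
      using S by (intro sum_mono mult_left_mono) auto
    also have "\<dots> = (\<Sum>i<n. \<Sum>j<n. u i j ^ 4 * ((\<Sum>k<n. u j k ^ 4) * S))"
      by (simp add: sum_distrib_right)
    also have "\<dots> \<le> (\<Sum>i<n. \<Sum>j<n. u i j ^ 4 * (S * S))"
      using S S0 by (intro sum_mono mult_left_mono mult_right_mono) auto
    also have "\<dots> = (\<Sum>i<n. (\<Sum>j<n. u i j ^ 4) * (S * S))"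
      by (simp add: sum_distrib_right)
    also have "\<dots> \<le> (\<Sum>i<n. S * (S * S))"
      using S S0 by (intro sum_mono mult_right_mono) auto
    also have "\<dots> = real n * S ^ 3" by (simp add: power3_eq_cube mult_ac)
    finally show ?thesis .
  qed
  define T where "T i k j l = u i k ^ 3 * u k j ^ 3 * u j l ^ 3 * u l i ^ 3" for i j k l
  have "4 * (\<Sum>i<n. \<Sum>j<n. (\<Sum>k<n. u i k ^ 3 * u k j ^ 3)\<^sup>2) = (\<Sum>i<n. \<Sum>j<n. \<Sum>k<n. \<Sum>l<n. 4 * T i k j l)"
  proof -
    have "(\<Sum>k<n. u i k ^ 3 * u k j ^ 3)\<^sup>2 = (\<Sum>k<n. \<Sum>l<n. T i k j l)" for i j
      unfolding power2_eq_square sum_product T_def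
      by (intro sum.cong refl) (metis (no_types) sym mult.assoc mult.commute)
    thus ?thesis by (simp add: sum_distrib_left)
  qed
  also have "\<dots> \<le> (\<Sum>i<n. \<Sum>j<n. \<Sum>k<n. \<Sum>l<n.
      u k j ^ 4 * u j l ^ 4 * u l i ^ 4 + u i k ^ 4 * u j l ^ 4 * u l i ^ 4
      + u i k ^ 4 * u k j ^ 4 * u l i ^ 4 + u i k ^ 4 * u k j ^ 4 * u j l ^ 4)"
    unfolding T_def by (intro sum_mono cycle_prod_le)
  also have "\<dots> = (\<Sum>i<n. \<Sum>j<n. \<Sum>k<n. \<Sum>l<n. u k j ^ 4 * u j l ^ 4 * u l i ^ 4)
      + (\<Sum>i<n. \<Sum>j<n. \<Sum>k<n. \<Sum>l<n. u i k ^ 4 * u j l ^ 4 * u l i ^ 4)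
      + (\<Sum>i<n. \<Sum>j<n. \<Sum>k<n. \<Sum>l<n. u i k ^ 4 * u k j ^ 4 * u l i ^ 4)
      + (\<Sum>i<n. \<Sum>j<n. \<Sum>k<n. \<Sum>l<n. u i k ^ 4 * u k j ^ 4 * u j l ^ 4)"
    by (simp add: sum.distrib)
  also have "(\<Sum>i<n. \<Sum>j<n. \<Sum>k<n. \<Sum>l<n. u k j ^ 4 * u j l ^ 4 * u l i ^ 4)
      = (\<Sum>k<n. \<Sum>j<n. \<Sum>l<n. \<Sum>i<n. u k j ^ 4 * u j l ^ 4 * u l i ^ 4)"
    by (subst sum_rotate4) (rule sum.swap)
  also have "(\<Sum>i<n. \<Sum>j<n. \<Sum>k<n. \<Sum>l<n. u i k ^ 4 * u j l ^ 4 * u l i ^ 4)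
      = (\<Sum>j<n. \<Sum>l<n. \<Sum>i<n. \<Sum>k<n. u j l ^ 4 * u l i ^ 4 * u i k ^ 4)"
    by (subst sum_rotate4, rule sum.cong[OF refl], subst sum_rotate3) (simp add: mult_ac)
  also have "(\<Sum>i<n. \<Sum>j<n. \<Sum>k<n. \<Sum>l<n. u i k ^ 4 * u k j ^ 4 * u l i ^ 4)
      = (\<Sum>l<n. \<Sum>i<n. \<Sum>k<n. \<Sum>j<n. u l i ^ 4 * u i k ^ 4 * u k j ^ 4)"
    by (subst sum_rotate4[symmetric], rule sum.cong[OF refl], rule sum.cong[OF refl], subst sum.swap) (simp add: mult_ac)
  also have "(\<Sum>i<n. \<Sum>j<n. \<Sum>k<n. \<Sum>l<n. u i k ^ 4 * u k j ^ 4 * u j l ^ 4)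
      = (\<Sum>i<n. \<Sum>k<n. \<Sum>j<n. \<Sum>l<n. u i k ^ 4 * u k j ^ 4 * u j l ^ 4)"
    by (intro sum.cong refl sum.swap)
  finally show ?thesis using path by simp
qed simp

section \<open>Power sums and the three regimes of the rate\<close>

definition power_sum :: "real \<Rightarrow> nat \<Rightarrow> real" where
  "power_sum p n = (\<Sum>m<n. (1 + real m) powr (- p))"

lemma power_sum_nonneg: "0 \<le> power_sum p n"
  unfolding power_sum_def by (intro sum_nonneg) simp

lemma power_sum_bounded:
  assumes "1 < p" obtains K where "0 \<le> K" "\<And>n. power_sum p n \<le> K"
proof -
  have "summable (\<lambda>n. real n powr (- p))" using assms by (simp add: summable_real_powr_iff)
  hence s: "summable (\<lambda>n. real (Suc n) powr (- p))" by (subst summable_Suc_iff)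
  have "power_sum p n \<le> (\<Sum>n. real (Suc n) powr (- p))" for n
    using sum_le_suminf[OF s, of "{..<n}"] by (simp add: power_sum_def)
  moreover have "0 \<le> (\<Sum>n. real (Suc n) powr (- p))" by (intro suminf_nonneg s) simp
  ultimately show thesis using that by blast
qed

lemma power_sum_1_le:
  assumes "1 \<le> n" shows "power_sum 1 n \<le> 1 + ln (real n)"
  using assms
proof (induction n rule: dec_induct)
  case (step n)
  have n: "0 < real n" using step by simp
  have "ln (real n / (1 + real n)) \<le> real n / (1 + real n) - 1" using n by (intro ln_le_minus_one) simp
  also have "\<dots> = - (1 / (1 + real n))" using n by (simp add: field_simps)
  finally have "1 / (1 + real n) \<le> ln (1 + real n) - ln (real n)" using n by (simp add: ln_div)
  moreover have "power_sum 1 (Suc n) = power_sum 1 n + 1 / (1 + real n)"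
    using n by (simp add: power_sum_def powr_minus inverse_eq_divide)
  ultimately show ?case using step by simp
qed (simp add: power_sum_def)

lemma power_sum_le:
  assumes p: "0 \<le> p" "p < 1" shows "power_sum p n \<le> real n powr (1 - p) / (1 - p)"
proof (induction n)
  case (Suc n)
  have "(1 + real n) powr (- p) \<le> ((1 + real n) powr (1 - p) - real n powr (1 - p)) / (1 - p)"
  proof (cases "n = 0")
    case True thus ?thesis using p by simp
  next
    case False
    have d: "((\<lambda>u. u powr (1 - p)) has_real_derivative (1 - p) * u powr (1 - p - 1)) (at u)" if "real n \<le> u" for u
      using that False by (intro has_real_derivative_powr) auto
    obtain \<xi> where \<xi>: "real n < \<xi>" "\<xi> < 1 + real n"
      "(1 + real n) powr (1 - p) - real n powr (1 - p) = (1 + real n - real n) * ((1 - p) * \<xi> powr (1 - p - 1))"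
      using MVT2[of "real n" "1 + real n", OF _ d] by auto
    have "(1 + real n) powr (- p) \<le> \<xi> powr (- p)" using p \<xi> by (intro powr_mono2') auto
    thus ?thesis using \<xi>(3) p by simp
  qed
  moreover have "power_sum p (Suc n) = power_sum p n + (1 + real n) powr (- p)" by (simp add: power_sum_def)
  ultimately show ?case using Suc p by (simp add: diff_divide_distrib)
qed (simp add: power_sum_def)

text \<open>The exponent p = (8 - 8H) / 3 exceeds, equals or falls below 1 as H is below, at or
  above 5/8: bounded, logarithmic or growing power sums. The cube and the square root produce the
  exponent 3/2 of the logarithm.\<close>

lemma power_sum_rate:
  assumes H: "1/2 \<le> H" "H < 3/4"
  shows "\<exists>C\<ge>0. \<forall>N\<ge>2. sqrt (power_sum ((8 - 8 * H) / 3) N ^ 3 / real N) \<le> C * clt_rate H N"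
proof -
  define p where "p = (8 - 8 * H) / 3"
  consider "H < 5/8" | "H = 5/8" | "5/8 < H" by linarith
  hence "\<exists>C\<ge>0. \<forall>N\<ge>2. sqrt (power_sum p N ^ 3 / real N) \<le> C * clt_rate H N"
  proof cases
    case 1
    hence "1 < p" by (simp add: p_def)
    then obtain K where K: "0 \<le> K" "\<And>n. power_sum p n \<le> K" using power_sum_bounded by blast
    have "sqrt (power_sum p N ^ 3 / real N) \<le> sqrt (K ^ 3) * clt_rate H N" if "2 \<le> N" for N
    proof -
      have "sqrt (power_sum p N ^ 3 / real N) \<le> sqrt (K ^ 3 / real N)"
        using K power_sum_nonneg by (intro real_sqrt_le_mono divide_right_mono power_mono) auto
      thus ?thesis using 1 by (simp add: clt_rate_def real_sqrt_divide powr_minus powr_half_sqrt field_simps)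
    qed
    thus ?thesis using K by (intro exI[of _ "sqrt (K ^ 3)"]) auto
  next
    case 2
    hence p: "p = 1" by (simp add: p_def)
    have "sqrt (power_sum p N ^ 3 / real N) \<le> sqrt (3 ^ 3) * clt_rate H N" if N: "2 \<le> N" for N
    proof -
      \<comment> \<open>For N >= 2 one has 1 <= 2 ln N, which absorbs the additive constant into the
        logarithm and gives the factor 3.\<close>
      have "1/2 \<le> ln (2::real)" using ln2_ge_two_thirds by simp
      also have "\<dots> \<le> ln (real N)" using N by (subst ln_le_cancel_iff) auto
      finally have l: "1/2 \<le> ln (real N)" .
      have "power_sum p N \<le> 1 + ln (real N)" using power_sum_1_le[of N] N by (simp add: p)
      hence "power_sum p N \<le> 3 * ln (real N)" using l by simp
      hence "sqrt (power_sum p N ^ 3 / real N) \<le> sqrt ((3 * ln (real N)) ^ 3 / real N)"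
        using power_sum_nonneg by (intro real_sqrt_le_mono divide_right_mono power_mono) auto
      also have "\<dots> = sqrt (3 ^ 3) * sqrt (ln (real N) ^ 3) / sqrt (real N)"
        by (simp add: power_mult_distrib real_sqrt_divide real_sqrt_mult)
      also have "sqrt (ln (real N) ^ 3) = ln (real N) powr (3/2)"
      proof -
        have "sqrt (ln (real N) ^ 3) = (ln (real N) powr 3) powr (1/2)" using l by (simp add: powr_half_sqrt powr_numeral)
        also have "\<dots> = ln (real N) powr (3/2)" by (subst powr_powr) simp
        finally show ?thesis .
      qed
      finally show ?thesis using 2 by (simp add: clt_rate_def powr_minus powr_half_sqrt field_simps)
    qed
    thus ?thesis by (intro exI[of _ "sqrt (3 ^ 3)"]) auto
  next
    case 3
    hence p: "0 \<le> p" "p < 1" using H by (auto simp: p_def)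
    have "sqrt (power_sum p N ^ 3 / real N) \<le> sqrt ((1 / (1 - p)) ^ 3) * clt_rate H N" if N: "2 \<le> N" for N
    proof -
      have "sqrt (power_sum p N ^ 3 / real N) \<le> sqrt ((real N powr (1 - p) / (1 - p)) ^ 3 / real N)"
        using power_sum_nonneg power_sum_le[OF p] by (intro real_sqrt_le_mono divide_right_mono power_mono) auto
      also have "(real N powr (1 - p) / (1 - p)) ^ 3 / real N = (1 / (1 - p)) ^ 3 * real N powr (8 * H - 6)"
      proof -
        have "(real N powr (1 - p)) ^ 3 / real N = real N powr ((1 - p) * 3) / real N powr 1"
          using N by (simp add: powr_power mult_ac)
        \<comment> \<open>The exponent under the square root is 3 (1 - p) - 1 = 8H - 6, half of
          which is 4H - 3.\<close>
        also have "(1 - p) * 3 = 8 * H - 5" by (simp add: p_def field_simps)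
        also have "real N powr (8 * H - 5) / real N powr 1 = real N powr (8 * H - 6)"
          unfolding powr_diff[symmetric] by simp
        finally have E: "(real N powr (1 - p)) ^ 3 / real N = real N powr (8 * H - 6)" .
        show ?thesis unfolding E[symmetric] by (simp add: power_divide)
      qed
      also have "sqrt \<dots> = sqrt ((1 / (1 - p)) ^ 3) * (real N powr (8 * H - 6)) powr (1/2)"
        by (simp add: real_sqrt_mult powr_half_sqrt)
      also have "(real N powr (8 * H - 6)) powr (1/2) = clt_rate H N"
      proof -
        have e: "(8 * H - 6) * (1/2) = 4 * H - 3" by (simp add: field_simps)
        show ?thesis unfolding powr_powr e using 3 by (simp add: clt_rate_def)
      qed
      finally show ?thesis .
    qed
    thus ?thesis using p by (intro exI[of _ "sqrt ((1 / (1 - p)) ^ 3)"]) auto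
  qed
  thus ?thesis unfolding p_def .
qed

lemma clt_rate_tendsto_0:
  assumes "H < 3/4" shows "clt_rate H \<longlonglongrightarrow> 0"
proof -
  consider "H < 5/8" | "H = 5/8" | "5/8 < H" by linarith
  thus ?thesis
  proof cases
    case 1
    have "(\<lambda>N. real N powr (-1/2)) \<longlonglongrightarrow> 0" by real_asymp
    thus ?thesis using 1 by (simp add: clt_rate_def[abs_def])
  next
    case 2
    have "(\<lambda>N. real N powr (-1/2) * ln (real N) powr (3/2)) \<longlonglongrightarrow> 0" by real_asymp
    thus ?thesis using 2 by (simp add: clt_rate_def[abs_def])
  next
    case 3
    have "(\<lambda>N. real N powr (4 * H - 3)) \<longlonglongrightarrow> 0"
      using assms by (intro tendsto_neg_powr filterlim_real_sequentially) auto
    thus ?thesis using 3 by (simp add: clt_rate_def[abs_def])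
  qed
qed

text \<open>With truncated subtraction, \<open>(i - j) + (j - i)\<close> is the distance of
  \<open>i\<close> and \<open>j\<close>. Each distance occurs at most once on either side of
  \<open>i\<close>; counting the diagonal twice is harmless.\<close>

lemma sum_abs_diff_le:
  fixes g :: "nat \<Rightarrow> real"
  assumes g: "\<And>m. 0 \<le> g m" and i: "i < n"
  shows "(\<Sum>j<n. g ((i - j) + (j - i))) \<le> 2 * (\<Sum>m<n. g m)"
proof -
  have "(\<Sum>j<n. g ((i - j) + (j - i))) \<le> (\<Sum>j<n. (if j \<le> i then g (i - j) else 0) + (if i \<le> j then g (j - i) else 0))"
    using g by (intro sum_mono) auto
  also have "\<dots> = (\<Sum>j\<in>{j\<in>{..<n}. j \<le> i}. g (i - j)) + (\<Sum>j\<in>{j\<in>{..<n}. i \<le> j}. g (j - i))"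
    unfolding sum.distrib by (simp only: sum.inter_filter finite_lessThan)
  also have "(\<Sum>j\<in>{j\<in>{..<n}. j \<le> i}. g (i - j)) = (\<Sum>m\<in>{..i}. g m)"
    using i by (intro sum.reindex_bij_witness[of _ "\<lambda>m. i - m" "\<lambda>j. i - j"]) auto
  also have "\<dots> \<le> (\<Sum>m<n. g m)" using i g by (intro sum_mono2) auto
  also have "(\<Sum>j\<in>{j\<in>{..<n}. i \<le> j}. g (j - i)) = (\<Sum>m\<in>{..<n - i}. g m)"
    by (intro sum.reindex_bij_witness[of _ "\<lambda>m. m + i" "\<lambda>j. j - i"]) auto
  also have "\<dots> \<le> (\<Sum>m<n. g m)" using g by (intro sum_mono2) auto
  finally show ?thesis by simp
qed

lemma sum_squares_lower:
  assumes "2 \<le> n" shows "real n ^ 3 / 12 \<le> (\<Sum>i<n. (real i)\<^sup>2)"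
proof -
  have "6 * (\<Sum>i<n. (real i)\<^sup>2) = (real n - 1) * real n * (2 * real n - 1)"
    by (induction n) (simp_all add: algebra_simps power2_eq_square)
  moreover have "real n / 2 * real n * real n \<le> (real n - 1) * real n * (2 * real n - 1)"
    using assms by (intro mult_mono) auto
  ultimately show ?thesis by (simp add: power3_eq_cube)
qed

text \<open>Numerator and denominator both scale with \<open>w\<^sup>2\<close>, so the size N^(-2H)
  of the variances cancels and only the decay of correlations is left.\<close>

lemma wave_incr_cov_ratio:
  assumes H: "1/2 \<le> H" "H < 1" and N: "2 \<le> N"
  defines "R \<equiv> wave_incr_cov H N"
  shows "0 < (\<Sum>i<N. \<Sum>j<N. (R i j)\<^sup>2)"
    and "8 * sqrt (2 * (\<Sum>i<N. \<Sum>j<N. (mat_sq N R i j)\<^sup>2)) / (\<Sum>i<N. \<Sum>j<N. (R i j)\<^sup>2)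
      \<le> 13824 * sqrt (power_sum ((8 - 8 * H) / 3) N ^ 3 / real N)"
proof -
  define w where "w = (1 / real N) powr (2 * H)"
  define A where "A = power_sum ((8 - 8 * H) / 3) N"
  define T where "T = (\<Sum>i<N. \<Sum>j<N. (R i j)\<^sup>2)"
  define U where "U = (\<Sum>i<N. \<Sum>j<N. (mat_sq N R i j)\<^sup>2)"
  have w: "0 < w" using N by (simp add: w_def)
  have A: "0 \<le> A" by (simp add: A_def power_sum_nonneg)
  \<comment> \<open>The cube root of the correlation decay: \<open>u i j ^ 3\<close> bounds the
    entries and \<open>u i j ^ 4\<close> carries the exponent of \<open>power_sum\<close>, as the
    cycle estimate requires.\<close>
  define u where "u i j = (1 + real ((i - j) + (j - i))) powr ((2 * H - 2) / 3)" for i j :: nat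
  have u3: "u i j ^ 3 = (1 + real ((i - j) + (j - i))) powr (2 * H - 2)" for i j
    unfolding u_def by (subst powr_power, simp, rule arg_cong2[of _ _ _ _ "(powr)"], rule refl, simp add: field_simps)
  have u4: "u i j ^ 4 = (1 + real ((i - j) + (j - i))) powr (- ((8 - 8 * H) / 3))" for i j
    unfolding u_def by (subst powr_power, simp, rule arg_cong2[of _ _ _ _ "(powr)"], rule refl, simp add: field_simps)
  have R0: "0 \<le> R i j" if "i < N" "j < N" for i j
    unfolding R_def by (rule wave_incr_cov_bounds(1)[OF H that])
  have Ru: "R i j \<le> 3 * w * u i j ^ 3" if ij: "i < N" "j < N" for i j
  proof -
    have "fgn_cov H (real i - real j) = fgn_cov H (real ((i - j) + (j - i)))"
      using fgn_cov_minus[of H "real j - real i"] by (cases "i \<le> j") (auto simp: of_nat_diff)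
    hence "fgn_cov H (real i - real j) \<le> 6 * u i j ^ 3"
      unfolding u3 using fgn_cov_le[OF H, of "(i - j) + (j - i)"] by simp
    from mult_left_mono[OF this, of "1/2 * w"] w
    have "1/2 * w * fgn_cov H (real i - real j) \<le> 3 * w * u i j ^ 3" by simp
    thus ?thesis using wave_incr_cov_bounds(2)[OF H ij] unfolding R_def w_def by linarith
  qed
  \<comment> \<open>The diagonal alone suffices. The variances are small for small \<open>i\<close>,
    but averaging (i / (2N))^2 over \<open>i\<close> still leaves a fixed proportion, at least 1/48
    = 1/4 * 1/12.\<close>
  have T: "w\<^sup>2 * real N / 48 \<le> T"
  proof -
    have "w\<^sup>2 * real N / 48 = w\<^sup>2 / (4 * (real N)\<^sup>2) * (real N ^ 3 / 12)"
      using N by (simp add: power2_eq_square power3_eq_cube)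
    also have "\<dots> \<le> w\<^sup>2 / (4 * (real N)\<^sup>2) * (\<Sum>i<N. (real i)\<^sup>2)"
      by (intro mult_left_mono sum_squares_lower N) simp
    also have "\<dots> = (\<Sum>i<N. (1/2 * (real i / real N) * w)\<^sup>2)"
      by (simp add: sum_distrib_left sum_divide_distrib power_mult_distrib power_divide mult_ac)
    also have "\<dots> \<le> (\<Sum>i<N. (R i i)\<^sup>2)"
      using wave_incr_cov_bounds(3)[OF H] w unfolding R_def w_def by (intro sum_mono power_mono) auto
    also have "\<dots> \<le> T"
      unfolding T_def by (intro sum_mono member_le_sum) auto
    finally show ?thesis .
  qed
  have T0: "0 < T" using T w N by (intro less_le_trans[OF _ T]) simp
  thus "0 < (\<Sum>i<N. \<Sum>j<N. (R i j)\<^sup>2)" by (simp add: T_def)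
  have "U \<le> (\<Sum>i<N. \<Sum>j<N. (9 * w\<^sup>2 * (\<Sum>k<N. u i k ^ 3 * u k j ^ 3))\<^sup>2)"
    unfolding U_def
  proof (intro sum_mono power_mono)
    fix i j assume ij: "i \<in> {..<N}" "j \<in> {..<N}"
    \<comment> \<open>Nonnegative entries let the entrywise upper bounds pass to products and
      squares.\<close>
    show "0 \<le> mat_sq N R i j" unfolding mat_sq_def using ij R0 by (intro sum_nonneg mult_nonneg_nonneg) auto
    have "mat_sq N R i j \<le> (\<Sum>k<N. (3 * w * u i k ^ 3) * (3 * w * u k j ^ 3))"
      unfolding mat_sq_def using ij R0 Ru w by (intro sum_mono mult_mono) (auto simp: u_def)
    also have "\<dots> = 9 * w\<^sup>2 * (\<Sum>k<N. u i k ^ 3 * u k j ^ 3)"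
      by (simp add: sum_distrib_left power2_eq_square mult_ac)
    finally show "mat_sq N R i j \<le> 9 * w\<^sup>2 * (\<Sum>k<N. u i k ^ 3 * u k j ^ 3)" .
  qed
  also have "\<dots> = 81 * w ^ 4 * (\<Sum>i<N. \<Sum>j<N. (\<Sum>k<N. u i k ^ 3 * u k j ^ 3)\<^sup>2)"
  proof -
    have "(9 * w\<^sup>2 * s)\<^sup>2 = 81 * w ^ 4 * s\<^sup>2" for s by (simp add: power_mult_distrib)
    thus ?thesis by (simp only: sum_distrib_left[symmetric])
  qed
  also have "\<dots> \<le> 81 * w ^ 4 * (real N * (2 * A) ^ 3)"
  proof (intro mult_left_mono sum_cycle_le)
    show "u i j = u j i" for i j by (simp add: u_def add.commute)
    show "(\<Sum>j<N. u i j ^ 4) \<le> 2 * A" if "i < N" for i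
      unfolding u4 A_def power_sum_def
      by (rule sum_abs_diff_le[where g = "\<lambda>m. (1 + real m) powr (- ((8 - 8 * H) / 3))"]) (use that in auto)
  qed (use w in auto)
  finally have U: "U \<le> 81 * w ^ 4 * (real N * (2 * A) ^ 3)" .
  \<comment> \<open>The constant: 2 * 81 * 2^3 = 36^2 comes out of the square root, and 8 * 36 * 48
    = 13824.\<close>
  have "8 * sqrt (2 * U) / T \<le> 8 * sqrt (2 * (81 * w ^ 4 * (real N * (2 * A) ^ 3))) / (w\<^sup>2 * real N / 48)"
    using U T T0 w N A by (intro frac_le mult_left_mono real_sqrt_le_mono) auto
  also have "2 * (81 * w ^ 4 * (real N * (2 * A) ^ 3)) = (36 * w\<^sup>2 * real N)\<^sup>2 * (A ^ 3 / real N)"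
    using N by (simp add: power_mult_distrib power2_eq_square power4_eq_xxxx)
  also have "sqrt \<dots> = 36 * w\<^sup>2 * real N * sqrt (A ^ 3 / real N)"
    unfolding real_sqrt_mult using w by simp
  also have "8 * (36 * w\<^sup>2 * real N * sqrt (A ^ 3 / real N)) / (w\<^sup>2 * real N / 48) = 13824 * sqrt (A ^ 3 / real N)"
    using w N by (simp add: field_simps)
  finally show "8 * sqrt (2 * (\<Sum>i<N. \<Sum>j<N. (mat_sq N R i j)\<^sup>2)) / (\<Sum>i<N. \<Sum>j<N. (R i j)\<^sup>2)
      \<le> 13824 * sqrt (power_sum ((8 - 8 * H) / 3) N ^ 3 / real N)"
    unfolding A_def T_def U_def .
qed

section \<open>The quadratic variation of the mild solution\<close>

lemma sum_increment_eq:
  fixes U :: "nat \<Rightarrow> real"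
  shows "(\<Sum>i<n. \<theta> i * (U (Suc i) - U i)) = (\<Sum>k<Suc n. ((if k = 0 then 0 else \<theta> (k - 1)) - (if k < n then \<theta> k else 0)) * U k)"
proof -
  have "(\<Sum>k<Suc n. (if k = 0 then 0 else \<theta> (k - 1)) * U k) = (\<Sum>i<n. \<theta> i * U (Suc i))"
    by (subst sum.lessThan_Suc_shift) simp
  moreover have "(\<Sum>k<Suc n. (if k < n then \<theta> k else 0) * U k) = (\<Sum>i<n. \<theta> i * U i)"
    by (simp add: sum.lessThan_Suc)
  ultimately show ?thesis by (simp add: left_diff_distrib right_diff_distrib sum_subtractf)
qed

context fractional_white_noise
begin

text \<open>Joint normality is assumed for sets of integrands, while a vector may repeat an
  integrand; the coefficients are therefore collected over the indices sharing the same one.\<close>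

lemma gaussian_vector_W:
  assumes F: "\<And>i. i < n \<Longrightarrow> wiener_integrand H (F i)"
  shows "gaussian_vector M n (\<lambda>i. W (F i))"
proof
  show "W (F i) \<in> borel_measurable M" if "i < n" for i by (rule measurable_W[OF F[OF that]])
  fix \<theta> :: "nat \<Rightarrow> real"
  have e: "(\<Sum>i<n. \<theta> i * W (F i) \<omega>) = (\<Sum>f\<in>F ` {..<n}. (\<Sum>i\<in>{i\<in>{..<n}. F i = f}. \<theta> i) * W f \<omega>)" for \<omega>
  proof -
    have "(\<Sum>i<n. \<theta> i * W (F i) \<omega>) = (\<Sum>f\<in>F ` {..<n}. \<Sum>i\<in>{i\<in>{..<n}. F i = f}. \<theta> i * W (F i) \<omega>)"
      by (rule sum.image_gen) simp
    also have "\<dots> = (\<Sum>f\<in>F ` {..<n}. (\<Sum>i\<in>{i\<in>{..<n}. F i = f}. \<theta> i) * W f \<omega>)"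
      unfolding sum_distrib_right by (intro sum.cong refl) auto
    finally show ?thesis .
  qed
  show "\<exists>\<sigma>\<ge>0. distr M borel (\<lambda>\<omega>. \<Sum>i<n. \<theta> i * W (F i) \<omega>) = centered_normal \<sigma>"
    unfolding e by (rule gaussian_W) (use F in auto)
qed

lemma increment_eq:
  "increment W x N i \<omega> = W (wave_integrand x (real (Suc i) / real N)) \<omega> - W (wave_integrand x (real i / real N)) \<omega>"
  by (simp add: increment_def mild_solution_eq)

lemma gaussian_vector_increment:
  assumes H: "1/2 \<le> H"
  shows "gaussian_vector M N (increment W x N)"
proof -
  define F where "F i = wave_integrand x (real i / real N)" for i
  interpret U: gaussian_vector M "Suc N" "\<lambda>i. W (F i)"
    by (rule gaussian_vector_W) (simp add: F_def wiener_integrand_wave[OF H])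
  have inc: "increment W x N i \<omega> = W (F (Suc i)) \<omega> - W (F i) \<omega>" for i \<omega>
    by (simp add: increment_eq F_def)
  show ?thesis
  proof
    show "increment W x N i \<in> borel_measurable M" if "i < N" for i
    proof -
      have "(\<lambda>\<omega>. W (F (Suc i)) \<omega> - W (F i) \<omega>) \<in> borel_measurable M"
        using U.measurable_X[of "Suc i"] U.measurable_X[of i] that by (intro borel_measurable_diff) auto
      thus ?thesis unfolding inc[symmetric] by simp
    qed
    show "\<exists>\<sigma>\<ge>0. distr M borel (\<lambda>\<omega>. \<Sum>i<N. \<theta> i * increment W x N i \<omega>) = centered_normal \<sigma>" for \<theta>
      \<comment> \<open>Summation by parts turns a combination of \<open>N\<close> increments into
        one of \<open>N + 1\<close> field values, which is normal.\<close>
      unfolding inc sum_increment_eq[where U = "\<lambda>k. W (F k) _"] by (rule U.normal_X)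
  qed
qed

lemma covar_increment:
  assumes H: "1/2 \<le> H"
  shows "gaussian_vector.covar M (increment W x N) i j = wave_incr_cov H N i j"
proof -
  define F where "F i = wave_integrand x (real i / real N)" for i
  \<comment> \<open>Large enough to contain \<open>Suc i\<close> and \<open>Suc j\<close> for
    arbitrary indices, so the covariance formula becomes an equality of functions.\<close>
  define n where "n = Suc (Suc (max i j))"
  interpret U: gaussian_vector M n "\<lambda>i. W (F i)"
    by (rule gaussian_vector_W) (simp add: F_def wiener_integrand_wave[OF H])
  interpret I: gaussian_vector M N "increment W x N" by (rule gaussian_vector_increment[OF H])
  have inc: "increment W x N i \<omega> = W (F (Suc i)) \<omega> - W (F i) \<omega>" for i \<omega>
    by (simp add: increment_eq F_def)
  have c: "expectation (\<lambda>\<omega>. W (F k) \<omega> * W (F l) \<omega>) = wave_cov H (real k / real N) (real l / real N)" for k l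
    unfolding F_def by (subst covariance_W) (auto simp: wiener_integrand_wave[OF H] noise_inner_wave[OF H])
  have i: "integrable M (\<lambda>\<omega>. W (F k) \<omega> * W (F l) \<omega>)" if "k < n" "l < n" for k l
    by (rule U.integrable_X_X[OF that])
  have lt: "i < n" "Suc i < n" "j < n" "Suc j < n" by (auto simp: n_def)
  have "I.covar i j = expectation (\<lambda>\<omega>. W (F (Suc i)) \<omega> * W (F (Suc j)) \<omega> - W (F (Suc i)) \<omega> * W (F j) \<omega>
     - W (F i) \<omega> * W (F (Suc j)) \<omega> + W (F i) \<omega> * W (F j) \<omega>)"
    unfolding I.covar_def inc by (simp add: algebra_simps)
  also have "\<dots> = wave_incr_cov H N i j"
    using i lt by (simp add: c wave_incr_cov_def)
  finally show ?thesis .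
qed

lemma normalized_variation_bounds:
  assumes H: "1/2 \<le> H" "H < 1" and N: "2 \<le> N"
    and d: "d \<in> {kolmogorov_dist, wasserstein_dist, total_variation_dist}"
  shows "d (distr M borel (normalized_variation M W x N)) std_normal_distribution
    \<le> ennreal (13824 * sqrt (power_sum ((8 - 8 * H) / 3) N ^ 3 / real N))"
proof -
  interpret I: gaussian_vector M N "increment W x N" by (rule gaussian_vector_increment[OF H(1)])
  define T where "T = (\<Sum>i<N. \<Sum>j<N. (I.covar i j)\<^sup>2)"
  define V where "V \<omega> = (\<Sum>i<N. (increment W x N i \<omega>)\<^sup>2) - (\<Sum>i<N. I.covar i i)" for \<omega>
  have cov: "I.covar = wave_incr_cov H N" using covar_increment[OF H(1)] by (intro ext)
  note R = wave_incr_cov_ratio[OF H N]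
  have T: "0 < T" using R(1) by (simp add: T_def cov)
  have "quadratic_variation M W x N \<omega> = V \<omega> / real N" for \<omega>
    by (simp add: quadratic_variation_def V_def I.covar_def sum_subtractf power2_eq_square)
  hence qv: "quadratic_variation M W x N = (\<lambda>\<omega>. V \<omega> / real N)" by auto
  note B = I.clt_distance_bounds[folded T_def, OF T refl]
  \<comment> \<open>The factor 1/N scales the variation and its standard deviation alike and cancels
    in the normalised quantity.\<close>
  have "expectation (\<lambda>\<omega>. (V \<omega> / real N)\<^sup>2) = 2 * T / (real N)\<^sup>2"
    using B(1) by (simp add: V_def power_divide)
  hence "normalized_variation M W x N = (\<lambda>\<omega>. V \<omega> / sqrt (2 * T))"
    using N by (simp add: normalized_variation_def[abs_def] qv real_sqrt_divide)
  hence nv: "normalized_variation M W x N = (\<lambda>\<omega>. ((\<Sum>i<N. (increment W x N i \<omega>)\<^sup>2) - (\<Sum>i<N. I.covar i i)) / sqrt (2 * T))"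
    by (simp add: V_def)
  have "d (distr M borel (normalized_variation M W x N)) std_normal_distribution
     \<le> ennreal (8 * sqrt (2 * (\<Sum>i<N. \<Sum>j<N. (mat_sq N I.covar i j)\<^sup>2)) / T)"
    unfolding nv using B(2-4) d by auto
  also have "\<dots> \<le> ennreal (13824 * sqrt (power_sum ((8 - 8 * H) / 3) N ^ 3 / real N))"
    using R(2) by (intro ennreal_leI) (simp add: T_def cov)
  finally show ?thesis .
qed

end

theorem theorem3:
  fixes H :: real
  assumes "1/2 \<le> H" and "H < 3/4"
  shows "(\<forall>(M :: 'a measure) W x. fractional_white_noise M H W \<longrightarrow>
      weak_conv_m (\<lambda>N. distr M borel (normalized_variation M W x N)) std_normal_distribution)
    \<and> (\<forall>d \<in> {kolmogorov_dist, wasserstein_dist, total_variation_dist}.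
      \<exists>C :: real. \<forall>(M :: 'a measure) W x. fractional_white_noise M H W \<longrightarrow>
        (\<forall>\<^sub>F N in sequentially.
          d (distr M borel (normalized_variation M W x N)) std_normal_distribution
            \<le> ennreal (C * clt_rate H N)))"
proof -
  \<comment> \<open>The constant is fixed before \<open>M\<close>, \<open>W\<close> and
    \<open>x\<close> appear, so it depends on \<open>H\<close> only.\<close>
  obtain C where C: "0 \<le> C" "\<And>N. 2 \<le> N \<Longrightarrow> sqrt (power_sum ((8 - 8 * H) / 3) N ^ 3 / real N) \<le> C * clt_rate H N"
    using power_sum_rate[OF assms] by blast
  have main: "d (distr M borel (normalized_variation M W x N)) std_normal_distribution \<le> ennreal (13824 * C * clt_rate H N)"
    if "fractional_white_noise M H W" "d \<in> {kolmogorov_dist, wasserstein_dist, total_variation_dist}" "2 \<le> N"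
    for M :: "'a measure" and W x d N
  proof -
    interpret fractional_white_noise M H W by fact
    have "d (distr M borel (normalized_variation M W x N)) std_normal_distribution
        \<le> ennreal (13824 * sqrt (power_sum ((8 - 8 * H) / 3) N ^ 3 / real N))"
      using assms that by (intro normalized_variation_bounds) auto
    also have "\<dots> \<le> ennreal (13824 * C * clt_rate H N)"
      using C(2)[OF that(3)] by (intro ennreal_leI) simp
    finally show ?thesis .
  qed
  show ?thesis
  proof (intro conjI allI impI ballI)
    fix M :: "'a measure" and W x
    assume W: "fractional_white_noise M H W"
    show "weak_conv_m (\<lambda>N. distr M borel (normalized_variation M W x N)) std_normal_distribution"
      unfolding weak_conv_m_def weak_conv_def
    proof (intro allI impI)
      fix z :: real
      let ?\<mu> = "\<lambda>N. distr M borel (normalized_variation M W x N)"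
      \<comment> \<open>Convergence in law is read off from the Kolmogorov bound: the distribution
        functions converge at every point, with the same rate.\<close>
      have b: "\<bar>cdf (?\<mu> N) z - cdf std_normal_distribution z\<bar> \<le> 13824 * C * clt_rate H N" if N: "2 \<le> N" for N
      proof -
        have "ennreal \<bar>cdf (?\<mu> N) z - cdf std_normal_distribution z\<bar> \<le> kolmogorov_dist (?\<mu> N) std_normal_distribution"
          unfolding kolmogorov_dist_def cdf_def by (intro SUP_upper) simp
        also have "\<dots> \<le> ennreal (13824 * C * clt_rate H N)" using main[OF W _ N] by simp
        finally show ?thesis
          using C(1) by (subst (asm) ennreal_le_iff) (auto simp: clt_rate_def)
      qed
      have "(\<lambda>N. cdf (?\<mu> N) z - cdf std_normal_distribution z) \<longlonglongrightarrow> 0"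
      proof (rule Lim_null_comparison)
        show "\<forall>\<^sub>F N in sequentially. norm (cdf (?\<mu> N) z - cdf std_normal_distribution z) \<le> 13824 * C * clt_rate H N"
          using eventually_ge_at_top[of 2] by eventually_elim (use b in simp)
        show "(\<lambda>N. 13824 * C * clt_rate H N) \<longlonglongrightarrow> 0"
          using tendsto_mult_left[OF clt_rate_tendsto_0[OF assms(2)], of "13824 * C"] by simp
      qed
      thus "(\<lambda>N. cdf (?\<mu> N) z) \<longlonglongrightarrow> cdf std_normal_distribution z" by (rule LIM_zero_cancel)
    qed
  next
    fix d assume d: "d \<in> {kolmogorov_dist, wasserstein_dist, total_variation_dist}"
    show "\<exists>C :: real. \<forall>(M :: 'a measure) W x. fractional_white_noise M H W \<longrightarrow>
        (\<forall>\<^sub>F N in sequentially.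
          d (distr M borel (normalized_variation M W x N)) std_normal_distribution \<le> ennreal (C * clt_rate H N))"
    proof (intro exI allI impI)
      fix M :: "'a measure" and W x assume W: "fractional_white_noise M H W"
      show "\<forall>\<^sub>F N in sequentially. d (distr M borel (normalized_variation M W x N)) std_normal_distribution
          \<le> ennreal (13824 * C * clt_rate H N)"
        using eventually_ge_at_top[of 2] by eventually_elim (rule main[OF W d])
    qed
  qed
qed

end
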